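(* The Shabat polynomials of the two trees with passport $[4^3,1^8;2^{10};20]$ are (up to equivalence) $Q_1(P(x))$ and $Q_2(R(x))$, one for each tree, where $$Q_1(x)=x\left(x-\frac14\right),\quad P(x)=A(B(x)),\quad A(x)=(x-1)^4\left(x+\frac14\right),\quad B(x)=(4x+4)x+1,$$ $$Q_2(x)=x\left(x-\frac{512}{3}\right),\quad R(x)=(x^2+3)^4\left(x-\frac53-\frac{\sqrt{-2}}{3}\right)\left(x-\frac53+\frac{\sqrt{-2}}{3}\right).$$
   Context: A Shabat polynomial is a complex polynomial with at most two finite critical values $c_1,c_2$. Its tree is the bicolored plane tree $P^{-1}([c_1,c_2])$, with black vertices the points of $P^{-1}(c_1)$, white vertices the points of $P^{-1}(c_2)$, edges the connected components of the preimage of the open segment $(c_1,c_2)$, and vertex degree equal to the multiplicity of the corresponding root of $P-c_1$ or $P-c_2$. Two Shabat polynomials $P,Q$ (with ordered critical values $c_{1,1},c_{1,2}$ and $c_{2,1},c_{2,2}$) are equivalent if $Q(x)=AP(ax+b)+B$ with $A,a\ne 0$ and $c_{2,j}=Ac_{1,j}+B$ for $j=1,2$; bicolored plane trees (up to color- and orientation-preserving isomorphism) correspond bijectively to Shabat polynomials up to equivalence. The passport $[\alpha;\beta;n]$ of a tree with $n$ edges records the partition $\alpha\vdash n$ of black vertex degrees and $\beta\vdash n$ of white vertex degrees ($k^m$ means $k$ repeated $m$ times). There are exactly two trees with passport $[4^3,1^8;2^{10};20]$. In the claim, $c_1=0$ for both compositions. *)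

theory Defs
  imports
    "HOL-Analysis.Analysis"
    "HOL-Combinatorics.Combinatorics"
    "HOL-Computational_Algebra.Computational_Algebra"
begin

section \<open>Bicolored plane trees\<close>

text \<open>
  A plane tree is a tree together with, for every vertex, a cyclic (counterclockwise) order of
  the edges at that vertex.  Each edge has one black and one white endpoint, so the cyclic orders
  are given by two functions on edges: \<open>black_rot T e\<close> (\<open>white_rot T e\<close>) is the edge following
  \<open>e\<close> counterclockwise around its black (white) endpoint.
\<close>

record ('v, 'e) bicolored_map =
  blacks :: "'v set"
  whites :: "'v set"
  edges :: "'e set"
  black_end :: "'e \<Rightarrow> 'v"
  white_end :: "'e \<Rightarrow> 'v"
  black_rot :: "'e \<Rightarrow> 'e"
  white_rot :: "'e \<Rightarrow> 'e"

definition edges_at_black :: "('v, 'e) bicolored_map \<Rightarrow> 'v \<Rightarrow> 'e set" where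
  "edges_at_black T v = {e \<in> edges T. black_end T e = v}"

definition edges_at_white :: "('v, 'e) bicolored_map \<Rightarrow> 'v \<Rightarrow> 'e set" where
  "edges_at_white T v = {e \<in> edges T. white_end T e = v}"

definition map_connected :: "('v, 'e) bicolored_map \<Rightarrow> bool" where
  "map_connected T \<longleftrightarrow>
     (\<forall>u \<in> blacks T \<union> whites T. \<forall>v \<in> blacks T \<union> whites T.
        (u, v) \<in> ((\<lambda>e. (black_end T e, white_end T e)) ` edges T \<union>
                  (\<lambda>e. (white_end T e, black_end T e)) ` edges T)\<^sup>*)"

text \<open>
  A cycle is given by its list of edges.  As the colors alternate, it has even length \<open>2 * k\<close>, and
  consecutive edges share alternately a black and a white endpoint.  The case \<open>k = 1\<close> is a pair
  of parallel edges.
\<close>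

definition is_cycle :: "('v, 'e) bicolored_map \<Rightarrow> 'e list \<Rightarrow> bool" where
  "is_cycle T es \<longleftrightarrow>
     (\<exists>k>0. length es = 2 * k \<and> distinct es \<and> set es \<subseteq> edges T \<and>
        (\<forall>i<k. black_end T (es ! (2 * i)) = black_end T (es ! (2 * i + 1)) \<and>
               white_end T (es ! (2 * i + 1)) = white_end T (es ! ((2 * i + 2) mod (2 * k)))) \<and>
        inj_on (\<lambda>i. black_end T (es ! (2 * i))) {..<k} \<and>
        inj_on (\<lambda>i. white_end T (es ! (2 * i + 1))) {..<k})"

text \<open>
  \<open>cyclic_on\<close> makes the rotation a single cycle on the edges at each vertex.  Trees without
  edges have no meaningful passport here and are excluded.
\<close>

definition bicolored_plane_tree :: "('v, 'e) bicolored_map \<Rightarrow> bool" where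
  "bicolored_plane_tree T \<longleftrightarrow>
     finite (blacks T) \<and> finite (whites T) \<and> finite (edges T) \<and> edges T \<noteq> {} \<and>
     blacks T \<inter> whites T = {} \<and>
     black_end T ` edges T \<subseteq> blacks T \<and> white_end T ` edges T \<subseteq> whites T \<and>
     map_connected T \<and> (\<nexists>es. is_cycle T es) \<and>
     (\<forall>v \<in> blacks T. cyclic_on (black_rot T) (edges_at_black T v)) \<and>
     (\<forall>v \<in> whites T. cyclic_on (white_rot T) (edges_at_white T v))"

text \<open>Isomorphisms preserve colors, incidence, and the counterclockwise orders.\<close>

definition tree_iso :: "('v, 'e) bicolored_map \<Rightarrow> ('w, 'f) bicolored_map \<Rightarrow> bool" where
  "tree_iso S T \<longleftrightarrow>
     (\<exists>p q h. bij_betw p (blacks S) (blacks T) \<and> bij_betw q (whites S) (whites T) \<and>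
        bij_betw h (edges S) (edges T) \<and>
        (\<forall>e \<in> edges S.
           black_end T (h e) = p (black_end S e) \<and> white_end T (h e) = q (white_end S e) \<and>
           black_rot T (h e) = h (black_rot S e) \<and> white_rot T (h e) = h (white_rot S e)))"

definition has_passport ::
    "('v, 'e) bicolored_map \<Rightarrow> nat multiset \<Rightarrow> nat multiset \<Rightarrow> nat \<Rightarrow> bool" where
  "has_passport T \<alpha> \<beta> n \<longleftrightarrow>
     image_mset (\<lambda>v. card (edges_at_black T v)) (mset_set (blacks T)) = \<alpha> \<and>
     image_mset (\<lambda>v. card (edges_at_white T v)) (mset_set (whites T)) = \<beta> \<and>
     card (edges T) = n"

section \<open>Shabat polynomials and their trees\<close>

definition shabat :: "complex poly \<Rightarrow> complex \<Rightarrow> complex \<Rightarrow> bool" where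
  "shabat F c1 c2 \<longleftrightarrow>
     degree F > 0 \<and> c1 \<noteq> c2 \<and> (\<forall>z. poly (pderiv F) z = 0 \<longrightarrow> poly F z \<in> {c1, c2})"

definition shabat_equiv ::
    "complex poly \<Rightarrow> complex \<Rightarrow> complex \<Rightarrow> complex poly \<Rightarrow> complex \<Rightarrow> complex \<Rightarrow> bool" where
  "shabat_equiv F c11 c12 G c21 c22 \<longleftrightarrow>
     (\<exists>A B a b. A \<noteq> 0 \<and> a \<noteq> 0 \<and> G = smult A (F \<circ>\<^sub>p [:b, a:]) + [:B:] \<and>
        c21 = A * c11 + B \<and> c22 = A * c12 + B)"

text \<open>
  The counterclockwise order of the edges of an embedded tree \<open>K\<close> around a vertex \<open>v\<close>: on every
  sufficiently small circle around \<open>v\<close>, starting at the point of the edge \<open>e\<close> and moving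
  counterclockwise, the first point of \<open>K\<close> that is met (after a positive angle) lies on \<open>e'\<close>.
  If \<open>e\<close> is the only edge at \<open>v\<close>, this is \<open>e\<close> itself, after a full turn.
\<close>

definition next_ccw :: "complex set \<Rightarrow> complex \<Rightarrow> complex set \<Rightarrow> complex set \<Rightarrow> bool" where
  "next_ccw K v e e' \<longleftrightarrow>
     (\<forall>\<^sub>F \<epsilon> in at_right 0. \<exists>\<theta> \<phi>. \<phi> > 0 \<and>
        v + rcis \<epsilon> \<theta> \<in> e \<and> v + rcis \<epsilon> (\<theta> + \<phi>) \<in> e' \<and>
        (\<forall>\<psi>. 0 < \<psi> \<and> \<psi> < \<phi> \<longrightarrow> v + rcis \<epsilon> (\<theta> + \<psi>) \<notin> K))"

definition shabat_edges :: "complex poly \<Rightarrow> complex \<Rightarrow> complex \<Rightarrow> complex set set" where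
  "shabat_edges F c1 c2 = components (poly F -` open_segment c1 c2)"

definition edge_end :: "complex poly \<Rightarrow> complex \<Rightarrow> complex set \<Rightarrow> complex" where
  "edge_end F c e = (THE v. poly F v = c \<and> v \<in> closure e)"

definition edge_rot ::
    "complex poly \<Rightarrow> complex \<Rightarrow> complex \<Rightarrow> complex \<Rightarrow> complex set \<Rightarrow> complex set" where
  "edge_rot F c1 c2 c e =
     (THE e'. e' \<in> shabat_edges F c1 c2 \<and>
        next_ccw (poly F -` closed_segment c1 c2) (edge_end F c e) e e')"

definition shabat_tree ::
    "complex poly \<Rightarrow> complex \<Rightarrow> complex \<Rightarrow> (complex, complex set) bicolored_map" where
  "shabat_tree F c1 c2 =
     \<lparr> blacks = poly F -` {c1},
       whites = poly F -` {c2},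
       edges = shabat_edges F c1 c2,
       black_end = edge_end F c1,
       white_end = edge_end F c2,
       black_rot = edge_rot F c1 c2 c1,
       white_rot = edge_rot F c1 c2 c2 \<rparr>"

section \<open>The two compositions\<close>

definition Q1_poly :: "complex poly" where
  "Q1_poly = [:0, 1:] * [:- (1/4), 1:]"

definition A_poly :: "complex poly" where
  "A_poly = [:- 1, 1:] ^ 4 * [:1/4, 1:]"

definition B_poly :: "complex poly" where
  "B_poly = [:4, 4:] * [:0, 1:] + 1"

definition P_poly :: "complex poly" where
  "P_poly = A_poly \<circ>\<^sub>p B_poly"

definition Q2_poly :: "complex poly" where
  "Q2_poly = [:0, 1:] * [:- (512/3), 1:]"

definition R_poly :: "complex poly" where
  "R_poly = [:3, 0, 1:] ^ 4 * [:- (5/3) - csqrt (- 2) / 3, 1:] * [:- (5/3) + csqrt (- 2) / 3, 1:]"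

end

theory Submission
  imports Defs "HOL-Complex_Analysis.Complex_Analysis"
begin

text \<open>
  After normalizing the critical values to 0 and 1, a Shabat polynomial \<open>f\<close> is a covering over the
  complement of \<open>{0, 1}\<close>, so each edge is the image of a branch of the inverse of \<open>f\<close> on the open unit interval.
  Near a root of multiplicity \<open>m\<close>, the preimage of the interval consists of \<open>m\<close> rays in cyclic order,
  which gives the vertex degrees and the rotations.  By the maximum principle for \<open>Im f\<close> no part of
  the tree separates the plane, so Janiszewski's theorem excludes cycles; as \<open>f'\<close> has
  degree \<open>n - 1\<close>, there are \<open>n + 1\<close> vertices, and a forest with \<open>n\<close> edges on them is connected.

  A plane tree with the given passport is a path of three vertices of degree 4 with leaves attached, and it is
  determined by whether the two inner edges at the middle vertex are adjacent or opposite.  The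
  symmetry \<open>z \<mapsto> -1 - z\<close> shows that the tree of the first composition is the opposite one,
  and complex conjugation shows that the tree of the second is the adjacent one.

  Conversely, if \<open>f\<close> has the passport, then \<open>f - 1 = k w^2\<close>, and the fourth powers divide \<open>w - \<sigma>\<close>
  and \<open>w + \<sigma>\<close> for a constant \<open>\<sigma>\<close>.  Comparing coefficients leaves, up to affine maps, only the
  two compositions.  So no general uniqueness theorem for Shabat polynomials is needed.
\<close>

section \<open>Edges as branches of the inverse\<close>

text \<open>All topology is done for the critical values 0 and 1 and for black vertices only; white
  vertices are reached through \<open>1 - f\<close>. The plane enters only through the order of rays
  on small circles and the absence of bypasses around an edge. Afterwards trees are compared by
  their rotations alone, hence by finite tables.

  The tables of the two explicit trees are not found by following edges. By its passport each tree
  is one of two candidates, and the wrong one is refuted by a symmetry that fixes no edge: a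
  rotation-preserving map of the adjacent tree and a rotation-reversing map of the opposite tree
  both fix an edge.

  That isomorphic trees come from equivalent polynomials is obtained by elimination: a polynomial
  whose tree is one of the two has the passport, so it is equivalent to one of the compositions; as
  equivalence yields isomorphic trees and the two trees are not isomorphic, it is the right one.

  The outer polynomial \<open>x * (x - w)\<close> has its critical point at \<open>w / 2\<close>,
  with value \<open>- (w ^ 2 / 4)\<close>; this gives -1/64 for \<open>w = 1/4\<close> and -65536/9
  for \<open>w = 512/3\<close>.\<close>

lemma card_roots_if_simple:
  fixes p :: "complex poly"
  assumes "degree p > 0" and simple: "\<And>z. poly p z = 0 \<Longrightarrow> poly (pderiv p) z \<noteq> 0"
  shows "card {z. poly p z = 0} = degree p"
proof -
  have p0: "p \<noteq> 0" using assms(1) by auto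
  have o: "Polynomial.order z p = 1" if "poly p z = 0" for z
  proof -
    have "Polynomial.order z p \<noteq> 0" using that p0 by (simp add: order_root)
    moreover have "Polynomial.order z (pderiv p) = 0"
      using simple[OF that] by (simp add: order_0I)
    moreover have "pderiv p \<noteq> 0" using simple[OF that] by auto
    ultimately show ?thesis by (metis order_pderiv2 One_nat_def)
  qed
  have "degree p = size (proots p)" by (simp add: size_proots_complex)
  also have "\<dots> = (\<Sum>z\<in>set_mset (proots p). count (proots p) z)" by (rule size_multiset_overloaded_eq)
  also have "\<dots> = (\<Sum>z\<in>{z. poly p z = 0}. 1)"
    using p0 by (intro sum.cong) (auto simp: o)
  finally show ?thesis by simp
qed

text \<open>A multiple root of \<open>f - w\<close> would be a critical point, where
  \<open>f\<close> takes only the values 0 and 1.\<close>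

lemma shabat_fibre:
  assumes "shabat f 0 1" "w \<notin> {0, 1}"
  shows "finite {z. poly f z = w}" "card {z. poly f z = w} = degree f"
proof -
  let ?p = "f - [:w:]"
  have d: "degree f > 0" "degree ?p = degree f"
  proof -
    show *: "degree f > 0" using assms(1) by (simp add: shabat_def)
    have eq: "?p = f + [:- w:]" by simp
    show "degree ?p = degree f" unfolding eq by (rule degree_add_eq_left) (use * in simp)
  qed
  have pd: "pderiv ?p = pderiv f" by (simp add: pderiv_diff pderiv_pCons)
  have eq: "{z. poly f z = w} = {z. poly ?p z = 0}" by auto
  have "card {z. poly ?p z = 0} = degree ?p"
  proof (rule card_roots_if_simple)
    show "degree ?p > 0" using d by simp
    fix z assume "poly ?p z = 0"
    then show "poly (pderiv ?p) z \<noteq> 0" using assms unfolding pd by (auto simp: shabat_def)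
  qed
  then show "card {z. poly f z = w} = degree f" by (simp only: eq d(2))
  show "finite {z. poly f z = w}" unfolding eq
    using d by (intro poly_roots_finite) auto
qed

lemma finite_separating_radius:
  fixes Z :: "complex set"
  assumes "finite Z"
  obtains \<rho> where "\<rho> > 0" "\<And>x y. x \<in> Z \<Longrightarrow> y \<in> Z \<Longrightarrow> x \<noteq> y \<Longrightarrow> ball x \<rho> \<inter> ball y \<rho> = {}"
proof -
  \<comment> \<open>The extra element 1 keeps \<open>Min D\<close> defined and positive when
    \<open>Z\<close> has fewer than two points.\<close>
  define D where "D = insert 1 ((\<lambda>(x,y). dist x y / 2) ` {(x,y). x \<in> Z \<and> y \<in> Z \<and> x \<noteq> y})"
  have "finite {(x,y). x \<in> Z \<and> y \<in> Z \<and> x \<noteq> y}"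
    by (rule finite_subset[of _ "Z \<times> Z"]) (use assms in auto)
  then have fin: "finite D" by (simp add: D_def)
  have pos: "d > 0" if "d \<in> D" for d using that by (auto simp: D_def)
  show thesis
  proof
    show "Min D > 0" using Min_in[OF fin] pos by (auto simp: D_def)
    fix x y assume xy: "x \<in> Z" "y \<in> Z" "x \<noteq> y"
    have "dist x y / 2 \<in> D" using xy by (force simp: D_def)
    then have "Min D \<le> dist x y / 2" by (rule Min_le[OF fin])
    then show "ball x (Min D) \<inter> ball y (Min D) = {}"
      by (intro disjoint_ballI) auto
  qed
qed

text \<open>At each of the \<open>degree f\<close> points over \<open>w\<close> the map is locally
  invertible. The local inverses have a common domain \<open>T\<close>, and the sheets over it
  exhaust the preimage by counting, since all fibres have the same size.\<close>

lemma shabat_covering: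
  assumes "shabat f 0 1"
  shows "covering_space (poly f -` (- {0, 1})) (poly f) (- {0, 1})"
proof
  have deg: "degree f > 0" using assms by (auto simp: shabat_def)
  have cont: "continuous_on S (poly f)" for S by (intro continuous_intros)
  show "continuous_on (poly f -` (- {0, 1})) (poly f)" by fact
  have opn: "open (poly f -` (- {0, 1}))"
    by (intro open_vimage cont) auto
  show "poly f ` (poly f -` (- {0, 1})) = - {0, 1}"
  proof -
    have "\<exists>z. poly f z = w" if "w \<notin> {0,1}" for w
      using shabat_fibre[OF assms that] deg by (metis (mono_tags) card.empty empty_Collect_eq less_irrefl)
    then show ?thesis by auto
  qed
  fix w :: complex assume w: "w \<in> - {0, 1}"
  define Z where "Z = {z. poly f z = w}"
  have Z: "finite Z" "card Z = degree f" using shabat_fibre[OF assms] w by (auto simp: Z_def)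
  have "Z \<noteq> {}" using Z deg by auto
  obtain \<rho> where \<rho>: "\<rho> > 0" "\<And>x y. x \<in> Z \<Longrightarrow> y \<in> Z \<Longrightarrow> x \<noteq> y \<Longrightarrow> ball x \<rho> \<inter> ball y \<rho> = {}"
    using finite_separating_radius[OF Z(1)] by metis
  have "\<exists>r>0. ball z r \<subseteq> ball z \<rho> \<and> open (poly f ` ball z r) \<and> inj_on (poly f) (ball z r)" if "z \<in> Z" for z
  proof -
    have "deriv (poly f) z \<noteq> 0"
      using assms that w by (auto simp: DERIV_imp_deriv[OF poly_DERIV] shabat_def Z_def)
    moreover have "poly f holomorphic_on ball z \<rho>" by (intro poly_holomorphic_on holomorphic_on_ident)
    ultimately obtain r where "r > 0" "ball z r \<subseteq> ball z \<rho>" "open (poly f ` ball z r)" "inj_on (poly f) (ball z r)"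
      using has_complex_derivative_locally_invertible[of "poly f" "ball z \<rho>" z] \<rho>(1) by (metis centre_in_ball open_ball)
    then show ?thesis by blast
  qed
  then obtain r where r: "\<And>z. z \<in> Z \<Longrightarrow> r z > 0" "\<And>z. z \<in> Z \<Longrightarrow> ball z (r z) \<subseteq> ball z \<rho>"
     "\<And>z. z \<in> Z \<Longrightarrow> open (poly f ` ball z (r z))" "\<And>z. z \<in> Z \<Longrightarrow> inj_on (poly f) (ball z (r z))"
    by metis
  define T where "T = (\<Inter>z\<in>Z. poly f ` ball z (r z)) \<inter> - {0,1}"
  have oT: "open T" unfolding T_def using Z r by (intro open_Int open_INT open_Compl) auto
  have wT: "w \<in> T" unfolding T_def using w r(1) by (auto simp: Z_def intro!: image_eqI)
  define U where "U z = ball z (r z) \<inter> poly f -` T" for z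
  have oU: "open (U z)" for z unfolding U_def by (intro open_Int open_vimage cont oT) auto
  have disj: "U z \<inter> U z' = {}" if "z \<in> Z" "z' \<in> Z" "z \<noteq> z'" for z z'
    using \<rho>(2)[OF that] r(2)[OF that(1)] r(2)[OF that(2)] by (auto simp: U_def)
  have img: "poly f ` U z = T" if "z \<in> Z" for z
    using that by (auto simp: U_def T_def image_iff)
  have inj: "inj_on (poly f) (U z)" if "z \<in> Z" for z
    using r(4)[OF that] by (auto simp: U_def intro: inj_on_subset)
  have cover: "poly f -` T \<subseteq> \<Union>(U ` Z)"
  proof
    fix x assume x: "x \<in> poly f -` T"
    \<comment> \<open>\<open>s\<close> picks the point over \<open>poly f x\<close> in each sheet.
      The sheets being disjoint, these are \<open>degree f\<close> points and so the whole fibre,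
      which contains \<open>x\<close>.\<close>
    define s where "s z = (SOME y. y \<in> U z \<and> poly f y = poly f x)" for z
    have s: "s z \<in> U z" "poly f (s z) = poly f x" if "z \<in> Z" for z
    proof -
      have "\<exists>y. y \<in> U z \<and> poly f y = poly f x" using img[OF that] x by force
      from someI_ex[OF this] show "s z \<in> U z" "poly f (s z) = poly f x" by (auto simp: s_def)
    qed
    have "inj_on s Z"
      using s(1) disj by (metis (no_types, lifting) disjoint_iff inj_onI)
    then have "card (s ` Z) = degree f" using Z by (simp add: card_image)
    moreover have "s ` Z \<subseteq> {z. poly f z = poly f x}" using s by auto
    moreover have "poly f x \<notin> {0,1}" using x by (auto simp: T_def)
    ultimately have "s ` Z = {z. poly f z = poly f x}"
      using shabat_fibre[OF assms] by (metis card_subset_eq)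
    then have "x \<in> s ` Z" by auto
    then show "x \<in> \<Union>(U ` Z)" using s(1) by auto
  qed
  have "\<Union>(U ` Z) = poly f -` (- {0, 1}) \<inter> poly f -` T"
    using cover by (auto simp: U_def T_def)
  moreover have "\<forall>u\<in>U ` Z. openin (top_of_set (poly f -` (- {0, 1}))) u"
    using oU by (auto intro!: open_subset simp: U_def T_def)
  moreover have "pairwise disjnt (U ` Z)"
    unfolding pairwise_def disjnt_def using disj by fastforce
  moreover have "\<exists>q. homeomorphism u T (poly f) q" if u: "u \<in> U ` Z" for u
  proof -
    obtain z where z: "z \<in> Z" "u = U z" using u by auto
    obtain q where "homeomorphism u (poly f ` u) (poly f) q"
      using invariance_of_domain_homeomorphism[of u "poly f"] inj[OF z(1)] oU z(2) cont by auto
    then show ?thesis using img[OF z(1)] z(2) by auto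
  qed
  moreover have "openin (top_of_set (- {0, 1})) T" using oT by (intro open_subset) (auto simp: T_def)
  ultimately show "\<exists>T. w \<in> T \<and> openin (top_of_set (- {0, 1})) T \<and>
        (\<exists>v. \<Union>v = poly f -` (- {0, 1}) \<inter> poly f -` T \<and>
          (\<forall>u\<in>v. openin (top_of_set (poly f -` (- {0, 1}))) u) \<and>
          pairwise disjnt v \<and> (\<forall>u\<in>v. \<exists>q. homeomorphism u T (poly f) q))"
    using wT by (intro exI[of _ T] conjI exI[of _ "U ` Z"]) auto
qed

section \<open>Lifting the unit interval through the covering\<close>

abbreviation I01 :: "complex set" where "I01 \<equiv> open_segment 0 1"

lemma I01_iff: "z \<in> I01 \<longleftrightarrow> Im z = 0 \<and> 0 < Re z \<and> Re z < 1"
  by (auto simp: in_segment complex_eq_iff scaleR_conv_of_real)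

lemma closed01_iff: "z \<in> closed_segment (0::complex) 1 \<longleftrightarrow> Im z = 0 \<and> 0 \<le> Re z \<and> Re z \<le> 1"
  by (auto simp: in_segment complex_eq_iff scaleR_conv_of_real)

text \<open>The open interval is simply connected and avoids 0 and 1, so its inclusion lifts through
  the covering, with a prescribed point over \<open>poly f x\<close>.\<close>

lemma shabat_branch:
  assumes "shabat f 0 1" "poly f x \<in> I01"
  obtains g where "continuous_on I01 g" "\<And>t. t \<in> I01 \<Longrightarrow> poly f (g t) = t" "g (poly f x) = x"
proof -
  have "convex I01" by simp
  then have "simply_connected I01" "locally path_connected I01"
    by (auto intro: convex_imp_simply_connected convex_imp_locally_path_connected)
  moreover have "I01 \<subseteq> - {0, 1}" by (auto simp: I01_iff)
  then have "(\<lambda>t. t) \<in> I01 \<rightarrow> - {0, 1}" "x \<in> poly f -` (- {0, 1})" using assms(2) by auto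
  ultimately obtain g where g: "continuous_on I01 g" "g (poly f x) = x" "\<And>t. t \<in> I01 \<Longrightarrow> poly f (g t) = t"
    using covering_space_lift_strong[OF shabat_covering[OF assms(1)] _ assms(2), of x "\<lambda>t. t"] continuous_on_id
    by (metis (no_types))
  show thesis by (rule that[OF g(1,3,2)])
qed

lemma branch_unique:
  assumes f: "shabat f 0 1"
    and g: "continuous_on I01 g" "\<And>t. t \<in> I01 \<Longrightarrow> poly f (g t) = t"
    and h: "continuous_on I01 h" "\<And>t. t \<in> I01 \<Longrightarrow> poly f (h t) = t"
    and "g t = h t" "t \<in> I01" "s \<in> I01"
  shows "g s = h s"
proof (rule covering_space_lift_unique[where f = "\<lambda>t. t" and T = I01 and a = t and p = "poly f" and ?g1.0 = g and ?g2.0 = h])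
  show "covering_space (poly f -` (- {0, 1})) (poly f) (- {0, 1})" by (rule shabat_covering[OF f])
  show "connected I01" by (simp add: convex_connected)
  have "I01 \<subseteq> - {0, 1}" by (auto simp: I01_iff)
  then show "(\<lambda>t. t) \<in> I01 \<rightarrow> - {0, 1}" "g \<in> I01 \<rightarrow> poly f -` (- {0, 1})" "h \<in> I01 \<rightarrow> poly f -` (- {0, 1})"
    using g(2) h(2) by auto
qed (use assms in auto)

text \<open>The image of a branch is relatively closed in its component \<open>C\<close>, being the
  set where \<open>g (poly f x) = x\<close>. The rest of \<open>C\<close> is the union of such sets
  for finitely many other branches, one for each further point over 1/2, hence closed too;
  connectedness of \<open>C\<close> leaves only the branch.\<close>

lemma branch_is_component:
  assumes f: "shabat f 0 1" and g: "continuous_on I01 g" "\<And>t. t \<in> I01 \<Longrightarrow> poly f (g t) = t"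
  shows "g ` I01 \<in> shabat_edges f 0 1"
proof -
  let ?X = "poly f -` I01"
  have conn: "connected (g ` I01)" using g(1) by (intro connected_continuous_image convex_connected) auto
  have sub: "g ` I01 \<subseteq> ?X" using g(2) by auto
  define c :: complex where "c = 1/2"
  have half: "c \<in> I01" by (auto simp: I01_iff c_def)
  have all: "\<exists>h. continuous_on I01 h \<and> (\<forall>t\<in>I01. poly f (h t) = t) \<and> h (poly f x) = x" if "x \<in> ?X" for x
    using shabat_branch[OF f, of x] that by (metis vimageD)
  have uniq: "h s = g s" if "continuous_on I01 h" "\<forall>t\<in>I01. poly f (h t) = t" "h t = g t" "t \<in> I01" "s \<in> I01" for h t s
    by (rule branch_unique[OF f that(1) _ g that(3-5)]) (use that in auto)
  define C where "C = connected_component_set ?X (g (c))"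
  have C: "C \<in> components ?X"
    unfolding C_def using sub half by (intro componentsI) auto
  have gC: "g ` I01 \<subseteq> C"
    unfolding C_def using half sub conn by (intro connected_component_maximal) auto
  have CX: "C \<subseteq> ?X" by (simp add: C_def connected_component_subset)
  have cg: "closedin (top_of_set C) (g ` I01)"
  proof -
    have "g ` I01 = {x \<in> C. g (poly f x) = x}"
      using gC CX g(2) by (auto simp: image_iff) (metis vimageD subsetD)
    moreover have "continuous_on C (\<lambda>x. g (poly f x))"
      using CX by (intro continuous_on_compose2[OF g(1)] continuous_intros) auto
    then have "closedin (top_of_set C) {x \<in> C. (\<lambda>x. g (poly f x) - x) x = 0}"
      by (intro continuous_closedin_preimage_constant continuous_intros)
    ultimately show ?thesis by simp
  qed
  have og: "closedin (top_of_set C) (C - g ` I01)"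
  proof -
    define Z where "Z = {z. poly f z = c} - {g (c)}"
    have "finite Z" unfolding Z_def using shabat_fibre(1)[OF f, of c] by (simp add: c_def)
    define h where "h z = (SOME h. continuous_on I01 h \<and> (\<forall>t\<in>I01. poly f (h t) = t) \<and> h (c) = z)" for z
    have h: "continuous_on I01 (h z)" "\<forall>t\<in>I01. poly f (h z t) = t" "h z (c) = z" if "z \<in> Z" for z
    proof -
      have "\<exists>h. continuous_on I01 h \<and> (\<forall>t\<in>I01. poly f (h t) = t) \<and> h (c) = z"
        using all[of z] that half by (auto simp: Z_def)
      from someI_ex[OF this] show "continuous_on I01 (h z)" "\<forall>t\<in>I01. poly f (h z t) = t" "h z (c) = z"
        by (auto simp: h_def)
    qed
    have "C - g ` I01 = (\<Union>z\<in>Z. {x \<in> C. h z (poly f x) = x})"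
    proof (intro set_eqI iffI)
      fix x assume x: "x \<in> C - g ` I01"
      then obtain k where k: "continuous_on I01 k" "\<forall>t\<in>I01. poly f (k t) = t" "k (poly f x) = x"
        using all CX by blast
      have xI: "poly f x \<in> I01" using x CX by auto
      have "k (c) \<noteq> g (c)"
        using uniq[OF k(1,2), of "c" "poly f x"] half xI k(3) x by (auto simp: image_iff)
      then have z: "k (c) \<in> Z" using k(2) half by (auto simp: Z_def)
      have "k (poly f x) = h (k (c)) (poly f x)"
        by (rule branch_unique[OF f k(1) _ h(1)[OF z], of "c"]) (use k h(2,3)[OF z] half xI in auto)
      then show "x \<in> (\<Union>z\<in>Z. {x \<in> C. h z (poly f x) = x})" using z k(3) x by (metis (mono_tags, lifting) DiffD1 UN_I mem_Collect_eq)
    next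
      fix x assume "x \<in> (\<Union>z\<in>Z. {x \<in> C. h z (poly f x) = x})"
      then obtain z where z: "z \<in> Z" "x \<in> C" "h z (poly f x) = x" by auto
      have xI: "poly f x \<in> I01" using z CX by auto
      have "x \<notin> g ` I01"
      proof
        assume "x \<in> g ` I01"
        then have "g (poly f x) = x" using g(2) by auto
        then have "h z (c) = g (c)" using uniq[OF h(1,2)[OF z(1)], of "poly f x" "c"] z xI half by auto
        then show False using h(3)[OF z(1)] z(1) by (auto simp: Z_def)
      qed
      then show "x \<in> C - g ` I01" using z by auto
    qed
    moreover have "closedin (top_of_set C) {x \<in> C. h z (poly f x) = x}" if "z \<in> Z" for z
    proof -
      have "continuous_on C (\<lambda>x. h z (poly f x))"
        using CX by (intro continuous_on_compose2[OF h(1)[OF that]] continuous_intros) auto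
      then have "closedin (top_of_set C) {x \<in> C. (\<lambda>x. h z (poly f x) - x) x = 0}"
        by (intro continuous_closedin_preimage_constant continuous_intros)
      then show ?thesis by simp
    qed
    ultimately show ?thesis using \<open>finite Z\<close> by (auto intro: closedin_Union)
  qed
  have "connected C" by (simp add: C_def)
  have "openin (top_of_set C) (g ` I01)"
    using og gC by (simp add: openin_closedin_eq)
  then have "g ` I01 = {} \<or> g ` I01 = C"
    using cg \<open>connected C\<close> by (auto simp: connected_clopen)
  then have "g ` I01 = C" using half by auto
  then show ?thesis using C by (simp add: shabat_edges_def)
qed

lemma shabat_edge_branch:
  assumes f: "shabat f 0 1" and e: "e \<in> shabat_edges f 0 1"
  obtains g where "continuous_on I01 g" "g ` I01 = e" "\<And>t. t \<in> I01 \<Longrightarrow> poly f (g t) = t"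
proof -
  obtain x where x: "x \<in> e" using e in_components_nonempty by (auto simp: shabat_edges_def)
  have xI: "poly f x \<in> I01" using in_components_subset[of e] x e by (auto simp: shabat_edges_def)
  obtain g where g: "continuous_on I01 g" "\<And>t. t \<in> I01 \<Longrightarrow> poly f (g t) = t" "g (poly f x) = x"
    using shabat_branch[OF f xI] by metis
  have "g ` I01 \<in> shabat_edges f 0 1" by (rule branch_is_component[OF f g(1,2)])
  moreover have "g ` I01 \<inter> e \<noteq> {}" using g(3) xI x by (metis IntI empty_iff imageI)
  ultimately have "g ` I01 = e" using e components_eq unfolding shabat_edges_def by blast
  then show thesis using that g by blast
qed

lemma shabat_edge_facts:
  assumes f: "shabat f 0 1" and e: "e \<in> shabat_edges f 0 1"
  shows "inj_on (poly f) e" "poly f ` e = I01" "connected e" "e \<noteq> {}"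
proof -
  obtain g where g: "continuous_on I01 g" "g ` I01 = e" "\<And>t. t \<in> I01 \<Longrightarrow> poly f (g t) = t"
    using shabat_edge_branch[OF f e] by metis
  show "inj_on (poly f) e" using g by (auto simp: inj_on_def)
  show "poly f ` e = I01" using g by (force simp: image_iff)
  show "connected e" "e \<noteq> {}"
    using e by (auto simp: shabat_edges_def in_components_connected in_components_nonempty)
qed

lemma shabat_edges_disjoint:
  assumes "e \<in> shabat_edges f 0 1" "e' \<in> shabat_edges f 0 1" "x \<in> e" "x \<in> e'"
  shows "e = e'"
  using assms components_eq unfolding shabat_edges_def by blast

lemma shabat_edge_through:
  assumes "poly f x \<in> I01"
  obtains e where "e \<in> shabat_edges f 0 1" "x \<in> e"
  using assms Union_components[of "poly f -` I01"] unfolding shabat_edges_def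
  by (metis UnionE vimageI2)

text \<open>An edge is mapped bijectively onto the open interval, so it contains exactly one of the
  \<open>degree f\<close> points over 1/2.\<close>

lemma card_shabat_edges:
  assumes f: "shabat f 0 1"
  shows "card (shabat_edges f 0 1) = degree f" "finite (shabat_edges f 0 1)"
proof -
  define c :: complex where "c = 1/2"
  have half: "c \<in> I01" and c01: "c \<notin> {0, 1}" by (auto simp: I01_iff c_def)
  let ?Z = "{z. poly f z = c}"
  define E where "E z = (THE e. e \<in> shabat_edges f 0 1 \<and> z \<in> e)" for z
  have E: "E z \<in> shabat_edges f 0 1 \<and> z \<in> E z" if "z \<in> ?Z" for z
    unfolding E_def
  proof (rule theI')
    have "poly f z \<in> I01" using that half by simp
    then show "\<exists>!e. e \<in> shabat_edges f 0 1 \<and> z \<in> e"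
      using shabat_edge_through[of f z] shabat_edges_disjoint by metis
  qed
  have "bij_betw E ?Z (shabat_edges f 0 1)"
  proof (rule bij_betw_imageI)
    show "inj_on E ?Z"
    proof
      fix x y assume xy: "x \<in> ?Z" "y \<in> ?Z" "E x = E y"
      then have "inj_on (poly f) (E x)" "x \<in> E x" "y \<in> E x"
        using E[OF xy(1)] E[OF xy(2)] shabat_edge_facts(1)[OF f] by auto
      moreover have "poly f x = poly f y" using xy by simp
      ultimately show "x = y" by (simp add: inj_on_def)
    qed
    show "E ` ?Z = shabat_edges f 0 1"
    proof (intro set_eqI iffI)
      fix e assume e: "e \<in> shabat_edges f 0 1"
      then obtain z where "z \<in> e" "poly f z = c"
        using shabat_edge_facts(2)[OF f e] half by (metis (no_types, lifting) imageE)
      then show "e \<in> E ` ?Z" using E[of z] e shabat_edges_disjoint by blast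
    qed (use E in auto)
  qed
  then show "card (shabat_edges f 0 1) = degree f" "finite (shabat_edges f 0 1)"
    using shabat_fibre[OF f c01] by (auto simp: bij_betw_same_card bij_betw_finite)
qed

section \<open>Rays at a vertex\<close>

text \<open>\<open>\<tau> r j\<close> is the angle at which ray number \<open>j\<close> meets the
  circle of radius \<open>r\<close>. Rays are numbered by all integers and angles are taken on the
  real line, so that the successor of a ray is always \<open>j + 1\<close> and the return to the
  same ray, \<open>m\<close> numbers later, is a full turn. Continuity in \<open>r\<close> makes
  each ray a connected curve.\<close>

definition local_rays :: "complex poly \<Rightarrow> complex \<Rightarrow> nat \<Rightarrow> real \<Rightarrow> (real \<Rightarrow> int \<Rightarrow> real) \<Rightarrow> bool" where
  "local_rays f v m R \<tau> \<longleftrightarrow> R > 0 \<and> m > 0 \<and>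
     (\<forall>r. 0 < r \<and> r < R \<longrightarrow>
        (\<forall>\<theta>. poly f (v + rcis r \<theta>) \<in> closed_segment 0 1 \<longleftrightarrow> (\<exists>j. \<theta> = \<tau> r j)) \<and>
        (\<forall>j. poly f (v + rcis r (\<tau> r j)) \<in> I01) \<and>
        strict_mono (\<tau> r) \<and> (\<forall>j. \<tau> r (j + int m) = \<tau> r j + 2 * pi)) \<and>
     (\<forall>j. continuous_on {0<..<R} (\<lambda>r. \<tau> r j))"

lemma norm_cis_diff_le: "norm (cis a - cis b) \<le> \<bar>a - b\<bar>"
proof -
  have "cis a - cis b = cis b * (cis (a - b) - 1)" by (simp add: algebra_simps cis_mult)
  then have "norm (cis a - cis b) = norm (exp (\<i> * of_real (a - b)) - 1)"
    by (simp add: norm_mult cis_conv_exp)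
  also have "\<dots> = 2 * \<bar>sin ((a - b) / 2)\<bar>" by (rule dist_exp_i_1)
  also have "\<dots> \<le> \<bar>a - b\<bar>" using abs_sin_x_le_abs_x[of "(a - b) / 2"] by simp
  finally show ?thesis .
qed

lemma cis_in_closed01:
  assumes "0 < A" "A < 1"
  shows "of_real A * cis t \<in> closed_segment 0 1 \<longleftrightarrow> (\<exists>j::int. t = 2 * pi * j)"
    and "of_real A * cis (2 * pi * real_of_int j) \<in> I01"
proof -
  show "of_real A * cis (2 * pi * real_of_int j) \<in> I01"
    using assms by (simp add: I01_iff)
  show "of_real A * cis t \<in> closed_segment 0 1 \<longleftrightarrow> (\<exists>j::int. t = 2 * pi * j)"
  proof
    assume "of_real A * cis t \<in> closed_segment 0 1"
    then have "sin t = 0" "cos t \<ge> 0"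
      using assms by (auto simp: closed01_iff zero_le_mult_iff)
    then have "cos t = 1" using sin_cos_squared_add[of t] by (simp add: power2_eq_1_iff)
    then show "\<exists>j::int. t = 2 * pi * j" by (auto simp: cos_one_2pi_int algebra_simps)
  next
    assume "\<exists>j::int. t = 2 * pi * j"
    then obtain j :: int where "t = 2 * pi * j" by auto
    then show "of_real A * cis t \<in> closed_segment 0 1"
      using assms by (simp add: closed01_iff)
  qed
qed

text \<open>
  Writing \<open>f = (z - v)^m * exp L\<close> near \<open>v\<close>, the argument of \<open>f (v + rcis r \<theta>)\<close> is
  \<open>m * \<theta> + Im (L (v + rcis r \<theta>))\<close>, which for small \<open>r\<close> increases in \<open>\<theta>\<close> because \<open>L\<close> is Lipschitz.
\<close>

lemma local_rays_exist:
  assumes "f \<noteq> 0" "poly f v = 0"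
  obtains R \<tau> where "local_rays f v (Polynomial.order v f) R \<tau>"
proof -
  define m where "m = Polynomial.order v f"
  have m: "m > 0" using assms by (simp add: m_def order_gt_0_iff)
  obtain h where h: "f = [:- v, 1:] ^ m * h" "\<not> [:- v, 1:] dvd h"
    using order_decomp[OF assms(1), of v] unfolding m_def by auto
  have hv: "poly h v \<noteq> 0" using h(2) by (simp add: poly_eq_0_iff_dvd)
  have "open {z. poly h z \<noteq> 0}" by (intro open_Collect_neq continuous_intros)
  then obtain \<rho> where \<rho>: "\<rho> > 0" "\<And>z. z \<in> ball v \<rho> \<Longrightarrow> poly h z \<noteq> 0"
    using openE[of "{z. poly h z \<noteq> 0}" v] hv by (metis (mono_tags, lifting) mem_Collect_eq subsetD)
  have "poly h holomorphic_on ball v \<rho>" by (intro poly_holomorphic_on holomorphic_on_ident)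
  then obtain L where L: "L holomorphic_on ball v \<rho>" "\<And>z. z \<in> ball v \<rho> \<Longrightarrow> exp (L z) = poly h z"
    using \<rho> holomorphic_logarithm_exists[of "ball v \<rho>" "poly h" v, OF convex_ball open_ball] centre_in_ball
    by metis
  define B where "B = cball v (\<rho> / 2)"
  have Bsub: "B \<subseteq> ball v \<rho>" using \<rho> by (auto simp: B_def)
  have "continuous_on B (deriv L)"
    using continuous_on_subset[OF holomorphic_on_imp_continuous_on[OF holomorphic_deriv[OF L(1) open_ball]] Bsub] .
  then have "bounded (deriv L ` B)"
    by (intro compact_imp_bounded compact_continuous_image) (auto simp: B_def)
  then obtain M where M: "M > 0" "\<And>z. z \<in> B \<Longrightarrow> norm (deriv L z) \<le> M"
    by (auto simp: bounded_pos)
  have lip: "norm (L x - L y) \<le> M * norm (x - y)" if "x \<in> B" "y \<in> B" for x y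
  proof (rule field_differentiable_bound[of B L "deriv L" M x y])
    show "(L has_field_derivative deriv L z) (at z within B)" if "z \<in> B" for z
      using L(1) Bsub that by (meson DERIV_deriv_iff_field_differentiable has_field_derivative_at_within
          holomorphic_on_imp_differentiable_at open_ball subsetD)
  qed (use M that in \<open>auto simp: B_def\<close>)
  have "open {z. norm (poly f z) < 1}" by (intro open_Collect_less continuous_intros)
  then obtain \<sigma> where \<sigma>: "\<sigma> > 0" "ball v \<sigma> \<subseteq> {z. norm (poly f z) < 1}"
    using openE[of "{z. norm (poly f z) < 1}" v] assms by auto
  then have \<sigma>: "\<sigma> > 0" "\<And>z. dist z v < \<sigma> \<Longrightarrow> norm (poly f z) < 1"
    by (auto simp: subset_eq dist_commute)
  \<comment> \<open>The bound \<open>m / (2 * M)\<close> keeps the variation of \<open>Im L\<close>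
    on the circle below half of the growth of \<open>m * \<theta>\<close>; \<open>\<sigma>\<close>
    keeps \<open>f\<close> inside the unit disc, so that a positive real value there lies in the
    open interval.\<close>
  define R where "R = min (min (\<rho> / 2) \<sigma>) (m / (2 * M))"
  have R: "R > 0" "R \<le> \<rho> / 2" "R \<le> \<sigma>" "M * R \<le> m / 2"
  proof -
    have "M * R \<le> M * (m / (2 * M))" using M by (intro mult_left_mono) (auto simp: R_def)
    then show "M * R \<le> m / 2" using M by simp
  qed (use \<rho> \<sigma> M m in \<open>auto simp: R_def\<close>)
  define \<Theta> where "\<Theta> r \<theta> = real m * \<theta> + Im (L (v + rcis r \<theta>))" for r \<theta>
  have inB: "v + rcis r \<theta> \<in> B" if "0 < r" "r < R" for r \<theta>
    using that R by (simp add: B_def dist_norm rcis_def norm_mult)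
  have polar: "poly f (v + rcis r \<theta>) = of_real (r ^ m * exp (Re (L (v + rcis r \<theta>)))) * cis (\<Theta> r \<theta>)"
    if "0 < r" "r < R" for r \<theta>
  proof -
    have "poly f (v + rcis r \<theta>) = rcis r \<theta> ^ m * exp (L (v + rcis r \<theta>))"
      using L(2) inB[OF that] Bsub by (simp add: h(1) subset_eq)
    also have "exp (L (v + rcis r \<theta>)) = of_real (exp (Re (L (v + rcis r \<theta>)))) * cis (Im (L (v + rcis r \<theta>)))"
      by (simp add: exp_eq_polar)
    also have "rcis r \<theta> ^ m = of_real (r ^ m) * cis (real m * \<theta>)"
      unfolding DeMoivre2 by (simp add: rcis_def)
    finally show ?thesis by (simp add: \<Theta>_def cis_mult[symmetric])
  qed
  have incr: "\<Theta> r t - \<Theta> r s \<ge> m / 2 * (t - s)" if r: "0 < r" "r < R" and st: "s \<le> t" for r s t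
  proof -
    have "\<bar>Im (L (v + rcis r t)) - Im (L (v + rcis r s))\<bar> \<le> norm (L (v + rcis r t) - L (v + rcis r s))"
      using abs_Im_le_cmod[of "L (v + rcis r t) - L (v + rcis r s)"] by simp
    also have "\<dots> \<le> M * norm (v + rcis r t - (v + rcis r s))"
      by (rule lip[OF inB[OF r] inB[OF r]])
    also have "norm (v + rcis r t - (v + rcis r s)) = r * norm (cis t - cis s)"
      using r by (simp add: rcis_def norm_mult right_diff_distrib[symmetric])
    also have "M * (r * norm (cis t - cis s)) \<le> M * (R * (t - s))"
      using M r norm_cis_diff_le[of t s] st by (intro mult_left_mono mult_mono) auto
    also have "\<dots> = M * R * (t - s)" by simp
    also have "\<dots> \<le> m / 2 * (t - s)" using R st by (intro mult_right_mono) auto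
    finally have "Im (L (v + rcis r t)) - Im (L (v + rcis r s)) \<ge> - (m / 2 * (t - s))" by linarith
    then show ?thesis by (simp add: \<Theta>_def field_simps)
  qed
  have incr': "\<bar>t - s\<bar> \<le> 2 / m * \<bar>\<Theta> r t - \<Theta> r s\<bar>" if r: "0 < r" "r < R" for r s t
  proof -
    have "m / 2 * \<bar>t - s\<bar> \<le> \<bar>\<Theta> r t - \<Theta> r s\<bar>"
    proof (cases "s \<le> t")
      case True
      have "\<bar>t - s\<bar> = t - s" using True by simp
      show ?thesis unfolding \<open>\<bar>t - s\<bar> = t - s\<close> using incr[OF r True] abs_ge_self by (rule order_trans)
    next
      case False
      have "\<bar>t - s\<bar> = s - t" using False by simp
      have "\<Theta> r s - \<Theta> r t \<le> \<bar>\<Theta> r t - \<Theta> r s\<bar>" by simp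
      with incr[OF r, of t s] False show ?thesis unfolding \<open>\<bar>t - s\<bar> = s - t\<close> by simp
    qed
    then show ?thesis using m by (simp add: field_simps)
  qed
  have inj: "s = t" if "\<Theta> r s = \<Theta> r t" "0 < r" "r < R" for r s t
    using incr'[OF that(2,3), of s t] that(1) by simp
  have ex: "\<exists>\<theta>. \<Theta> r \<theta> = c" if r: "0 < r" "r < R" for r c
  proof -
    define a where "a = min 0 ((c - \<Theta> r 0) * 2 / m)"
    define b where "b = max 0 ((c - \<Theta> r 0) * 2 / m)"
    have "\<Theta> r a \<le> c"
    proof -
      have "m / 2 * (0 - a) \<le> \<Theta> r 0 - \<Theta> r a" using incr[OF r, of a 0] by (simp add: a_def)
      moreover have "m / 2 * a \<le> c - \<Theta> r 0" using m by (simp add: a_def min_def field_simps)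
      ultimately show ?thesis by (simp add: algebra_simps)
    qed
    moreover have "c \<le> \<Theta> r b"
    proof -
      have "m / 2 * (b - 0) \<le> \<Theta> r b - \<Theta> r 0" using incr[OF r, of 0 b] by (simp add: b_def)
      moreover have "c - \<Theta> r 0 \<le> m / 2 * b" using m by (simp add: b_def max_def field_simps)
      ultimately show ?thesis by (simp add: algebra_simps)
    qed
    moreover have "continuous_on {a..b} (\<Theta> r)"
      unfolding \<Theta>_def using L(1) inB[OF r] Bsub
      by (intro continuous_intros continuous_on_compose2[OF holomorphic_on_imp_continuous_on[OF L(1)]])
         (auto simp: rcis_def intro!: continuous_intros)
    moreover have "a \<le> b" by (simp add: a_def b_def)
    ultimately show ?thesis using IVT'[of "\<Theta> r" a c b] by auto
  qed
  \<comment> \<open>The values of \<open>f\<close> on the circle are positive reals exactly where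
    the argument \<open>\<Theta>\<close> is a multiple of \<open>2 * pi\<close>; by
    \<open>inj\<close> and \<open>ex\<close> each multiple is attained at exactly one angle.\<close>
  define \<tau> where "\<tau> r j = (SOME \<theta>. \<Theta> r \<theta> = 2 * pi * real_of_int j)" for r j
  have \<tau>: "\<Theta> r (\<tau> r j) = 2 * pi * real_of_int j" if "0 < r" "r < R" for r j
    unfolding \<tau>_def by (rule someI_ex[OF ex[OF that]])
  have small: "0 < r ^ m * exp (Re (L (v + rcis r \<theta>)))" "r ^ m * exp (Re (L (v + rcis r \<theta>))) < 1"
    if r: "0 < r" "r < R" for r \<theta>
  proof -
    show *: "0 < r ^ m * exp (Re (L (v + rcis r \<theta>)))" using r by simp
    have "norm (poly f (v + rcis r \<theta>)) < 1"
      using r R by (intro \<sigma>(2)) (simp add: dist_norm rcis_def norm_mult)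
    then show "r ^ m * exp (Re (L (v + rcis r \<theta>))) < 1"
      using * unfolding polar[OF r] norm_mult norm_of_real norm_cis by linarith
  qed
  have "local_rays f v m R \<tau>"
    unfolding local_rays_def
  proof (intro conjI allI impI; (elim conjE)?)
    show "R > 0" "m > 0" by fact+
  next
    fix r \<theta> assume r: "0 < r" "r < R"
    show "poly f (v + rcis r \<theta>) \<in> closed_segment 0 1 \<longleftrightarrow> (\<exists>j. \<theta> = \<tau> r j)"
      unfolding polar[OF r] cis_in_closed01(1)[OF small[OF r]]
      using \<tau>[OF r] inj[OF _ r] by metis
  next
    fix r j assume r: "0 < r" "r < R"
    show "poly f (v + rcis r (\<tau> r j)) \<in> I01"
      unfolding polar[OF r] \<tau>[OF r] by (rule cis_in_closed01(2)[OF small[OF r]])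
  next
    fix r assume r: "0 < r" "r < R"
    show "strict_mono (\<tau> r)"
    proof (rule strict_monoI, rule ccontr)
      fix j k :: int assume jk: "j < k" "\<not> \<tau> r j < \<tau> r k"
      then have "\<Theta> r (\<tau> r k) \<le> \<Theta> r (\<tau> r j)"
        using incr[OF r, of "\<tau> r k" "\<tau> r j"] m by (smt (verit) divide_nonneg_nonneg mult_nonneg_nonneg of_nat_0_le_iff)
      then show False using jk(1) by (simp add: \<tau>[OF r])
    qed
  next
    fix r j assume r: "0 < r" "r < R"
    have "rcis r (\<tau> r j + 2 * pi) = rcis r (\<tau> r j)" by (simp add: rcis_def cis_mult[symmetric])
    then have *: "\<Theta> r (\<tau> r j + 2 * pi) = 2 * pi * real_of_int (j + int m)"
      using \<tau>[OF r, of j] by (simp add: \<Theta>_def algebra_simps)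
    show "\<tau> r (j + int m) = \<tau> r j + 2 * pi"
      by (rule inj[OF trans[OF \<tau>[OF r] *[symmetric]] r])
  next
    fix j
    show "continuous_on {0<..<R} (\<lambda>r. \<tau> r j)"
    proof (rule lipschitz_on_continuous_on[of "2 / m * M"], rule lipschitz_onI)
      fix r s assume "r \<in> {0<..<R}" "s \<in> {0<..<R}"
      then have r: "0 < r" "r < R" and s: "0 < s" "s < R" by auto
      let ?t = "\<tau> s j"
      \<comment> \<open>Both angles have the argument \<open>2 * pi * j\<close> at their own radii,
        so their distance is controlled by the change of \<open>\<Theta>\<close> at the fixed angle
        \<open>?t\<close> between the radii \<open>r\<close> and \<open>s\<close>.\<close>
      have 1: "\<bar>\<tau> r j - ?t\<bar> \<le> 2 / m * \<bar>\<Theta> r (\<tau> r j) - \<Theta> r ?t\<bar>" by (rule incr'[OF r])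
      have "\<bar>\<Theta> r (\<tau> r j) - \<Theta> r ?t\<bar> = \<bar>\<Theta> s ?t - \<Theta> r ?t\<bar>" by (simp add: \<tau>[OF r] \<tau>[OF s])
      also have "\<dots> \<le> norm (L (v + rcis s ?t) - L (v + rcis r ?t))"
        using abs_Im_le_cmod[of "L (v + rcis s ?t) - L (v + rcis r ?t)"] by (simp add: \<Theta>_def)
      also have "\<dots> \<le> M * norm (v + rcis s ?t - (v + rcis r ?t))"
        by (rule lip[OF inB[OF s] inB[OF r]])
      also have "v + rcis s ?t - (v + rcis r ?t) = of_real (s - r) * cis ?t"
        by (simp add: rcis_def algebra_simps)
      also have "norm (of_real (s - r) * cis ?t) = \<bar>r - s\<bar>"
        unfolding norm_mult norm_cis norm_of_real by simp
      finally have "2 / m * \<bar>\<Theta> r (\<tau> r j) - \<Theta> r ?t\<bar> \<le> 2 / m * (M * \<bar>r - s\<bar>)"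
        by (intro mult_left_mono) auto
      then show "dist (\<tau> r j) (\<tau> s j) \<le> 2 / m * M * dist r s"
        using 1 unfolding dist_real_def mult.assoc by linarith
    qed (use M in auto)
  qed
  then show thesis using that by (simp add: m_def)
qed

section \<open>Edges and rotations at a vertex\<close>

lemma local_raysD:
  assumes "local_rays f v m R \<tau>" "0 < r" "r < R"
  shows "poly f (v + rcis r \<theta>) \<in> closed_segment 0 1 \<longleftrightarrow> (\<exists>j. \<theta> = \<tau> r j)"
    and "poly f (v + rcis r (\<tau> r j)) \<in> I01" "strict_mono (\<tau> r)" "\<tau> r (j + int m) = \<tau> r j + 2 * pi"
  using assms unfolding local_rays_def by blast+

lemma continuous_on_ray:
  assumes "local_rays f v m R \<tau>"
  shows "continuous_on {0<..<R} (\<lambda>r. v + rcis r (\<tau> r j))"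
proof -
  have "continuous_on {0<..<R} (\<lambda>r. \<tau> r j)" using assms by (simp add: local_rays_def)
  then show ?thesis unfolding rcis_def by (intro continuous_intros continuous_on_cis)
qed

lemma ray_angle_shift:
  assumes "local_rays f v m R \<tau>" "0 < r" "r < R"
  shows "\<tau> r (j + int m * k) = \<tau> r j + 2 * pi * real_of_int k"
proof (induction k rule: int_induct[where k = 0])
  case (step1 i)
  then show ?case
    using local_raysD(4)[OF assms, of "j + int m * i"] by (simp add: algebra_simps)
next
  case (step2 i)
  then show ?case
    using local_raysD(4)[OF assms, of "j + int m * (i - 1)"] by (simp add: algebra_simps)
qed simp

lemma ray_eqD:
  assumes lr: "local_rays f v m R \<tau>" and r: "0 < r" "r < R" and s: "0 < s" "s < R"
    and eq: "v + rcis r (\<tau> r j) = v + rcis s (\<tau> s k)"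
  shows "r = s \<and> int m dvd j - k"
proof -
  have "norm (rcis r (\<tau> r j)) = norm (rcis s (\<tau> s k))" using eq by simp
  then have [simp]: "s = r" using r s by simp
  have "cis (\<tau> r j) = cis (\<tau> r k)" using eq r by (simp add: rcis_def)
  then have "cis (\<tau> r j - \<tau> r k) = 1" by (simp add: cis_divide[symmetric])
  then have "cos (\<tau> r j - \<tau> r k) = 1" by (metis cis.sel(1) one_complex.sel(1))
  then obtain i :: int where "\<tau> r j = \<tau> r k + 2 * pi * i"
    by (auto simp: cos_one_2pi_int algebra_simps)
  then have "\<tau> r j = \<tau> r (k + int m * i)" using ray_angle_shift[OF lr r] by simp
  then have "j = k + int m * i" using local_raysD(3)[OF lr r] by (simp add: strict_mono_eq)
  then show ?thesis by simp
qed

text \<open>The positive values of \<open>f\<close> along the ray tend to 0 towards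
  \<open>v\<close>, so the intermediate value theorem yields all small ones, even within distance
  \<open>\<rho>\<close> of \<open>v\<close>. Two rays in one edge therefore share a value, and
  injectivity of \<open>f\<close> on the edge makes them share a point.\<close>

lemma ray_values:
  assumes lr: "local_rays f v m R \<tau>" and v: "poly f v = 0" and \<rho>: "0 < \<rho>" "\<rho> \<le> R"
  obtains s where "s > 0"
    "\<And>t. 0 < t \<Longrightarrow> t < s \<Longrightarrow> \<exists>r. 0 < r \<and> r < \<rho> \<and> poly f (v + rcis r (\<tau> r j)) = of_real t"
proof -
  define y where "y r = v + rcis r (\<tau> r j)" for r
  define \<phi> where "\<phi> r = Re (poly f (y r))" for r
  have cy: "continuous_on {0<..<R} y" unfolding y_def by (rule continuous_on_ray[OF lr])
  have yI: "poly f (y r) \<in> I01" if "0 < r" "r < R" for r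
    unfolding y_def by (rule local_raysD(2)[OF lr that])
  have c\<phi>: "continuous_on {a..b} \<phi>" if "0 < a" "b < R" for a b
    unfolding \<phi>_def
    by (intro continuous_intros continuous_on_subset[OF cy]) (use that in auto)
  show thesis
  proof
    show "\<phi> (\<rho> / 2) > 0" using yI[of "\<rho> / 2"] \<rho> by (simp add: I01_iff \<phi>_def)
    fix t assume t: "0 < t" "t < \<phi> (\<rho> / 2)"
    have "open {z. norm (poly f z) < t}" by (intro open_Collect_less continuous_intros)
    then obtain d where d: "d > 0" "ball v d \<subseteq> {z. norm (poly f z) < t}"
      using openE[of "{z. norm (poly f z) < t}" v] t v by auto
    define a where "a = min d \<rho> / 2"
    have a: "0 < a" "a \<le> \<rho> / 2" "a < d" using d \<rho> by (auto simp: a_def)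
    have "y a \<in> ball v d" using a by (simp add: y_def dist_norm rcis_def norm_mult)
    then have "norm (poly f (y a)) < t" using d by auto
    then have "\<phi> a < t" using complex_Re_le_cmod[of "poly f (y a)"] by (simp add: \<phi>_def)
    moreover have "continuous_on {a..\<rho> / 2} \<phi>" by (rule c\<phi>) (use a \<rho> in auto)
    ultimately obtain r where r: "a \<le> r" "r \<le> \<rho> / 2" "\<phi> r = t"
      using IVT'[of \<phi> a t "\<rho> / 2"] t a by auto
    then have "poly f (y r) = of_real t"
      using yI[of r] a \<rho> by (simp add: I01_iff \<phi>_def complex_eq_iff)
    then show "\<exists>r. 0 < r \<and> r < \<rho> \<and> poly f (v + rcis r (\<tau> r j)) = of_real t"
      using r a \<rho> by (intro exI[of _ r]) (auto simp: y_def)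
  qed
qed

text \<open>\<open>E j\<close> is the edge that continues ray \<open>j\<close>. The last clause
  combines two facts: numbers congruent modulo \<open>m\<close> name the same ray, and different
  rays at \<open>v\<close> never belong to one edge.\<close>

definition ray_edges :: "complex poly \<Rightarrow> complex \<Rightarrow> nat \<Rightarrow> real \<Rightarrow> (real \<Rightarrow> int \<Rightarrow> real) \<Rightarrow> (int \<Rightarrow> complex set) \<Rightarrow> bool" where
  "ray_edges f v m R \<tau> E \<longleftrightarrow> local_rays f v m R \<tau> \<and>
     (\<forall>j. E j \<in> shabat_edges f 0 1) \<and>
     (\<forall>j r. 0 < r \<longrightarrow> r < R \<longrightarrow> v + rcis r (\<tau> r j) \<in> E j) \<and>
     (\<forall>j k. E j = E k \<longleftrightarrow> int m dvd j - k)"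

text \<open>A ray is connected and so lies in one component. Two rays in the same edge take a common
  value, hence meet, and then their numbers agree modulo \<open>m\<close>.\<close>

lemma ray_edges_exist:
  assumes f: "shabat f 0 1" and v: "poly f v = 0"
  obtains R \<tau> E where "ray_edges f v (Polynomial.order v f) R \<tau> E"
proof -
  define m where "m = Polynomial.order v f"
  have "f \<noteq> 0" using f by (auto simp: shabat_def)
  then obtain R \<tau> where lr: "local_rays f v m R \<tau>"
    using local_rays_exist v unfolding m_def by metis
  have R: "R > 0" using lr by (simp add: local_rays_def)
  define A where "A j = (\<lambda>r. v + rcis r (\<tau> r j)) ` {0<..<R}" for j
  have "\<exists>e. e \<in> shabat_edges f 0 1 \<and> A j \<subseteq> e" for j
    unfolding shabat_edges_def
  proof (rule exists_component_superset)
    show "connected (A j)" unfolding A_def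
      by (intro connected_continuous_image continuous_on_ray[OF lr]) auto
    show sub: "A j \<subseteq> poly f -` I01" using local_raysD(2)[OF lr] by (auto simp: A_def)
    have "v + rcis (R / 2) (\<tau> (R / 2) j) \<in> A j" using R by (auto simp: A_def)
    then show "poly f -` I01 \<noteq> {}" using sub by blast
  qed
  then obtain E where E: "\<And>j. E j \<in> shabat_edges f 0 1" "\<And>j. A j \<subseteq> E j" by metis
  have AE: "v + rcis r (\<tau> r j) \<in> E j" if "0 < r" "r < R" for r j
    using E(2)[of j] that by (auto simp: A_def)
  have "E j = E k \<longleftrightarrow> int m dvd j - k" for j k
  proof
    assume eq: "E j = E k"
    obtain s where s: "s > 0" "\<And>t. 0 < t \<Longrightarrow> t < s \<Longrightarrow> \<exists>r. 0 < r \<and> r < R \<and> poly f (v + rcis r (\<tau> r j)) = of_real t"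
      using ray_values[OF lr v R order_refl] by metis
    obtain s' where s': "s' > 0" "\<And>t. 0 < t \<Longrightarrow> t < s' \<Longrightarrow> \<exists>r. 0 < r \<and> r < R \<and> poly f (v + rcis r (\<tau> r k)) = of_real t"
      using ray_values[OF lr v R order_refl] by metis
    define t where "t = min s s' / 2"
    have t: "0 < t" "t < s" "t < s'" using s(1) s'(1) by (auto simp: t_def)
    obtain r where r: "0 < r" "r < R" "poly f (v + rcis r (\<tau> r j)) = of_real t" using s(2) t by blast
    obtain r' where r': "0 < r'" "r' < R" "poly f (v + rcis r' (\<tau> r' k)) = of_real t" using s'(2) t by blast
    have "v + rcis r (\<tau> r j) = v + rcis r' (\<tau> r' k)"
    proof (rule inj_onD[OF shabat_edge_facts(1)[OF f E(1)[of j]]])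
      show "v + rcis r (\<tau> r j) \<in> E j" by (rule AE[OF r(1,2)])
      show "v + rcis r' (\<tau> r' k) \<in> E j" unfolding eq by (rule AE[OF r'(1,2)])
    qed (simp add: r r')
    then show "int m dvd j - k" using ray_eqD[OF lr r(1,2) r'(1,2)] by blast
  next
    assume "int m dvd j - k"
    then obtain i where i: "j = k + int m * i" by (metis add_diff_cancel_left' diff_add_cancel dvd_def add.commute)
    have r: "0 < R / 2" "R / 2 < R" using R by auto
    have "rcis (R / 2) (\<tau> (R / 2) j) = rcis (R / 2) (\<tau> (R / 2) k)"
      unfolding i ray_angle_shift[OF lr r] by (simp add: rcis_def cis_mult[symmetric])
    then show "E j = E k"
      using shabat_edges_disjoint[OF E(1) E(1)] AE[OF r, of j] AE[OF r, of k] by metis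
  qed
  then have "ray_edges f v m R \<tau> E" using lr E(1) AE by (auto simp: ray_edges_def)
  then show thesis using that by (simp add: m_def)
qed

lemma ray_edgesD:
  assumes "ray_edges f v m R \<tau> E"
  shows "local_rays f v m R \<tau>" "E j \<in> shabat_edges f 0 1"
    "0 < r \<Longrightarrow> r < R \<Longrightarrow> v + rcis r (\<tau> r j) \<in> E j" "E j = E k \<longleftrightarrow> int m dvd j - k" "R > 0" "m > 0"
  using assms by (auto simp: ray_edges_def local_rays_def)

text \<open>A point of \<open>e\<close> close to \<open>v\<close> has its value in the interval, so
  it lies on one of the rays, and disjointness of edges identifies \<open>e\<close> with the edge of
  that ray.\<close>

lemma edge_at_root_iff:
  assumes re: "ray_edges f v m R \<tau> E" and v: "poly f v = 0" and e: "e \<in> shabat_edges f 0 1"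
  shows "v \<in> closure e \<longleftrightarrow> e \<in> range E"
proof
  note D = ray_edgesD[OF re]
  assume "v \<in> closure e"
  then obtain x where x: "x \<in> e" "dist x v < R" using D(5) by (auto simp: closure_approachable)
  have xI: "poly f x \<in> I01" using in_components_subset[of e] x e by (auto simp: shabat_edges_def)
  then have "x \<noteq> v" using v by (auto simp: I01_iff)
  define r where "r = norm (x - v)"
  have r: "0 < r" "r < R" using x \<open>x \<noteq> v\<close> by (auto simp: r_def dist_norm)
  have xe: "x = v + rcis r (Arg (x - v))" by (simp add: r_def rcis_cmod_Arg)
  have "poly f x \<in> closed_segment 0 1" using xI by (auto simp: I01_iff closed01_iff)
  then obtain j where "Arg (x - v) = \<tau> r j" using local_raysD(1)[OF D(1) r] xe by metis
  then have "x \<in> E j" using D(3)[OF r] xe by metis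
  then show "e \<in> range E" using shabat_edges_disjoint[OF e D(2) x(1)] by blast
next
  note D = ray_edgesD[OF re]
  assume "e \<in> range E"
  then obtain j where j: "e = E j" by auto
  show "v \<in> closure e"
    unfolding closure_approachable
  proof (intro allI impI)
    fix d :: real assume "d > 0"
    define r where "r = min d R / 2"
    have r: "0 < r" "r < R" "r < d" using \<open>d > 0\<close> D(5) by (auto simp: r_def)
    show "\<exists>y\<in>e. dist y v < d"
      using D(3)[OF r(1,2), of j] r j by (intro bexI[of _ "v + rcis r (\<tau> r j)"]) (auto simp: dist_norm)
  qed
qed

text \<open>Near a black end an edge takes every small positive value. With two different black ends
  the same value would occur in two disjoint discs, against injectivity on the edge.\<close>

lemma black_end_unique:
  assumes f: "shabat f 0 1" and e: "e \<in> shabat_edges f 0 1"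
    and u: "poly f u = 0" "u \<in> closure e" and v: "poly f v = 0" "v \<in> closure e"
  shows "u = v"
proof (rule ccontr)
  assume ne: "u \<noteq> v"
  obtain m R \<tau> E where re: "ray_edges f u m R \<tau> E" using ray_edges_exist[OF f u(1)] by metis
  obtain m' R' \<tau>' E' where re': "ray_edges f v m' R' \<tau>' E'" using ray_edges_exist[OF f v(1)] by metis
  note D = ray_edgesD[OF re] and D' = ray_edgesD[OF re']
  obtain j where j: "e = E j" using edge_at_root_iff[OF re u(1) e] u(2) by auto
  obtain k where k: "e = E' k" using edge_at_root_iff[OF re' v(1) e] v(2) by auto
  define \<rho> where "\<rho> = min (dist u v / 2) (min R R')"
  have \<rho>: "0 < \<rho>" "\<rho> \<le> R" "\<rho> \<le> R'" "\<rho> \<le> dist u v / 2" using ne D(5) D'(5) by (auto simp: \<rho>_def)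
  obtain s where s: "s > 0" "\<And>t. 0 < t \<Longrightarrow> t < s \<Longrightarrow> \<exists>r. 0 < r \<and> r < \<rho> \<and> poly f (u + rcis r (\<tau> r j)) = of_real t"
    using ray_values[OF D(1) u(1) \<rho>(1,2)] by metis
  obtain s' where s': "s' > 0" "\<And>t. 0 < t \<Longrightarrow> t < s' \<Longrightarrow> \<exists>r. 0 < r \<and> r < \<rho> \<and> poly f (v + rcis r (\<tau>' r k)) = of_real t"
    using ray_values[OF D'(1) v(1) \<rho>(1,3)] by metis
  define t where "t = min s s' / 2"
  have t: "0 < t" "t < s" "t < s'" using s(1) s'(1) by (auto simp: t_def)
  obtain r where r: "0 < r" "r < \<rho>" "poly f (u + rcis r (\<tau> r j)) = of_real t" using s(2) t by blast
  obtain r' where r': "0 < r'" "r' < \<rho>" "poly f (v + rcis r' (\<tau>' r' k)) = of_real t" using s'(2) t by blast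
  have "u + rcis r (\<tau> r j) = v + rcis r' (\<tau>' r' k)"
  proof (rule inj_onD[OF shabat_edge_facts(1)[OF f e]])
    show "u + rcis r (\<tau> r j) \<in> e" unfolding j by (rule D(3)) (use r \<rho> in auto)
    show "v + rcis r' (\<tau>' r' k) \<in> e" unfolding k by (rule D'(3)) (use r' \<rho> in auto)
  qed (simp add: r r')
  then have "u - v = rcis r' (\<tau>' r' k) - rcis r (\<tau> r j)" by (simp add: algebra_simps)
  then have "dist u v \<le> r' + r"
    using norm_triangle_ineq4[of "rcis r' (\<tau>' r' k)" "rcis r (\<tau> r j)"] r r' by (simp add: dist_norm)
  then show False using r r' \<rho> by simp
qed

section \<open>Closures of edges and their ends\<close>

lemma compact_poly_preimage:
  fixes f :: "complex poly"
  assumes "degree f > 0" "compact S"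
  shows "compact (poly f -` S)"
proof -
  have "compact {z. (\<Sum>i\<le>degree f. coeff f i * z ^ i) \<in> S}"
    using assms by (intro proper_map_polyfun_univ[of S "coeff f" "degree f"]) auto
  moreover have "{z. (\<Sum>i\<le>degree f. coeff f i * z ^ i) \<in> S} = poly f -` S"
    by (auto simp: poly_altdef)
  ultimately show ?thesis by simp
qed

text \<open>Compactness comes from properness of \<open>f\<close>, and a compact image that contains
  the open interval contains the closed one. No further point over the open interval is added
  because a component is relatively closed there.\<close>

lemma edge_closure:
  assumes f: "shabat f 0 1" and e: "e \<in> shabat_edges f 0 1"
  shows "closure e \<subseteq> poly f -` closed_segment 0 1" "compact (closure e)" "connected (closure e)"
    "poly f ` closure e = closed_segment 0 1" "closure e \<inter> poly f -` I01 = e"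
proof -
  have K: "compact (poly f -` closed_segment 0 1)"
    using f by (intro compact_poly_preimage) (auto simp: shabat_def)
  have eX: "e \<subseteq> poly f -` I01" using in_components_subset[of e] e by (auto simp: shabat_edges_def)
  also have "\<dots> \<subseteq> poly f -` closed_segment 0 1" using segment_open_subset_closed by blast
  finally show sub: "closure e \<subseteq> poly f -` closed_segment 0 1"
    by (rule closure_minimal) (rule compact_imp_closed[OF K])
  then show comp: "compact (closure e)"
    using K by (metis bounded_subset closed_closure compact_eq_bounded_closed)
  show "connected (closure e)" using shabat_edge_facts(3)[OF f e] by (rule connected_imp_connected_closure)
  have "compact (poly f ` closure e)" using comp by (intro compact_continuous_image continuous_intros)
  then have "closed (poly f ` closure e)" by (rule compact_imp_closed)
  moreover have "I01 \<subseteq> poly f ` closure e"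
    using shabat_edge_facts(2)[OF f e] closure_subset[of e] by blast
  ultimately have "closure I01 \<subseteq> poly f ` closure e" by (intro closure_minimal)
  then show "poly f ` closure e = closed_segment 0 1" using sub by (auto simp: closure_open_segment)
  have "closedin (top_of_set (poly f -` I01)) e"
    using e unfolding shabat_edges_def by (rule closedin_component)
  then obtain T where T: "closed T" "e = poly f -` I01 \<inter> T" by (auto simp: closedin_closed)
  then have "closure e \<subseteq> T" by (intro closure_minimal) auto
  then show "closure e \<inter> poly f -` I01 = e" using T closure_subset[of e] by blast
qed

lemma edge_end_black:
  assumes f: "shabat f 0 1" and e: "e \<in> shabat_edges f 0 1"
  shows "edge_end f 0 e = v \<longleftrightarrow> poly f v = 0 \<and> v \<in> closure e"
proof -
  have "0 \<in> poly f ` closure e" unfolding edge_closure(4)[OF f e] by simp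
  then obtain u where u: "poly f u = 0" "u \<in> closure e" by (metis imageE)
  have "edge_end f 0 e = u"
    unfolding edge_end_def using u black_end_unique[OF f e] by (intro the_equality) auto
  then show ?thesis using u black_end_unique[OF f e u] by blast
qed

text \<open>Passing from \<open>f\<close> to \<open>1 - f\<close> exchanges the two colors.\<close>

lemma vimage_complement_segment:
  "poly (1 - f) -` open_segment 0 1 = poly f -` open_segment (0::complex) 1"
  "poly (1 - f) -` closed_segment 0 1 = poly f -` closed_segment (0::complex) 1"
  by (auto simp: I01_iff closed01_iff)

lemma shabat_complement: "shabat f 0 1 \<Longrightarrow> shabat (1 - f) 0 1"
proof -
  assume f: "shabat f 0 1"
  have "degree (1 - f) = degree f"
    using f degree_add_eq_right[of 1 "- f"] by (simp add: shabat_def)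
  then show ?thesis using f by (auto simp: shabat_def pderiv_diff pderiv_1)
qed

lemma shabat_edges_complement: "shabat_edges (1 - f) 0 1 = shabat_edges f 0 1"
  unfolding shabat_edges_def vimage_complement_segment ..

lemma edge_end_complement: "edge_end (1 - f) 0 e = edge_end f 1 e"
  by (simp add: edge_end_def eq_commute[of "0::complex"] right_minus_eq)

lemma edge_rot_complement: "edge_rot (1 - f) 0 1 0 e = edge_rot f 0 1 1 e"
  by (simp add: edge_rot_def shabat_edges_complement vimage_complement_segment edge_end_complement)

lemma edge_end_white:
  assumes f: "shabat f 0 1" and e: "e \<in> shabat_edges f 0 1"
  shows "edge_end f 1 e = v \<longleftrightarrow> poly f v = 1 \<and> v \<in> closure e"
  using edge_end_black[OF shabat_complement[OF f], unfolded shabat_edges_complement, OF e, of v]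
  by (auto simp: edge_end_complement)

lemma edge_endD:
  assumes f: "shabat f 0 1" and e: "e \<in> shabat_edges f 0 1"
  shows "poly f (edge_end f 0 e) = 0" "poly f (edge_end f 1 e) = 1"
    "edge_end f 0 e \<in> closure e" "edge_end f 1 e \<in> closure e"
    "closure e = e \<union> {edge_end f 0 e, edge_end f 1 e}"
proof -
  show *: "poly f (edge_end f 0 e) = 0" "poly f (edge_end f 1 e) = 1"
    "edge_end f 0 e \<in> closure e" "edge_end f 1 e \<in> closure e"
    using edge_end_black[OF f e] edge_end_white[OF f e] by blast+
  have "x \<in> e \<union> {edge_end f 0 e, edge_end f 1 e}" if x: "x \<in> closure e" for x
  proof -
    have "poly f x \<in> closed_segment 0 1" using edge_closure(1)[OF f e] x by blast
    then have "poly f x \<in> I01 \<or> poly f x = 0 \<or> poly f x = 1" by (auto simp: open_segment_def)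
    then show ?thesis
      using edge_closure(5)[OF f e] x edge_end_black[OF f e, of x] edge_end_white[OF f e, of x] by blast
  qed
  then show "closure e = e \<union> {edge_end f 0 e, edge_end f 1 e}" using * closure_subset[of e] by blast
qed

lemma next_ccw_ray:
  assumes re: "ray_edges f v m R \<tau> E"
  shows "next_ccw (poly f -` closed_segment 0 1) v (E j) (E (j + 1))"
proof -
  note D = ray_edgesD[OF re]
  have "\<exists>\<theta> \<phi>. \<phi> > 0 \<and> v + rcis r \<theta> \<in> E j \<and> v + rcis r (\<theta> + \<phi>) \<in> E (j + 1) \<and>
        (\<forall>\<psi>. 0 < \<psi> \<and> \<psi> < \<phi> \<longrightarrow> v + rcis r (\<theta> + \<psi>) \<notin> poly f -` closed_segment 0 1)"
    if r: "0 < r" "r < R" for r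
  proof (intro exI conjI allI impI)
    note sm = local_raysD(3)[OF D(1) r]
    show "\<tau> r (j + 1) - \<tau> r j > 0" using sm by (simp add: strict_mono_less)
    show "v + rcis r (\<tau> r j) \<in> E j" "v + rcis r (\<tau> r j + (\<tau> r (j + 1) - \<tau> r j)) \<in> E (j + 1)"
      using D(3)[OF r] by simp_all
    fix \<psi> assume \<psi>: "0 < \<psi> \<and> \<psi> < \<tau> r (j + 1) - \<tau> r j"
    show "v + rcis r (\<tau> r j + \<psi>) \<notin> poly f -` closed_segment 0 1"
    proof
      assume "v + rcis r (\<tau> r j + \<psi>) \<in> poly f -` closed_segment 0 1"
      then obtain i where i: "\<tau> r j + \<psi> = \<tau> r i" using local_raysD(1)[OF D(1) r] by auto
      then have "\<tau> r j < \<tau> r i" "\<tau> r i < \<tau> r (j + 1)" using \<psi> by auto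
      then show False using sm by (simp add: strict_mono_less)
    qed
  qed
  then show ?thesis
    unfolding next_ccw_def using D(5) by (intro eventually_at_rightI[of 0 R]) auto
qed

text \<open>A single radius below \<open>R\<close> decides. Both angles are values of
  \<open>\<tau> r\<close>, and none lies strictly between them, so they have consecutive numbers
  \<open>k\<close> and \<open>k + 1\<close>; as \<open>E j = E k\<close>, periodicity gives
  \<open>E (j + 1) = E (k + 1)\<close>.\<close>

lemma next_ccw_ray_unique:
  assumes re: "ray_edges f v m R \<tau> E" and e': "e' \<in> shabat_edges f 0 1"
    and nx: "next_ccw (poly f -` closed_segment 0 1) v (E j) e'"
  shows "e' = E (j + 1)"
proof -
  note D = ray_edgesD[OF re]
  let ?K = "poly f -` closed_segment 0 1"
  have "\<forall>\<^sub>F r in at_right (0::real). r \<in> {0<..<R}" using D(5) by (rule eventually_at_right_real)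
  with nx[unfolded next_ccw_def] have "\<forall>\<^sub>F r in at_right 0. r \<in> {0<..<R} \<and> (\<exists>\<theta> \<phi>. \<phi> > 0 \<and>
        v + rcis r \<theta> \<in> E j \<and> v + rcis r (\<theta> + \<phi>) \<in> e' \<and>
        (\<forall>\<psi>. 0 < \<psi> \<and> \<psi> < \<phi> \<longrightarrow> v + rcis r (\<theta> + \<psi>) \<notin> ?K))"
    by eventually_elim blast
  then have "\<exists>r. r \<in> {0<..<R} \<and> (\<exists>\<theta> \<phi>. \<phi> > 0 \<and>
        v + rcis r \<theta> \<in> E j \<and> v + rcis r (\<theta> + \<phi>) \<in> e' \<and>
        (\<forall>\<psi>. 0 < \<psi> \<and> \<psi> < \<phi> \<longrightarrow> v + rcis r (\<theta> + \<psi>) \<notin> ?K))"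
    by (rule eventually_happens'[rotated]) simp
  then obtain r \<theta> \<phi> where r: "0 < r" "r < R" and \<phi>: "\<phi> > 0"
    "v + rcis r \<theta> \<in> E j" "v + rcis r (\<theta> + \<phi>) \<in> e'"
    "\<And>\<psi>. 0 < \<psi> \<Longrightarrow> \<psi> < \<phi> \<Longrightarrow> v + rcis r (\<theta> + \<psi>) \<notin> ?K" by auto
  note sm = local_raysD(3)[OF D(1) r]
  have edgeK: "e \<subseteq> ?K" if "e \<in> shabat_edges f 0 1" for e
    using in_components_subset[of e] that segment_open_subset_closed[of "0::complex" 1] unfolding shabat_edges_def by blast
  have "poly f (v + rcis r \<theta>) \<in> closed_segment 0 1" "poly f (v + rcis r (\<theta> + \<phi>)) \<in> closed_segment 0 1"
    using \<phi> edgeK[OF D(2)] edgeK[OF e'] by blast+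
  then obtain k k' where k: "\<theta> = \<tau> r k" "\<theta> + \<phi> = \<tau> r k'"
    using local_raysD(1)[OF D(1) r] by metis
  then have "\<tau> r k < \<tau> r k'" using \<phi>(1) by simp
  then have "k < k'" using sm by (simp add: strict_mono_less)
  have "k' = k + 1"
  proof (rule ccontr)
    assume "k' \<noteq> k + 1"
    then have "k < k + 1" "k + 1 < k'" using \<open>k < k'\<close> by auto
    then have "\<tau> r k < \<tau> r (k + 1)" "\<tau> r (k + 1) < \<tau> r k'" using sm by (simp_all add: strict_mono_less)
    then have "v + rcis r (\<theta> + (\<tau> r (k + 1) - \<tau> r k)) \<notin> ?K" using k by (intro \<phi>(4)) auto
    then show False using D(3)[OF r, of "k + 1"] edgeK[OF D(2)] k by auto
  qed
  have "E j = E k" using shabat_edges_disjoint[OF D(2) D(2) \<phi>(2)] D(3)[OF r, of k] k by metis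
  then have "int m dvd (j + 1) - (k + 1)" using D(4) by simp
  then have "E (j + 1) = E (k + 1)" using D(4) by blast
  moreover have "e' = E k'" using shabat_edges_disjoint[OF e' D(2) \<phi>(3)] D(3)[OF r, of k'] k by metis
  ultimately show ?thesis using \<open>k' = k + 1\<close> by simp
qed

lemma ray_edge_end:
  assumes f: "shabat f 0 1" and re: "ray_edges f v m R \<tau> E" and v: "poly f v = 0"
  shows "edge_end f 0 (E j) = v"
  using edge_end_black[OF f ray_edgesD(2)[OF re]] edge_at_root_iff[OF re v ray_edgesD(2)[OF re]] v by blast

lemma ray_edge_rot:
  assumes f: "shabat f 0 1" and re: "ray_edges f v m R \<tau> E" and v: "poly f v = 0"
  shows "edge_rot f 0 1 0 (E j) = E (j + 1)"
  unfolding edge_rot_def ray_edge_end[OF f re v]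
  using next_ccw_ray[OF re] next_ccw_ray_unique[OF re] ray_edgesD(2)[OF re]
  by (intro the_equality) auto

lemma range_periodic:
  assumes "m > 0" "\<And>j k. E j = E k \<longleftrightarrow> int m dvd j - k"
  shows "range E = E ` {0..<int m}" "card (range E) = m"
proof -
  have "E j \<in> E ` {0..<int m}" for j
  proof (rule image_eqI)
    show "E j = E (j mod int m)" using assms by (simp add: mod_eq_dvd_iff[symmetric])
    show "j mod int m \<in> {0..<int m}" using assms by simp
  qed
  then show *: "range E = E ` {0..<int m}" by auto
  have "inj_on E {0..<int m}"
  proof
    fix j k assume jk: "j \<in> {0..<int m}" "k \<in> {0..<int m}" "E j = E k"
    then have "int m dvd j - k" using assms by blast
    then have "j mod int m = k mod int m" by (simp add: mod_eq_dvd_iff)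
    then show "j = k" using jk by simp
  qed
  then show "card (range E) = m" unfolding * by (simp add: card_image)
qed

text \<open>In the numbering of the rays the rotation is \<open>j \<mapsto> j + 1\<close>, so the
  edges at \<open>v\<close> form one orbit of length \<open>m\<close>.\<close>

lemma edges_at_black_root:
  assumes f: "shabat f 0 1" and v: "poly f v = 0"
  defines "S \<equiv> {e \<in> shabat_edges f 0 1. edge_end f 0 e = v}"
  shows "card S = Polynomial.order v f" "cyclic_on (edge_rot f 0 1 0) S"
proof -
  define m where "m = Polynomial.order v f"
  obtain R \<tau> E where re: "ray_edges f v m R \<tau> E"
    using ray_edges_exist[OF f v] unfolding m_def by metis
  note D = ray_edgesD[OF re]
  have S: "S = range E"
    unfolding S_def using edge_end_black[OF f] edge_at_root_iff[OF re v] D(2) v by blast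
  then show "card S = Polynomial.order v f" using range_periodic(2)[of m E, OF D(6) D(4)] by (simp add: m_def)
  let ?r = "edge_rot f 0 1 0"
  have rot: "?r (E j) = E (j + 1)" for j by (rule ray_edge_rot[OF f re v])
  have pos: "E (int (Suc n)) \<in> orbit ?r (E 0)" for n
  proof (induction n)
    case 0
    then show ?case using orbit.base[of ?r "E 0"] rot[of 0] by simp
  next
    case (Suc n)
    then show ?case using orbit.step[OF Suc] rot[of "int (Suc n)"] by (simp add: add.commute)
  qed
  have "range E \<subseteq> orbit ?r (E 0)"
  proof
    fix e assume "e \<in> range E"
    then obtain j where j: "e = E j" by auto
    \<comment> \<open>Adding \<open>m\<close> makes the index at least 1: \<open>orbit\<close>
      collects the iterates from the first one on.\<close>
    have "E j = E (j mod int m + int m)" using D(4,6) by (simp add: mod_eq_dvd_iff[symmetric])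
    moreover have "a + int m = int (Suc (nat (a + int m - 1)))" if "a \<ge> 0" for a using D(6) that by auto
    then have "j mod int m + int m = int (Suc (nat (j mod int m + int m - 1)))" using D(6) by (metis pos_mod_sign of_nat_0_less_iff)
    ultimately show "e \<in> orbit ?r (E 0)" using pos j by metis
  qed
  moreover have "x \<in> range E" if "x \<in> orbit ?r (E 0)" for x
    using that by induction (auto simp: rot)
  ultimately show "cyclic_on ?r S" unfolding cyclic_on_def S by blast
qed

lemma edges_at_white_root:
  assumes f: "shabat f 0 1" and v: "poly f v = 1"
  defines "S \<equiv> {e \<in> shabat_edges f 0 1. edge_end f 1 e = v}"
  shows "card S = Polynomial.order v (f - 1)" "cyclic_on (edge_rot f 0 1 1) S"
proof -
  have *: "S = {e \<in> shabat_edges (1 - f) 0 1. edge_end (1 - f) 0 e = v}"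
    by (simp add: S_def shabat_edges_complement edge_end_complement)
  have v': "poly (1 - f) v = 0" using v by simp
  show "card S = Polynomial.order v (f - 1)"
    using edges_at_black_root(1)[OF shabat_complement[OF f] v'] order_uminus[of v "f - 1"] by (simp add: *)
  have "edge_rot (1 - f) 0 1 0 = edge_rot f 0 1 1" by (rule ext) (rule edge_rot_complement)
  then show "cyclic_on (edge_rot f 0 1 1) S"
    using edges_at_black_root(2)[OF shabat_complement[OF f] v'] by (simp add: *)
qed

text \<open>Symmetries of the plane act on the rotations through this characterization.\<close>

lemma edge_rot_black_char:
  assumes f: "shabat f 0 1" and e: "e \<in> shabat_edges f 0 1"
  shows "edge_rot f 0 1 0 e \<in> shabat_edges f 0 1"
    "next_ccw (poly f -` closed_segment 0 1) (edge_end f 0 e) e (edge_rot f 0 1 0 e)"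
    "e' \<in> shabat_edges f 0 1 \<Longrightarrow> next_ccw (poly f -` closed_segment 0 1) (edge_end f 0 e) e e' \<Longrightarrow> e' = edge_rot f 0 1 0 e"
    "edge_end f 0 (edge_rot f 0 1 0 e) = edge_end f 0 e"
proof -
  define v where "v = edge_end f 0 e"
  have v: "poly f v = 0" "v \<in> closure e" using edge_endD[OF f e] by (auto simp: v_def)
  obtain m R \<tau> E where re: "ray_edges f v m R \<tau> E" using ray_edges_exist[OF f v(1)] by metis
  obtain j where j: "e = E j" using edge_at_root_iff[OF re v(1) e] v(2) by auto
  have r: "edge_rot f 0 1 0 e = E (j + 1)" unfolding j by (rule ray_edge_rot[OF f re v(1)])
  show "edge_rot f 0 1 0 e \<in> shabat_edges f 0 1" unfolding r by (rule ray_edgesD(2)[OF re])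
  show "next_ccw (poly f -` closed_segment 0 1) (edge_end f 0 e) e (edge_rot f 0 1 0 e)"
    unfolding r v_def[symmetric] unfolding j by (rule next_ccw_ray[OF re])
  show "e' = edge_rot f 0 1 0 e" if "e' \<in> shabat_edges f 0 1" "next_ccw (poly f -` closed_segment 0 1) (edge_end f 0 e) e e'"
    unfolding r using that(2)[folded v_def, unfolded j] by (rule next_ccw_ray_unique[OF re that(1)])
  show "edge_end f 0 (edge_rot f 0 1 0 e) = edge_end f 0 e"
    unfolding r v_def[symmetric] by (rule ray_edge_end[OF f re v(1)])
qed

section \<open>Shabat trees are trees\<close>

lemma sum_order_roots:
  fixes p :: "complex poly"
  assumes "p \<noteq> 0"
  shows "(\<Sum>z | poly p z = 0. Polynomial.order z p) = degree p"
proof -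
  have "degree p = size (proots p)" by (simp add: size_proots_complex)
  also have "\<dots> = (\<Sum>z\<in>set_mset (proots p). count (proots p) z)" by (rule size_multiset_overloaded_eq)
  also have "\<dots> = (\<Sum>z | poly p z = 0. Polynomial.order z p)" using assms by simp
  finally show ?thesis ..
qed

lemma order_pderiv_eq:
  fixes p :: "complex poly"
  assumes "degree p > 0" "poly p z = 0"
  shows "Polynomial.order z p = Suc (Polynomial.order z (pderiv p))"
proof -
  have "p \<noteq> 0" "pderiv p \<noteq> 0" using assms(1) by (auto simp: pderiv_eq_0_iff)
  then show ?thesis using assms(2) by (intro order_pderiv) (auto simp: order_root)
qed

lemma shabat_vertices:
  assumes f: "shabat f 0 1"
  shows "finite (poly f -` {0, 1})" "card (poly f -` {0, 1}) = degree f + 1"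
proof -
  let ?B = "poly f -` {0}" and ?W = "poly f -` {1}"
  have deg: "degree f > 0" and f0: "f \<noteq> 0" using f by (auto simp: shabat_def)
  have W_eq: "?W = {z. poly (f - 1) z = 0}" by auto
  have B_eq: "?B = {z. poly f z = 0}" by auto
  have deg1: "degree (f - 1) = degree f" using deg degree_add_eq_left[of "- 1" f] by simp
  then have f1: "f - 1 \<noteq> 0" using deg by auto
  have p1: "pderiv (f - 1) = pderiv f" by (simp add: pderiv_diff pderiv_1)
  have p0: "pderiv f \<noteq> 0" using deg by (auto simp: pderiv_eq_0_iff)
  have finB: "finite ?B" and finW: "finite ?W"
    unfolding B_eq W_eq by (intro poly_roots_finite f0 f1)+
  have un: "poly f -` {0, 1} = ?B \<union> ?W" by auto
  have disj: "?B \<inter> ?W = {}" by auto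
  show fin: "finite (poly f -` {0, 1})" unfolding un using finB finW by simp
  have oB: "Polynomial.order z f = Suc (Polynomial.order z (pderiv f))" if "z \<in> ?B" for z
    using order_pderiv_eq[OF deg, of z] that by simp
  have oW: "Polynomial.order z (f - 1) = Suc (Polynomial.order z (pderiv f))" if "z \<in> ?W" for z
    using order_pderiv_eq[of "f - 1" z] that deg deg1 by (simp add: p1)
  have "degree f - 1 = (\<Sum>z | poly (pderiv f) z = 0. Polynomial.order z (pderiv f))"
    by (simp add: sum_order_roots[OF p0] degree_pderiv)
  \<comment> \<open>All critical points are vertices, and a vertex that is not critical contributes
    order 0. Each vertex has one more as its degree than as its order in \<open>pderiv f\<close>, so
    the degrees of both colors, \<open>2 * degree f\<close> in total, amount to the number of
    vertices plus \<open>degree f - 1\<close>.\<close>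
  also have "\<dots> = (\<Sum>z\<in>?B \<union> ?W. Polynomial.order z (pderiv f))"
    using f finB finW by (intro sum.mono_neutral_left) (auto simp: shabat_def order_0I)
  also have "\<dots> = (\<Sum>z\<in>?B. Polynomial.order z (pderiv f)) + (\<Sum>z\<in>?W. Polynomial.order z (pderiv f))"
    using disj finB finW by (intro sum.union_disjoint)
  finally have 1: "degree f - 1 = (\<Sum>z\<in>?B. Polynomial.order z (pderiv f)) + (\<Sum>z\<in>?W. Polynomial.order z (pderiv f))" .
  have "degree f = (\<Sum>z\<in>?B. Polynomial.order z f)"
    unfolding B_eq using sum_order_roots[OF f0] by simp
  also have "\<dots> = (\<Sum>z\<in>?B. 1 + Polynomial.order z (pderiv f))" using oB by (intro sum.cong) auto
  finally have 2: "degree f = card ?B + (\<Sum>z\<in>?B. Polynomial.order z (pderiv f))" unfolding sum.distrib by simp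
  have "degree f = (\<Sum>z\<in>?W. Polynomial.order z (f - 1))"
    unfolding W_eq using sum_order_roots[OF f1] deg1 by simp
  also have "\<dots> = (\<Sum>z\<in>?W. 1 + Polynomial.order z (pderiv f))" using oW by (intro sum.cong) auto
  finally have 3: "degree f = card ?W + (\<Sum>z\<in>?W. Polynomial.order z (pderiv f))" unfolding sum.distrib by simp
  have "card (poly f -` {0, 1}) = card ?B + card ?W" unfolding un using disj finB finW by (rule card_Un_disjoint[rotated 2])
  then show "card (poly f -` {0, 1}) = degree f + 1" using 1 2 3 deg by linarith
qed

text \<open>
  \<open>f\<close> is real on the tree, so by the maximum principle for \<open>Im f\<close> no part of the tree can enclose
  a bounded region.
\<close>

lemma connected_complement_of_tree_part:
  fixes f :: "complex poly"
  assumes deg: "degree f > 0" and K: "compact K" "K \<subseteq> poly f -` closed_segment 0 1"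
  shows "connected (- K)"
proof (rule ccontr)
  assume "\<not> connected (- K)"
  then obtain C where C: "C \<in> components (- K)" "bounded C"
    using cobounded_has_bounded_component[of "- K"] compact_imp_bounded[OF K(1)] by auto
  have "closed K" using K(1) by (rule compact_imp_closed)
  then have "open C" using C(1) by (meson open_Compl open_components)
  have fr: "frontier C \<subseteq> K" using frontier_of_components_closed_complement[OF \<open>closed K\<close> C(1)] .
  have real: "Im (poly f z) = 0" if z: "z \<in> C" for z
  proof -
    have Imfr: "Im (poly f x) = 0" if "x \<in> frontier C" for x
      using that fr K(2) by (auto simp: closed01_iff)
    \<comment> \<open>The real parts of \<open>- \<i> * f\<close> and \<open>\<i> * f\<close> are
      \<open>Im f\<close> and \<open>- Im f\<close>; both vanish on the frontier.\<close>
    have "Re (- \<i> * poly f z) \<le> 0"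
      by (rule maximum_real_frontier[OF _ _ C(2) _ z])
         (use Imfr in \<open>auto intro!: holomorphic_intros continuous_intros poly_holomorphic_on\<close>)
    moreover have "Re (\<i> * poly f z) \<le> 0"
      by (rule maximum_real_frontier[OF _ _ C(2) _ z])
         (use Imfr in \<open>auto intro!: holomorphic_intros continuous_intros poly_holomorphic_on\<close>)
    ultimately show ?thesis by simp
  qed
  have "C \<noteq> {}" "connected C" using C(1) in_components_nonempty in_components_connected by auto
  \<comment> \<open>A nonconstant \<open>f\<close> would be open on \<open>C\<close> and take
    nonreal values next to a real one.\<close>
  have "poly f constant_on C"
  proof (rule ccontr)
    assume "\<not> poly f constant_on C"
    then have "open (poly f ` C)"
      using open_mapping_thm[of "poly f" C C] \<open>open C\<close> \<open>connected C\<close> poly_holomorphic_on[OF holomorphic_on_ident]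
      by blast
    moreover obtain z where z: "z \<in> C" using \<open>C \<noteq> {}\<close> by auto
    ultimately obtain e where e: "e > 0" "ball (poly f z) e \<subseteq> poly f ` C" by (metis openE imageI)
    have "poly f z + \<i> * of_real (e / 2) \<in> ball (poly f z) e" using e(1) by (simp add: dist_norm norm_mult)
    then obtain y where "y \<in> C" "poly f y = poly f z + \<i> * of_real (e / 2)" using e(2) by auto
    then have "Im (poly f y) = e / 2" using real[OF z] by simp
    then show False using real[OF \<open>y \<in> C\<close>] e(1) by simp
  qed
  then obtain c where c: "\<And>z. z \<in> C \<Longrightarrow> poly f z = c" by (auto simp: constant_on_def)
  have "infinite C" using \<open>open C\<close> \<open>C \<noteq> {}\<close> finite_imp_not_open by blast
  moreover have "C \<subseteq> {z. poly (f - [:c:]) z = 0}" using c by auto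
  ultimately have "f - [:c:] = 0" using poly_roots_finite infinite_super by blast
  then have "f = [:c:]" by simp
  then show False using deg by simp
qed

text \<open>For the set of all edges this is the relation in \<open>map_connected\<close>; with
  \<open>E\<close> as a parameter, edges can be removed or added one at a time.\<close>

definition links :: "('e \<Rightarrow> 'v) \<Rightarrow> ('e \<Rightarrow> 'v) \<Rightarrow> 'e set \<Rightarrow> ('v \<times> 'v) set" where
  "links b w E = (\<lambda>e. (b e, w e)) ` E \<union> (\<lambda>e. (w e, b e)) ` E"

lemma sym_links: "sym (links b w E)"
  by (auto simp: links_def sym_def)

lemma links_mono: "E \<subseteq> E' \<Longrightarrow> links b w E \<subseteq> links b w E'"
  by (auto simp: links_def)

text \<open>The closures of consecutive edges of a chain share an end, so their union is a
  continuum. The point \<open>x\<close> is listed separately for the empty chain.\<close>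

lemma links_imp_continuum:
  assumes f: "shabat f 0 1" and E: "E' \<subseteq> shabat_edges f 0 1"
    and xy: "(x, y) \<in> (links (edge_end f 0) (edge_end f 1) E')\<^sup>*"
  shows "\<exists>C. compact C \<and> connected C \<and> x \<in> C \<and> y \<in> C \<and> C \<subseteq> {x} \<union> (\<Union>e\<in>E'. closure e)"
  using xy
proof induction
  case base
  show ?case by (intro exI[of _ "{x}"]) auto
next
  case (step y z)
  then obtain C where C: "compact C" "connected C" "x \<in> C" "y \<in> C" "C \<subseteq> {x} \<union> (\<Union>e\<in>E'. closure e)" by blast
  obtain e where e: "e \<in> E'" "{y, z} = {edge_end f 0 e, edge_end f 1 e}"
    using step.hyps(2) by (auto simp: links_def)
  have eE: "e \<in> shabat_edges f 0 1" using E e by auto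
  have yz: "y \<in> closure e" "z \<in> closure e" using edge_endD(3,4)[OF f eE] e(2) by (auto simp: doubleton_eq_iff)
  show ?case
  proof (intro exI conjI)
    show "compact (C \<union> closure e)" using C(1) edge_closure(2)[OF f eE] by (rule compact_Un)
    show "connected (C \<union> closure e)" using C(2,4) edge_closure(3)[OF f eE] yz by (intro connected_Un) auto
  qed (use C e(1) yz in auto)
qed

text \<open>A chain of other edges between the ends of \<open>e\<close> gives a continuum
  \<open>C\<close> that meets the closure of \<open>e\<close> in just these two ends. Both continua
  lie in the preimage of the interval, so their union does not separate the plane, and Janiszewski's
  theorem makes the intersection connected, which two points are not.\<close>

lemma no_bypass:
  assumes f: "shabat f 0 1" and E': "E' \<subseteq> shabat_edges f 0 1" and e: "e \<in> shabat_edges f 0 1" "e \<notin> E'"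
  shows "(edge_end f 0 e, edge_end f 1 e) \<notin> (links (edge_end f 0) (edge_end f 1) E')\<^sup>*"
proof
  define b where "b = edge_end f 0 e"
  define w where "w = edge_end f 1 e"
  note ends = edge_endD[OF f e(1), folded b_def w_def]
  assume "(edge_end f 0 e, edge_end f 1 e) \<in> (links (edge_end f 0) (edge_end f 1) E')\<^sup>*"
  then obtain C where C: "compact C" "connected C" "b \<in> C" "w \<in> C" "C \<subseteq> {b} \<union> (\<Union>e\<in>E'. closure e)"
    using links_imp_continuum[OF f E'] unfolding b_def w_def by blast
  have "C \<subseteq> poly f -` closed_segment 0 1"
  proof -
    have "closure e' \<subseteq> poly f -` closed_segment 0 1" if "e' \<in> E'" for e'
      using edge_closure(1)[OF f] that E' by blast
    moreover have "b \<in> poly f -` closed_segment 0 1" using ends(1) by simp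
    ultimately show ?thesis using C(5) by blast
  qed
  then have "connected (- (closure e \<union> C))"
    using edge_closure(1,2)[OF f e(1)] C(1) f
    by (intro connected_complement_of_tree_part) (auto simp: shabat_def)
  then have conn: "connected (closure e \<inter> C)"
    using edge_closure(2,3)[OF f e(1)] C(1,2) by (intro Janiszewski_dual)
  have "closure e \<inter> C = {b, w}"
  proof
    show "{b, w} \<subseteq> closure e \<inter> C" using ends C by auto
    show "closure e \<inter> C \<subseteq> {b, w}"
    proof
      fix z assume z: "z \<in> closure e \<inter> C"
      show "z \<in> {b, w}"
      proof (rule ccontr)
        assume nz: "z \<notin> {b, w}"
        then have ze: "z \<in> e" using z ends(5) by auto
        obtain e' where e': "e' \<in> E'" "z \<in> closure e'" using z nz C(5) by auto
        have e'E: "e' \<in> shabat_edges f 0 1" using e' E' by auto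
        have "poly f z \<in> I01" using shabat_edge_facts(2)[OF f e(1)] ze by auto
        then have "z \<in> e'" using edge_closure(5)[OF f e'E] e'(2) by blast
        then have "e = e'" using shabat_edges_disjoint[OF e(1) e'E ze] by blast
        then show False using e' e(2) by simp
      qed
    qed
  qed
  then have "connected {b, w}" using conn by simp
  then have "b = w" using connected_finite_iff_sing[of "{b, w}"] by (auto simp: doubleton_eq_iff insert_eq_iff)
  then show False using ends(1,2) by simp
qed

text \<open>Mapping an \<open>R\<close>-class to the \<open>S\<close>-class around it is onto, and
  it merges the classes of \<open>x\<close> and \<open>y\<close>.\<close>

lemma card_quotient_less:
  assumes fin: "finite V" and R: "equiv V R" and S: "equiv V S" and sub: "R \<subseteq> S"
    and xy: "(x, y) \<in> S" "(x, y) \<notin> R"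
  shows "card (V // S) < card (V // R)"
proof -
  have x: "x \<in> V" and y: "y \<in> V" using xy(1) S by (auto simp: equiv_def refl_on_def)
  have SR: "S `` (R `` {a}) = S `` {a}" if "a \<in> V" for a
  proof -
    have "trans S" "(a, a) \<in> R" using R S that by (auto elim!: equivE dest: refl_onD)
    then show ?thesis using sub by (auto dest: transD)
  qed
  have img: "(\<lambda>X. S `` X) ` (V // R) = V // S"
    unfolding quotient_def using SR by (auto simp: image_UN)
  have finR: "finite (V // R)"
    unfolding quotient_def using fin by simp
  have "\<not> inj_on (\<lambda>X. S `` X) (V // R)"
  proof
    assume inj: "inj_on (\<lambda>X. S `` X) (V // R)"
    have "S `` (R `` {x}) = S `` (R `` {y})"
      unfolding SR[OF x] SR[OF y] using equiv_class_eq[OF S xy(1)] .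
    then have "R `` {x} = R `` {y}" by (rule inj_onD[OF inj _ quotientI[OF x] quotientI[OF y]])
    then show False using xy(2) eq_equiv_class[OF _ R y] by blast
  qed
  then have "card ((\<lambda>X. S `` X) ` (V // R)) \<noteq> card (V // R)"
    using eq_card_imp_inj_on[OF finR] by blast
  then show ?thesis using card_image_le[OF finR, of "\<lambda>X. S `` X"] img by simp
qed

text \<open>Each edge joins two different classes when it is added, since its ends were not linked
  before. Starting from singletons, at least \<open>card V - 1\<close> such joins leave at most one
  class.\<close>

lemma forest_connected:
  assumes fin: "finite V" "finite E" and ends: "b ` E \<subseteq> V" "w ` E \<subseteq> V"
    and forest: "\<And>E' e. E' \<subseteq> E \<Longrightarrow> e \<in> E \<Longrightarrow> e \<notin> E' \<Longrightarrow> (b e, w e) \<notin> (links b w E')\<^sup>*"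
    and card: "card V \<le> card E + 1" and uv: "u \<in> V" "v \<in> V"
  shows "(u, v) \<in> (links b w E)\<^sup>*"
proof -
  define r where "r E' = (links b w E')\<^sup>* \<inter> V \<times> V" for E'
  have eq: "equiv V (r E')" for E'
    unfolding equiv_def r_def
    by (intro conjI) (auto simp: refl_on_def sym_def trans_def dest: symD[OF sym_rtrancl[OF sym_links]])
  have "card (V // r E') + card E' \<le> card V" if "finite E'" "E' \<subseteq> E" for E'
    using that
  proof (induction E')
    case empty
    show ?case unfolding quotient_def using fin(1) by (simp add: UNION_singleton_eq_range card_image_le)
  next
    case (insert e F)
    have "card (V // r (insert e F)) < card (V // r F)"
    proof (rule card_quotient_less[OF fin(1) eq eq])
      show "r F \<subseteq> r (insert e F)" unfolding r_def using rtrancl_mono[OF links_mono[of F "insert e F"]] by auto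
      show "(b e, w e) \<in> r (insert e F)"
        using ends insert.prems by (auto simp: r_def links_def)
      show "(b e, w e) \<notin> r F" using forest[of F e] insert by (auto simp: r_def)
    qed
    then show ?case using insert by auto
  qed
  from this[OF fin(2) order_refl] card have "card (V // r E) \<le> Suc 0" by simp
  moreover have "finite (V // r E)" unfolding quotient_def using fin(1) by simp
  ultimately have "\<forall>X\<in>V // r E. \<forall>Y\<in>V // r E. X = Y" by (simp add: card_le_Suc0_iff_eq)
  then have "r E `` {u} = r E `` {v}" using uv by (simp add: quotientI)
  then show ?thesis using eq_equiv_class[OF _ eq uv(2)] by (auto simp: r_def)
qed

lemma shabat_tree_is_tree:
  assumes f: "shabat f 0 1"
  shows "bicolored_plane_tree (shabat_tree f 0 1)"
proof -
  let ?E = "shabat_edges f 0 1" and ?T = "shabat_tree f 0 1"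
  let ?b = "edge_end f 0" and ?w = "edge_end f 1"
  have V: "poly f -` {0} \<union> poly f -` {1} = poly f -` {0, 1}" by auto
  have fin: "finite (poly f -` {0})" "finite (poly f -` {1})"
    using shabat_vertices(1)[OF f] unfolding V[symmetric] by auto
  have ne: "?E \<noteq> {}" using card_shabat_edges[OF f] f by (auto simp: shabat_def)
  have ends: "?b ` ?E \<subseteq> poly f -` {0}" "?w ` ?E \<subseteq> poly f -` {1}"
    using edge_endD(1,2)[OF f] by auto
  have conn: "map_connected ?T"
  proof -
    have "(u, v) \<in> (links ?b ?w ?E)\<^sup>*" if "u \<in> poly f -` {0, 1}" "v \<in> poly f -` {0, 1}" for u v
      by (rule forest_connected[OF shabat_vertices(1)[OF f] card_shabat_edges(2)[OF f] _ _ no_bypass[OF f] _ that])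
         (use ends shabat_vertices(2)[OF f] card_shabat_edges(1)[OF f] in auto)
    then show ?thesis by (simp add: map_connected_def shabat_tree_def links_def V)
  qed
  have acyc: "\<nexists>es. is_cycle ?T es"
  proof
    assume "\<exists>es. is_cycle ?T es"
    then obtain es k where k: "k > 0" "length es = 2 * k" "distinct es" "set es \<subseteq> ?E"
      and cyc: "\<And>i. i < k \<Longrightarrow> ?b (es ! (2 * i)) = ?b (es ! (2 * i + 1))"
        "\<And>i. i < k \<Longrightarrow> ?w (es ! (2 * i + 1)) = ?w (es ! ((2 * i + 2) mod (2 * k)))"
      by (auto simp: is_cycle_def shabat_tree_def)
    \<comment> \<open>Without its edge number 0 the cycle is still a chain from the black to the
      white end of that edge, the bypass excluded by \<open>no_bypass\<close>.\<close>
    define e where "e = es ! 0"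
    define L where "L = links ?b ?w (set es - {e})"
    have inL: "(?b (es ! i), ?w (es ! i)) \<in> L" "(?w (es ! i), ?b (es ! i)) \<in> L" if "0 < i" "i < 2 * k" for i
    proof -
      have "es ! i \<in> set es - {e}" using that k by (auto simp: e_def nth_eq_iff_index_eq)
      then show "(?b (es ! i), ?w (es ! i)) \<in> L" "(?w (es ! i), ?b (es ! i)) \<in> L" by (auto simp: L_def links_def)
    qed
    have "(?b e, ?w (es ! (2 * i + 1))) \<in> L\<^sup>*" if "i < k" for i
      using that
    proof (induction i)
      case 0
      then show ?case using inL(1)[of 1] cyc(1)[of 0] by (simp add: e_def)
    next
      case (Suc i)
      then have "(?b e, ?w (es ! (2 * i + 1))) \<in> L\<^sup>*" by simp
      also have "?w (es ! (2 * i + 1)) = ?w (es ! (2 * Suc i))" using cyc(2)[of i] Suc.prems by simp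
      also have "(?w (es ! (2 * Suc i)), ?b (es ! (2 * Suc i))) \<in> L" using Suc.prems by (intro inL(2)) auto
      also have "?b (es ! (2 * Suc i)) = ?b (es ! (2 * Suc i + 1))" using cyc(1)[of "Suc i"] Suc.prems by simp
      also have "(?b (es ! (2 * Suc i + 1)), ?w (es ! (2 * Suc i + 1))) \<in> L" using Suc.prems by (intro inL(1)) auto
      finally show ?case .
    qed
    moreover obtain k' where k': "k = Suc k'" using k(1) by (cases k) auto
    ultimately have "(?b e, ?w (es ! (2 * k' + 1))) \<in> L\<^sup>*" by blast
    \<comment> \<open>The index \<open>2 * k' + 2\<close> equals \<open>2 * k\<close> and wraps
      around to edge 0.\<close>
    moreover have "?w (es ! (2 * k' + 1)) = ?w e"
      using cyc(2)[of k'] by (simp add: e_def k')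
    ultimately have "(?b e, ?w e) \<in> L\<^sup>*" by simp
    moreover have "e \<in> ?E" using k by (auto simp: e_def)
    ultimately show False using no_bypass[OF f, of "set es - {e}" e] k(4) by (auto simp: L_def)
  qed
  show ?thesis
    unfolding bicolored_plane_tree_def
  proof (intro conjI ballI)
    show "cyclic_on (black_rot ?T) (edges_at_black ?T v)" if "v \<in> blacks ?T" for v
      using edges_at_black_root(2)[OF f, of v] that by (simp add: shabat_tree_def edges_at_black_def)
    show "cyclic_on (white_rot ?T) (edges_at_white ?T v)" if "v \<in> whites ?T" for v
      using edges_at_white_root(2)[OF f, of v] that by (simp add: shabat_tree_def edges_at_white_def)
  qed (use fin card_shabat_edges(2)[OF f] ne ends conn acyc in \<open>auto simp: shabat_tree_def\<close>)
qed

lemma shabat_tree_degrees: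
  assumes f: "shabat f 0 1"
  shows "poly f v = 0 \<Longrightarrow> card (edges_at_black (shabat_tree f 0 1) v) = Polynomial.order v f"
    "poly f v = 1 \<Longrightarrow> card (edges_at_white (shabat_tree f 0 1) v) = Polynomial.order v (f - 1)"
  using edges_at_black_root(1)[OF f, of v] edges_at_white_root(1)[OF f, of v]
  by (simp_all add: shabat_tree_def edges_at_black_def edges_at_white_def)

section \<open>Rotations of plane trees\<close>

lemma cyclic_on_orbit_list:
  assumes c: "cyclic_on f S" and s: "s \<in> S"
  shows "S = (\<lambda>n. (f ^^ n) s) ` {0..<card S}" "inj_on (\<lambda>n. (f ^^ n) s) {0..<card S}" "(f ^^ card S) s = s"
proof -
  have S: "S = orbit f s" using c s by (simp add: cyclic_on_alldef)
  have so: "s \<in> orbit f s" using S s by simp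
  have *: "orbit f s = (\<lambda>n. (f ^^ n) s) ` {0..<funpow_dist1 f s s}" by (rule orbit_conv_funpow_dist1[OF so])
  have inj: "inj_on (\<lambda>n. (f ^^ n) s) {0..<funpow_dist1 f s s}" by (rule inj_on_funpow_dist1[OF so])
  have card: "card S = funpow_dist1 f s s" unfolding S * using inj by (simp only: card_image card_atLeastLessThan diff_zero)
  show "S = (\<lambda>n. (f ^^ n) s) ` {0..<card S}" unfolding card using S * by simp
  show "inj_on (\<lambda>n. (f ^^ n) s) {0..<card S}" unfolding card by (rule inj)
  show "(f ^^ card S) s = s" unfolding card by (rule funpow_dist1_prop[OF so])
qed

lemma cyclic_on_1:
  assumes "cyclic_on f S" "s \<in> S" "card S = 1"
  shows "f s = s" "S = {s}"
  using cyclic_on_orbit_list[OF assms(1,2)] assms(3) by auto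

lemma cyclic_on_2:
  assumes "cyclic_on f S" "s \<in> S" "card S = 2"
  shows "f (f s) = s" "f s \<noteq> s" "S = {s, f s}"
proof -
  have "{0..<card S} = {0, 1}" using assms(3) by auto
  then show "f (f s) = s" "f s \<noteq> s" "S = {s, f s}"
    using cyclic_on_orbit_list[OF assms(1,2)] assms(3) by (auto simp: numeral_2_eq_2)
qed

lemma cyclic_on_4:
  assumes "cyclic_on f S" "s \<in> S" "card S = 4"
  shows "f (f (f (f s))) = s" "S = {s, f s, f (f s), f (f (f s))}" "distinct [s, f s, f (f s), f (f (f s))]"
proof -
  have "{0..<card S} = {0, 1, 2, 3}" using assms(3) by auto
  then show "f (f (f (f s))) = s" "S = {s, f s, f (f s), f (f (f s))}"
      "distinct [s, f s, f (f s), f (f (f s))]"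
    using cyclic_on_orbit_list[OF assms(1,2)] assms(3)
    by (auto simp: numeral_2_eq_2 numeral_3_eq_3 numeral_eq_Suc)
qed

section \<open>Isomorphisms from the rotations\<close>

text \<open>The vertices of one color correspond to the orbits of its rotation, and \<open>h\<close>
  carries orbits to orbits. Isomorphisms of trees can thus be given on edges alone.\<close>

lemma vertex_bijection_from_rotation:
  assumes b: "b ` E \<subseteq> V" and b': "b' ` E' \<subseteq> V'"
    and r: "\<And>v. v \<in> V \<Longrightarrow> cyclic_on r {e \<in> E. b e = v}"
    and r': "\<And>v. v \<in> V' \<Longrightarrow> cyclic_on r' {e \<in> E'. b' e = v}"
    and h: "bij_betw h E E'" "\<And>e. e \<in> E \<Longrightarrow> r' (h e) = h (r e)"
  shows "\<exists>p. bij_betw p V V' \<and> (\<forall>e\<in>E. b' (h e) = p (b e))"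
proof -
  have orb: "{x \<in> E. b x = b e} = orbit r e" if "e \<in> E" for e
    using r[of "b e"] b that by (auto simp: cyclic_on_alldef)
  have orb': "{x \<in> E'. b' x = b' e} = orbit r' e" if "e \<in> E'" for e
    using r'[of "b' e"] b' that by (auto simp: cyclic_on_alldef)
  have hE: "h e \<in> E'" if "e \<in> E" for e using h(1) that by (auto simp: bij_betw_def)
  have rE: "r e \<in> E" "b (r e) = b e" if "e \<in> E" for e
    using orbit.base[of r e] orb[OF that] by auto
  have rE': "b' (r' e) = b' e" if "e \<in> E'" for e
    using orbit.base[of r' e] orb'[OF that] by auto
  have fwd: "b' (h x) = b' (h e)" if "e \<in> E" "x \<in> E" "b x = b e" for e x
  proof -
    have "x \<in> orbit r e" using orb that by auto
    then have "x \<in> E \<and> b' (h x) = b' (h e)"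
    proof induction
      case base
      show ?case using rE[OF that(1)] h(2)[OF that(1)] rE'[OF hE[OF that(1)]] by simp
    next
      case (step y)
      then show ?case using rE[of y] h(2)[of y] rE'[OF hE, of y] by simp
    qed
    then show ?thesis by simp
  qed
  have bwd: "b x = b e" if "e \<in> E" "x \<in> E" "b' (h x) = b' (h e)" for e x
  proof -
    have "h x \<in> orbit r' (h e)" using orb'[OF hE[OF that(1)]] hE[OF that(2)] that(3) by auto
    then have "\<exists>y\<in>E. h x = h y \<and> b y = b e"
    proof (induction "h x" arbitrary: x)
      case base
      then show ?case using h(2)[OF that(1)] rE[OF that(1)] by (intro bexI[of _ "r e"]) auto
    next
      case (step z)
      have "z \<in> E'" using step.hyps(1) orb'[OF hE[OF that(1)]] by auto
      then obtain z' where z': "z' \<in> E" "z = h z'" using h(1) by (auto simp: bij_betw_def)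
      then obtain y where "y \<in> E" "h z' = h y" "b y = b e" using step.hyps(2)[of z'] by auto
      then show ?case using h(2)[of y] rE[of y] step.hyps(3) z' by (intro bexI[of _ "r y"]) auto
    qed
    then show ?thesis using h(1) that by (auto simp: bij_betw_def inj_on_def)
  qed
  define c where "c v = (SOME e. e \<in> E \<and> b e = v)" for v
  have c: "c v \<in> E" "b (c v) = v" if "v \<in> V" for v
  proof -
    have "\<exists>e. e \<in> E \<and> b e = v" using r[OF that] by (auto simp: cyclic_on_def)
    from someI_ex[OF this] show "c v \<in> E" "b (c v) = v" by (auto simp: c_def)
  qed
  define p where "p v = b' (h (c v))" for v
  have p: "b' (h e) = p (b e)" if "e \<in> E" for e
    unfolding p_def using c[of "b e"] b that by (intro fwd) auto
  have "bij_betw p V V'"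
  proof (rule bij_betw_imageI)
    show "inj_on p V"
    proof
      fix u v assume "u \<in> V" "v \<in> V" "p u = p v"
      then show "u = v" using bwd[of "c v" "c u"] c[of u] c[of v] by (auto simp: p_def)
    qed
    show "p ` V = V'"
    proof (intro set_eqI iffI)
      fix v assume "v \<in> p ` V"
      then show "v \<in> V'" using c hE b' by (auto simp: p_def)
    next
      fix v assume v: "v \<in> V'"
      obtain e' where "e' \<in> E'" "b' e' = v" using r'[OF v] by (auto simp: cyclic_on_def)
      then obtain e where "e \<in> E" "b' (h e) = v" using h(1) by (auto simp: bij_betw_def)
      then show "v \<in> p ` V" using p[of e] b by auto
    qed
  qed
  then show ?thesis using p by blast
qed

lemma tree_isoI:
  assumes S: "bicolored_plane_tree S" and T: "bicolored_plane_tree T"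
    and h: "bij_betw h (edges S) (edges T)"
      "\<And>e. e \<in> edges S \<Longrightarrow> black_rot T (h e) = h (black_rot S e)"
      "\<And>e. e \<in> edges S \<Longrightarrow> white_rot T (h e) = h (white_rot S e)"
  shows "tree_iso S T"
proof -
  have "\<exists>p. bij_betw p (blacks S) (blacks T) \<and> (\<forall>e\<in>edges S. black_end T (h e) = p (black_end S e))"
    by (rule vertex_bijection_from_rotation[where r = "black_rot S" and r' = "black_rot T"])
      (use S T h in \<open>auto simp: bicolored_plane_tree_def edges_at_black_def\<close>)
  moreover have "\<exists>q. bij_betw q (whites S) (whites T) \<and> (\<forall>e\<in>edges S. white_end T (h e) = q (white_end S e))"
    by (rule vertex_bijection_from_rotation[where r = "white_rot S" and r' = "white_rot T"])
      (use S T h in \<open>auto simp: bicolored_plane_tree_def edges_at_white_def\<close>)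
  ultimately show ?thesis unfolding tree_iso_def using h by metis
qed

lemma tree_rot_in_edges:
  assumes T: "bicolored_plane_tree T" and e: "e \<in> edges T"
  shows "black_rot T e \<in> edges T" "black_end T (black_rot T e) = black_end T e"
    "white_rot T e \<in> edges T" "white_end T (white_rot T e) = white_end T e"
proof -
  have "cyclic_on (black_rot T) (edges_at_black T (black_end T e))"
    "cyclic_on (white_rot T) (edges_at_white T (white_end T e))"
    using T e by (auto simp: bicolored_plane_tree_def)
  then show "black_rot T e \<in> edges T" "black_end T (black_rot T e) = black_end T e"
    "white_rot T e \<in> edges T" "white_end T (white_rot T e) = white_end T e"
    using cyclic_on_inI[of "black_rot T" _ e] cyclic_on_inI[of "white_rot T" _ e] e
    by (auto simp: edges_at_black_def edges_at_white_def)
qed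

lemma tree_iso_edges:
  assumes "tree_iso S T"
  obtains h where "bij_betw h (edges S) (edges T)"
    "\<And>e. e \<in> edges S \<Longrightarrow> black_rot T (h e) = h (black_rot S e)"
    "\<And>e. e \<in> edges S \<Longrightarrow> white_rot T (h e) = h (white_rot S e)"
  using assms unfolding tree_iso_def by blast

text \<open>The rotations stay inside the edge sets, so the inverse edge map commutes with them; the
  vertex maps are then reconstructed from it.\<close>

lemma tree_iso_sym:
  assumes S: "bicolored_plane_tree S" and T: "bicolored_plane_tree T" and "tree_iso S T"
  shows "tree_iso T S"
proof -
  obtain h where h: "bij_betw h (edges S) (edges T)"
    "\<And>e. e \<in> edges S \<Longrightarrow> black_rot T (h e) = h (black_rot S e)"
    "\<And>e. e \<in> edges S \<Longrightarrow> white_rot T (h e) = h (white_rot S e)"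
    using tree_iso_edges[OF assms(3)] by metis
  define k where "k = the_inv_into (edges S) h"
  have k: "bij_betw k (edges T) (edges S)" unfolding k_def by (rule bij_betw_the_inv_into[OF h(1)])
  have hk: "h (k e) = e" "k e \<in> edges S" if "e \<in> edges T" for e
    using f_the_inv_into_f_bij_betw[OF h(1)] that k by (auto simp: k_def bij_betw_def)
  have kh: "k (h e) = e" if "e \<in> edges S" for e
    using the_inv_into_f_f[of h "edges S" e] h(1) that by (auto simp: k_def bij_betw_def)
  show ?thesis
  proof (rule tree_isoI[OF T S k])
    fix e assume e: "e \<in> edges T"
    show "black_rot S (k e) = k (black_rot T e)"
      using kh[OF tree_rot_in_edges(1)[OF S hk(2)[OF e]]] h(2)[OF hk(2)[OF e]] hk(1)[OF e] by simp
    show "white_rot S (k e) = k (white_rot T e)"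
      using kh[OF tree_rot_in_edges(3)[OF S hk(2)[OF e]]] h(3)[OF hk(2)[OF e]] hk(1)[OF e] by simp
  qed
qed

lemma tree_iso_trans:
  assumes "tree_iso S T" "tree_iso T U"
  shows "tree_iso S U"
proof -
  obtain p q h where 1: "bij_betw p (blacks S) (blacks T)" "bij_betw q (whites S) (whites T)"
      "bij_betw h (edges S) (edges T)"
      "\<forall>e \<in> edges S. black_end T (h e) = p (black_end S e) \<and> white_end T (h e) = q (white_end S e) \<and>
           black_rot T (h e) = h (black_rot S e) \<and> white_rot T (h e) = h (white_rot S e)"
    using assms(1) unfolding tree_iso_def by blast
  obtain p' q' h' where 2: "bij_betw p' (blacks T) (blacks U)" "bij_betw q' (whites T) (whites U)"
      "bij_betw h' (edges T) (edges U)"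
      "\<forall>e \<in> edges T. black_end U (h' e) = p' (black_end T e) \<and> white_end U (h' e) = q' (white_end T e) \<and>
           black_rot U (h' e) = h' (black_rot T e) \<and> white_rot U (h' e) = h' (white_rot T e)"
    using assms(2) unfolding tree_iso_def by blast
  have "h e \<in> edges T" if "e \<in> edges S" for e using 1(3) that by (auto simp: bij_betw_def)
  then show ?thesis unfolding tree_iso_def
    using 1(4) 2(4)
    by (intro exI[of _ "p' \<circ> p"] exI[of _ "q' \<circ> q"] exI[of _ "h' \<circ> h"] conjI
          bij_betw_trans[OF 1(1) 2(1)] bij_betw_trans[OF 1(2) 2(2)] bij_betw_trans[OF 1(3) 2(3)]) simp
qed

lemma tree_iso_passport:
  assumes S: "bicolored_plane_tree S" and "tree_iso S T" and "has_passport T \<alpha> \<beta> n"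
  shows "has_passport S \<alpha> \<beta> n"
proof -
  obtain p q h where i: "bij_betw p (blacks S) (blacks T)" "bij_betw q (whites S) (whites T)"
      "bij_betw h (edges S) (edges T)"
      "\<And>e. e \<in> edges S \<Longrightarrow> black_end T (h e) = p (black_end S e)"
      "\<And>e. e \<in> edges S \<Longrightarrow> white_end T (h e) = q (white_end S e)"
    using assms(2) unfolding tree_iso_def by blast
  have card_eq: "card {e \<in> edges T. b' e = p v} = card {e \<in> edges S. b e = v}"
    if "bij_betw p V V'" "v \<in> V" "b ` edges S \<subseteq> V" "\<And>e. e \<in> edges S \<Longrightarrow> b' (h e) = p (b e)"
    for p V V' v b b'
  proof -
    have "bij_betw h {e \<in> edges S. b e = v} {e \<in> edges T. b' e = p v}"
    proof (rule bij_betw_subset[OF i(3), THEN iffD1[OF bij_betw_cong[OF refl]]])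
      show "h ` {e \<in> edges S. b e = v} = {e \<in> edges T. b' e = p v}"
      proof (intro set_eqI iffI)
        fix x assume "x \<in> h ` {e \<in> edges S. b e = v}"
        then show "x \<in> {e \<in> edges T. b' e = p v}" using i(3) that(4) by (auto simp: bij_betw_def)
      next
        fix x assume x: "x \<in> {e \<in> edges T. b' e = p v}"
        then obtain e where e: "e \<in> edges S" "x = h e" using i(3) by (auto simp: bij_betw_def)
        then have "p (b e) = p v" using x that(4) by auto
        then have "b e = v" using that(1-3) e(1) by (auto simp: bij_betw_def inj_on_def)
        then show "x \<in> h ` {e \<in> edges S. b e = v}" using e by auto
      qed
    qed auto
    then show ?thesis by (simp add: bij_betw_same_card)
  qed
  have "image_mset (\<lambda>v. card (edges_at_black T v)) (mset_set (blacks T))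
      = image_mset (\<lambda>v. card (edges_at_black S v)) (mset_set (blacks S))"
  proof -
    have "mset_set (blacks T) = image_mset p (mset_set (blacks S))"
      using i(1) by (simp add: bij_betw_def image_mset_mset_set)
    moreover have "card (edges_at_black T (p v)) = card (edges_at_black S v)" if "v \<in> blacks S" for v
      unfolding edges_at_black_def
      by (rule card_eq[OF i(1) that]) (use i S that in \<open>auto simp: bicolored_plane_tree_def\<close>)
    ultimately show ?thesis
      using S by (auto simp: image_mset.compositionality bicolored_plane_tree_def intro!: image_mset_cong)
  qed
  moreover have "image_mset (\<lambda>v. card (edges_at_white T v)) (mset_set (whites T))
      = image_mset (\<lambda>v. card (edges_at_white S v)) (mset_set (whites S))"
  proof -
    have "mset_set (whites T) = image_mset q (mset_set (whites S))"
      using i(2) by (simp add: bij_betw_def image_mset_mset_set)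
    moreover have "card (edges_at_white T (q v)) = card (edges_at_white S v)" if "v \<in> whites S" for v
      unfolding edges_at_white_def
      by (rule card_eq[OF i(2) that]) (use i S that in \<open>auto simp: bicolored_plane_tree_def\<close>)
    ultimately show ?thesis
      using S by (auto simp: image_mset.compositionality bicolored_plane_tree_def intro!: image_mset_cong)
  qed
  moreover have "card (edges T) = card (edges S)" using bij_betw_same_card[OF i(3)] by simp
  ultimately show ?thesis using assms(3) by (simp add: has_passport_def)
qed

section \<open>The two trees with passport \<open>[4^3, 1^8; 2^10; 20]\<close>\<close>

text \<open>
  The edges at the central vertex of degree 4 are numbered 0 to 3, those at the two other vertices
  of degree 4 are numbered 4 to 7 and 8 to 11, where 4 and 8 lie towards the center, and 12 to 19
  are the edges at the leaves.  The edges towards the outer vertices of degree 4 are 0 and 1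
  in \<open>white_adj\<close>, and 0 and 2 in \<open>white_opp\<close>.
\<close>

definition black_table :: "nat list" where
  "black_table = [1, 2, 3, 0, 5, 6, 7, 4, 9, 10, 11, 8, 12, 13, 14, 15, 16, 17, 18, 19]"

definition white_adj :: "nat list" where
  "white_adj = [4, 8, 12, 13, 0, 14, 15, 16, 1, 17, 18, 19, 2, 3, 5, 6, 7, 9, 10, 11]"

definition white_opp :: "nat list" where
  "white_opp = [4, 12, 8, 13, 0, 14, 15, 16, 2, 17, 18, 19, 1, 3, 5, 6, 7, 9, 10, 11]"

text \<open>Such a list turns both rotations into index tables, so two trees with lists for the same
  \<open>w\<close> are isomorphic by matching positions.\<close>

definition numbered :: "nat list \<Rightarrow> ('v, 'e) bicolored_map \<Rightarrow> 'e list \<Rightarrow> bool" where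
  "numbered w T L \<longleftrightarrow> distinct L \<and> length L = 20 \<and> set L = edges T \<and>
     (\<forall>i<20. black_rot T (L ! i) = L ! (black_table ! i) \<and> white_rot T (L ! i) = L ! (w ! i))"

text \<open>Turns a claim about the tables into twenty evaluations by rewriting.\<close>

lemma less_20: "(\<forall>i<20. P i) \<longleftrightarrow> (\<forall>i\<in>set [0,1,2,3,4,5,6,7,8,9,10,11,12,13,14,15,16,17,18,19::nat]. P i)"
proof -
  have "{..<20} = set [0,1,2,3,4,5,6,7,8,9,10,11,12,13,14,15,16,17,18,19::nat]" by auto presburger
  then show ?thesis by (metis lessThan_iff)
qed

lemma table_less:
  "i < 20 \<Longrightarrow> black_table ! i < 20" "i < 20 \<Longrightarrow> white_adj ! i < 20" "i < 20 \<Longrightarrow> white_opp ! i < 20"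
proof -
  have "\<forall>i<20. black_table ! i < 20 \<and> white_adj ! i < 20 \<and> white_opp ! i < 20"
    unfolding less_20 by (simp add: black_table_def white_adj_def white_opp_def)
  then show "i < 20 \<Longrightarrow> black_table ! i < 20" "i < 20 \<Longrightarrow> white_adj ! i < 20" "i < 20 \<Longrightarrow> white_opp ! i < 20" by auto
qed

lemma numbered_iso:
  assumes S: "bicolored_plane_tree S" and T: "bicolored_plane_tree T"
    and L: "numbered w S L" and M: "numbered w T M" and w: "\<And>i. i < 20 \<Longrightarrow> w ! i < 20"
  shows "tree_iso S T"
proof -
  have bL: "bij_betw ((!) L) {..<20} (edges S)" and bM: "bij_betw ((!) M) {..<20} (edges T)"
    using L M by (auto simp: numbered_def intro!: bij_betw_nth)
  define k where "k = the_inv_into {..<20} ((!) L)"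
  have k: "k (L ! i) = i" if "i < 20" for i
    unfolding k_def using bL that by (intro the_inv_into_f_f) (auto simp: bij_betw_def)
  have bk: "bij_betw k (edges S) {..<20}" unfolding k_def by (rule bij_betw_the_inv_into[OF bL])
  have b: "bij_betw (\<lambda>e. M ! k e) (edges S) (edges T)"
    using bij_betw_trans[OF bk bM] by (simp add: o_def)
  have ex: "\<exists>i<20. e = L ! i" if "e \<in> edges S" for e using bL that by (auto simp: bij_betw_def)
  show ?thesis
  proof (rule tree_isoI[OF S T b])
    fix e assume "e \<in> edges S"
    then obtain i where i: "i < 20" "e = L ! i" using ex by blast
    show "black_rot T (M ! k e) = M ! k (black_rot S e)"
      using L M i table_less(1)[OF i(1)] by (simp add: numbered_def k)
    show "white_rot T (M ! k e) = M ! k (white_rot S e)"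
      using L M i w[OF i(1)] by (simp add: numbered_def k)
  qed
qed

text \<open>The fixed points of the black rotation are the edges at leaves, so for the passport
  these are the edges on the path through the three vertices of degree 4. Being expressed by
  rotations, the set is preserved by edge maps compatible with them.\<close>

definition inner_edges :: "('v, 'e) bicolored_map \<Rightarrow> 'e set" where
  "inner_edges T = {e \<in> edges T. black_rot T e \<noteq> e \<and> black_rot T (white_rot T e) \<noteq> white_rot T e}"

lemma numbered_inner:
  assumes "numbered white_adj T L \<or> numbered white_opp T L"
  shows "numbered white_adj T L \<Longrightarrow> inner_edges T = {L ! 0, L ! 1, L ! 4, L ! 8}"
    "numbered white_opp T L \<Longrightarrow> inner_edges T = {L ! 0, L ! 2, L ! 4, L ! 8}"
proof -
  have *: "inner_edges T = (\<lambda>i. L ! i) ` {i. i < 20 \<and> black_table ! i \<noteq> i \<and> black_table ! (w ! i) \<noteq> w ! i}"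
    if L: "numbered w T L" and w: "\<And>i. i < 20 \<Longrightarrow> w ! i < 20" for w
  proof -
    have "bij_betw ((!) L) {..<20} (edges T)" using L by (auto simp: numbered_def intro!: bij_betw_nth)
    then have E: "edges T = (\<lambda>i. L ! i) ` {..<20}" by (simp add: bij_betw_def)
    have eq: "L ! i = L ! j \<longleftrightarrow> i = j" if "i < 20" "j < 20" for i j
      using L that by (simp add: numbered_def nth_eq_iff_index_eq)
    have "L ! i \<in> inner_edges T \<longleftrightarrow> black_table ! i \<noteq> i \<and> black_table ! (w ! i) \<noteq> w ! i" if "i < 20" for i
      using L that w[OF that] table_less(1)[OF that] table_less(1)[OF w[OF that]] E
      by (auto simp: inner_edges_def numbered_def eq)
    moreover have "inner_edges T \<subseteq> edges T" by (auto simp: inner_edges_def)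
    ultimately show ?thesis unfolding E by auto
  qed
  have "{i. i < 20 \<and> black_table ! i \<noteq> i \<and> black_table ! (white_adj ! i) \<noteq> white_adj ! i} = {0, 1, 4, 8}"
  proof -
    have "\<forall>i<20. (black_table ! i \<noteq> i \<and> black_table ! (white_adj ! i) \<noteq> white_adj ! i) = (i \<in> {0, 1, 4, 8})"
      unfolding less_20 by (simp add: black_table_def white_adj_def)
    then have "i < 20 \<and> black_table ! i \<noteq> i \<and> black_table ! (white_adj ! i) \<noteq> white_adj ! i \<longleftrightarrow> i \<in> {0, 1, 4, 8}" for i
      by (cases "i < 20") auto
    then show ?thesis by auto
  qed
  then show "numbered white_adj T L \<Longrightarrow> inner_edges T = {L ! 0, L ! 1, L ! 4, L ! 8}"
    using *[of white_adj, OF _ table_less(2)] by simp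
  have "{i. i < 20 \<and> black_table ! i \<noteq> i \<and> black_table ! (white_opp ! i) \<noteq> white_opp ! i} = {0, 2, 4, 8}"
  proof -
    have "\<forall>i<20. (black_table ! i \<noteq> i \<and> black_table ! (white_opp ! i) \<noteq> white_opp ! i) = (i \<in> {0, 2, 4, 8})"
      unfolding less_20 by (simp add: black_table_def white_opp_def)
    then have "i < 20 \<and> black_table ! i \<noteq> i \<and> black_table ! (white_opp ! i) \<noteq> white_opp ! i \<longleftrightarrow> i \<in> {0, 2, 4, 8}" for i
      by (cases "i < 20") auto
    then show ?thesis by auto
  qed
  then show "numbered white_opp T L \<Longrightarrow> inner_edges T = {L ! 0, L ! 2, L ! 4, L ! 8}"
    using *[of white_opp, OF _ table_less(3)] by simp
qed

lemma numbered_nth: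
  assumes "numbered w T L"
  shows "i < 20 \<Longrightarrow> j < 20 \<Longrightarrow> L ! i = L ! j \<longleftrightarrow> i = j" "i < 20 \<Longrightarrow> L ! i \<in> edges T"
    "black_rot T (L ! 0) = L ! 1" "black_rot T (L ! 1) = L ! 2" "black_rot T (L ! 2) = L ! 3" "black_rot T (L ! 3) = L ! 0"
    "black_rot T (L ! 4) = L ! 5" "black_rot T (L ! 5) = L ! 6" "black_rot T (L ! 8) = L ! 9" "black_rot T (L ! 9) = L ! 10"
proof -
  show "i < 20 \<Longrightarrow> j < 20 \<Longrightarrow> L ! i = L ! j \<longleftrightarrow> i = j"
    using assms by (simp add: numbered_def nth_eq_iff_index_eq)
  show "i < 20 \<Longrightarrow> L ! i \<in> edges T" using assms nth_mem[of i L] by (simp add: numbered_def)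
  have "\<forall>i<20. black_rot T (L ! i) = L ! (black_table ! i)" using assms by (simp add: numbered_def)
  from this[unfolded less_20] show
    "black_rot T (L ! 0) = L ! 1" "black_rot T (L ! 1) = L ! 2" "black_rot T (L ! 2) = L ! 3" "black_rot T (L ! 3) = L ! 0"
    "black_rot T (L ! 4) = L ! 5" "black_rot T (L ! 5) = L ! 6" "black_rot T (L ! 8) = L ! 9" "black_rot T (L ! 9) = L ! 10"
    by (simp_all add: black_table_def)
qed

text \<open>Edge 0 is the only inner edge whose black successor, edge 1, is inner as well.\<close>

lemma adj_rigid:
  assumes L: "numbered white_adj T L" and h: "h ` edges T \<subseteq> edges T" "inj_on h (edges T)"
      "\<And>e. e \<in> edges T \<Longrightarrow> black_rot T (h e) = h (black_rot T e)"
      "\<And>e. e \<in> edges T \<Longrightarrow> white_rot T (h e) = h (white_rot T e)"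
    and rot: "\<And>e. e \<in> edges T \<Longrightarrow> black_rot T e \<in> edges T" "\<And>e. e \<in> edges T \<Longrightarrow> white_rot T e \<in> edges T"
  shows "h (L ! 0) = L ! 0"
proof -
  note I = numbered_inner(1)[OF disjI1[OF L] L] and n = numbered_nth[OF L]
  have hI: "h e \<in> inner_edges T" if "e \<in> inner_edges T" for e
    using that h rot by (auto simp: inner_edges_def inj_on_def)
  have "h (L ! 0) \<in> inner_edges T" "black_rot T (h (L ! 0)) \<in> inner_edges T"
    using hI[of "L ! 0"] hI[of "L ! 1"] h(3)[of "L ! 0"] n(2)[of 0] n(3) unfolding I by auto
  then show ?thesis unfolding I using n by auto
qed

text \<open>Edges 0 and 2 are the inner edges whose second black successor is inner, so
  \<open>h\<close> maps this pair to itself. As \<open>h\<close> reverses the cyclic order of the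
  four central edges, it either fixes edge 0 or sends it to edge 2, and then it fixes edge 1 between
  them.\<close>

lemma opp_reversal_fixed_edge:
  assumes L: "numbered white_opp T L" and h: "h ` edges T \<subseteq> edges T" "inj_on h (edges T)"
      "\<And>e. e \<in> edges T \<Longrightarrow> black_rot T (h (black_rot T e)) = h e"
      "\<And>e. e \<in> edges T \<Longrightarrow> white_rot T (h e) = h (white_rot T e)"
    and rot: "\<And>e. e \<in> edges T \<Longrightarrow> black_rot T e \<in> edges T" "\<And>e. e \<in> edges T \<Longrightarrow> white_rot T e \<in> edges T"
    and inj: "inj_on (black_rot T) (edges T)"
  shows "\<exists>e\<in>edges T. h e = e"
proof -
  note I = numbered_inner(2)[OF disjI2[OF L] L] and n = numbered_nth[OF L]
  have hne: "black_rot T (h e) \<noteq> h e" if e: "e \<in> edges T" "black_rot T e \<noteq> e" for e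
  proof
    assume "black_rot T (h e) = h e"
    then have "black_rot T (h e) = black_rot T (h (black_rot T e))" using h(3)[OF e(1)] by simp
    then have "h e = h (black_rot T e)" using inj h(1) rot(1)[OF e(1)] e(1) by (auto simp: inj_on_def)
    then show False using h(2) rot(1)[OF e(1)] e by (auto simp: inj_on_def)
  qed
  have hI: "h e \<in> inner_edges T" if "e \<in> inner_edges T" for e
    using that h(1) h(4)[of e] hne[of e] hne[of "white_rot T e"] rot(2)[of e] by (auto simp: inner_edges_def)
  have J: "e = L ! 0 \<or> e = L ! 2" if "e \<in> inner_edges T" "black_rot T (black_rot T e) \<in> inner_edges T" for e
    using that n unfolding I by auto
  have e02: "L ! 0 \<in> inner_edges T" "L ! 2 \<in> inner_edges T" unfolding I by auto
  have "black_rot T (black_rot T (h (L ! 2))) = h (L ! 0)"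
    using h(3)[of "L ! 1"] h(3)[of "L ! 0"] n by simp
  then have h2: "h (L ! 2) = L ! 0 \<or> h (L ! 2) = L ! 2" using J hI e02 by metis
  have "black_rot T (black_rot T (h (L ! 0))) = h (L ! 2)"
    using h(3)[of "L ! 3"] h(3)[of "L ! 2"] n by simp
  then have h0: "h (L ! 0) = L ! 0 \<or> h (L ! 0) = L ! 2" using J hI e02 by metis
  show ?thesis
  proof (cases "h (L ! 0) = L ! 0")
    case True
    then show ?thesis using n(2)[of 0] by auto
  next
    case False
    then have "black_rot T (h (L ! 1)) = black_rot T (L ! 1)" using h0 h(3)[of "L ! 0"] n by simp
    then have "h (L ! 1) = L ! 1" using inj h(1) n(2)[of 1] by (auto simp: inj_on_def)
    then show ?thesis using n(2)[of 1] by auto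
  qed
qed

text \<open>In the adjacent tree the inner edge 0 is followed by the inner edge 1 around the center;
  in the opposite tree no black successor of an inner edge is inner.\<close>

lemma adj_not_iso_opp:
  assumes L: "numbered white_adj S L" and M: "numbered white_opp T M"
    and S: "bicolored_plane_tree S"
  shows "\<not> tree_iso S T"
proof
  assume "tree_iso S T"
  then obtain h where h: "bij_betw h (edges S) (edges T)"
    "\<And>e. e \<in> edges S \<Longrightarrow> black_rot T (h e) = h (black_rot S e)"
    "\<And>e. e \<in> edges S \<Longrightarrow> white_rot T (h e) = h (white_rot S e)"
    using tree_iso_edges by metis
  note rot = tree_rot_in_edges[OF S]
  note I = numbered_inner(1)[OF disjI1[OF L] L] and n = numbered_nth[OF L]
  note I' = numbered_inner(2)[OF disjI2[OF M] M] and n' = numbered_nth[OF M]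
  have hI: "h e \<in> inner_edges T" if "e \<in> inner_edges S" for e
    using that h rot by (auto simp: inner_edges_def bij_betw_def inj_on_def)
  have "h (L ! 0) \<in> inner_edges T" "black_rot T (h (L ! 0)) \<in> inner_edges T"
    using hI[of "L ! 0"] hI[of "L ! 1"] h(2)[of "L ! 0"] n(2)[of 0] n(3) unfolding I by auto
  then show False unfolding I' using n' by auto
qed


text \<open>\<open>a0\<close> to \<open>a3\<close> are the central edges, the \<open>x\<close> and
  \<open>z\<close> those at the outer vertices of degree 4, and the \<open>l\<close> those at the
  leaves.\<close>

lemma numbered_adjI:
  assumes "distinct [a0, a1, a2, a3, x0, x1, x2, x3, z0, z1, z2, z3, l0, l1, l2, l3, l4, l5, l6, l7]"
    and "set [a0, a1, a2, a3, x0, x1, x2, x3, z0, z1, z2, z3, l0, l1, l2, l3, l4, l5, l6, l7] = edges T"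
    and
      "black_rot T a0 = a1" "black_rot T a1 = a2" "black_rot T a2 = a3" "black_rot T a3 = a0"
      "black_rot T x0 = x1" "black_rot T x1 = x2" "black_rot T x2 = x3" "black_rot T x3 = x0"
      "black_rot T z0 = z1" "black_rot T z1 = z2" "black_rot T z2 = z3" "black_rot T z3 = z0"
      "black_rot T l0 = l0" "black_rot T l1 = l1" "black_rot T l2 = l2" "black_rot T l3 = l3"
      "black_rot T l4 = l4" "black_rot T l5 = l5" "black_rot T l6 = l6" "black_rot T l7 = l7"
    and
      "white_rot T a0 = x0" "white_rot T a1 = z0" "white_rot T a2 = l0" "white_rot T a3 = l1"
      "white_rot T x0 = a0" "white_rot T x1 = l2" "white_rot T x2 = l3" "white_rot T x3 = l4"
      "white_rot T z0 = a1" "white_rot T z1 = l5" "white_rot T z2 = l6" "white_rot T z3 = l7"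
      "white_rot T l0 = a2" "white_rot T l1 = a3" "white_rot T l2 = x1" "white_rot T l3 = x2"
      "white_rot T l4 = x3" "white_rot T l5 = z1" "white_rot T l6 = z2" "white_rot T l7 = z3"
  shows "numbered white_adj T [a0, a1, a2, a3, x0, x1, x2, x3, z0, z1, z2, z3, l0, l1, l2, l3, l4, l5, l6, l7]"
  unfolding numbered_def less_20 using assms by (simp add: black_table_def white_adj_def)

lemma numbered_oppI:
  assumes "distinct [a0, a1, a2, a3, x0, x1, x2, x3, z0, z1, z2, z3, l0, l1, l2, l3, l4, l5, l6, l7]"
    and "set [a0, a1, a2, a3, x0, x1, x2, x3, z0, z1, z2, z3, l0, l1, l2, l3, l4, l5, l6, l7] = edges T"
    and
      "black_rot T a0 = a1" "black_rot T a1 = a2" "black_rot T a2 = a3" "black_rot T a3 = a0"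
      "black_rot T x0 = x1" "black_rot T x1 = x2" "black_rot T x2 = x3" "black_rot T x3 = x0"
      "black_rot T z0 = z1" "black_rot T z1 = z2" "black_rot T z2 = z3" "black_rot T z3 = z0"
      "black_rot T l0 = l0" "black_rot T l1 = l1" "black_rot T l2 = l2" "black_rot T l3 = l3"
      "black_rot T l4 = l4" "black_rot T l5 = l5" "black_rot T l6 = l6" "black_rot T l7 = l7"
    and
      "white_rot T a0 = x0" "white_rot T a1 = l0" "white_rot T a2 = z0" "white_rot T a3 = l1"
      "white_rot T x0 = a0" "white_rot T x1 = l2" "white_rot T x2 = l3" "white_rot T x3 = l4"
      "white_rot T z0 = a2" "white_rot T z1 = l5" "white_rot T z2 = l6" "white_rot T z3 = l7"
      "white_rot T l0 = a1" "white_rot T l1 = a3" "white_rot T l2 = x1" "white_rot T l3 = x2"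
      "white_rot T l4 = x3" "white_rot T l5 = z1" "white_rot T l6 = z2" "white_rot T l7 = z3"
  shows "numbered white_opp T [a0, a1, a2, a3, x0, x1, x2, x3, z0, z1, z2, z3, l0, l1, l2, l3, l4, l5, l6, l7]"
  unfolding numbered_def less_20 using assms by (simp add: black_table_def white_opp_def)

section \<open>Structure of an arbitrary tree with the passport\<close>

locale passport_tree =
  fixes T :: "('v, 'e) bicolored_map"
  assumes tree: "bicolored_plane_tree T"
    and passport: "has_passport T (replicate_mset 3 4 + replicate_mset 8 1) (replicate_mset 10 2) 20"
begin

abbreviation E where "E \<equiv> edges T"
abbreviation B where "B \<equiv> black_rot T"
abbreviation W where "W \<equiv> white_rot T"
abbreviation bl where "bl \<equiv> black_end T"
abbreviation wh where "wh \<equiv> white_end T"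

lemma fin: "finite (blacks T)" "finite (whites T)" "finite E" "blacks T \<inter> whites T = {}"
  using tree by (simp_all add: bicolored_plane_tree_def)

lemma ends: "e \<in> E \<Longrightarrow> bl e \<in> blacks T" "e \<in> E \<Longrightarrow> wh e \<in> whites T"
  using tree by (auto simp: bicolored_plane_tree_def)

lemmas rot = tree_rot_in_edges[OF tree]

lemma degree_black:
  assumes "v \<in> blacks T"
  shows "card (edges_at_black T v) = 4 \<or> card (edges_at_black T v) = 1"
proof -
  have "card (edges_at_black T v) \<in># image_mset (\<lambda>v. card (edges_at_black T v)) (mset_set (blacks T))"
    using assms fin by auto
  moreover have "image_mset (\<lambda>v. card (edges_at_black T v)) (mset_set (blacks T)) = replicate_mset 3 4 + replicate_mset 8 1"
    using passport by (simp add: has_passport_def)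
  ultimately show ?thesis by (auto split: if_splits)
qed

lemma degree_white:
  assumes "v \<in> whites T"
  shows "card (edges_at_white T v) = 2"
proof -
  have "card (edges_at_white T v) \<in># image_mset (\<lambda>v. card (edges_at_white T v)) (mset_set (whites T))"
    using assms fin by auto
  moreover have "image_mset (\<lambda>v. card (edges_at_white T v)) (mset_set (whites T)) = replicate_mset 10 2"
    using passport by (simp add: has_passport_def)
  ultimately show ?thesis by (auto split: if_splits)
qed

definition Q where "Q = {v \<in> blacks T. card (edges_at_black T v) = 4}"
definition D where "D = {e \<in> E. bl e \<in> Q}"

lemma card_Q: "card Q = 3"
proof -
  have "count (image_mset (\<lambda>v. card (edges_at_black T v)) (mset_set (blacks T))) 4
      = (\<Sum>y\<in>Q. count (mset_set (blacks T)) y)"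
    unfolding count_image_mset using fin by (intro sum.cong) (auto simp: Q_def)
  also have "\<dots> = (\<Sum>y\<in>Q. 1)" using fin by (intro sum.cong) (auto simp: Q_def)
  finally show ?thesis using passport by (simp add: has_passport_def)
qed

lemma finite_Q: "finite Q" using fin by (simp add: Q_def)

lemma DE: "e \<in> D \<Longrightarrow> e \<in> E" by (simp add: D_def)

lemma finite_D: "finite D" using fin by (simp add: D_def)

lemma card_D: "card D = 12"
proof -
  have "D = (\<Union>v\<in>Q. edges_at_black T v)" by (auto simp: D_def edges_at_black_def)
  also have "card \<dots> = (\<Sum>v\<in>Q. card (edges_at_black T v))"
    using finite_Q fin by (intro card_UN_disjoint) (auto simp: edges_at_black_def)
  also have "\<dots> = (\<Sum>v\<in>Q. 4)" by (intro sum.cong) (auto simp: Q_def)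
  finally show ?thesis by (simp add: card_Q)
qed

lemma cyclic:
  assumes "e \<in> E"
  shows "cyclic_on B (edges_at_black T (bl e))" "cyclic_on W (edges_at_white T (wh e))"
    "e \<in> edges_at_black T (bl e)" "e \<in> edges_at_white T (wh e)"
  using assms tree ends by (auto simp: bicolored_plane_tree_def edges_at_black_def edges_at_white_def)

lemma inner_rot:
  assumes "e \<in> D"
  shows "B (B (B (B e))) = e" "edges_at_black T (bl e) = {e, B e, B (B e), B (B (B e))}"
    "distinct [e, B e, B (B e), B (B (B e))]" "B e \<in> D" "bl (B e) = bl e"
proof -
  have e: "e \<in> E" "card (edges_at_black T (bl e)) = 4" using assms by (auto simp: D_def Q_def)
  show "B (B (B (B e))) = e" "edges_at_black T (bl e) = {e, B e, B (B e), B (B (B e))}"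
    "distinct [e, B e, B (B e), B (B (B e))]"
    using cyclic_on_4[OF cyclic(1,3)[OF e(1)] e(2)] by blast+
  show "B e \<in> D" "bl (B e) = bl e" using rot[OF e(1)] assms by (auto simp: D_def)
qed

lemma leaf_rot:
  assumes "e \<in> E" "e \<notin> D"
  shows "B e = e" "edges_at_black T (bl e) = {e}"
proof -
  have "card (edges_at_black T (bl e)) = 1"
    using degree_black[OF ends(1)[OF assms(1)]] assms ends(1) by (auto simp: D_def Q_def)
  then show "B e = e" "edges_at_black T (bl e) = {e}"
    using cyclic_on_1[OF cyclic(1,3)[OF assms(1)]] by blast+
qed

lemma white_rot:
  assumes "e \<in> E"
  shows "W (W e) = e" "W e \<noteq> e" "edges_at_white T (wh e) = {e, W e}" "W e \<in> E" "wh (W e) = wh e"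
  using cyclic_on_2[OF cyclic(2,4)[OF assms] degree_white[OF ends(2)[OF assms]]] rot[OF assms] by blast+

lemma W_eq_iff: "e \<in> E \<Longrightarrow> e' \<in> E \<Longrightarrow> W e = W e' \<longleftrightarrow> e = e'"
  using white_rot(1) by metis

lemma same_white:
  assumes "e \<in> E" "e' \<in> E" "wh e = wh e'"
  shows "e' = e \<or> e' = W e"
proof -
  have "e' \<in> edges_at_white T (wh e)" using assms by (simp add: edges_at_white_def)
  then show ?thesis using white_rot(3)[OF assms(1)] by auto
qed

lemma no_cycle: "\<not> is_cycle T es"
  using tree by (simp add: bicolored_plane_tree_def)

lemma no_loop:
  assumes e: "e \<in> E"
  shows "bl (W e) \<noteq> bl e"
proof
  assume "bl (W e) = bl e"
  then have "is_cycle T [e, W e]"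
    unfolding is_cycle_def using e white_rot[OF e] by (intro exI[of _ 1]) (auto simp: lessThan_Suc)
  then show False using no_cycle by blast
qed

text \<open>Otherwise \<open>e'\<close>, \<open>e\<close>, \<open>W e\<close>, \<open>W e'\<close>
  would be the sides of a quadrilateral with two black and two white vertices.\<close>

lemma no_double:
  assumes e: "e \<in> E" and e': "e' \<in> E" "e' \<noteq> e" "e' \<noteq> W e" and eq: "bl e = bl e'"
  shows "bl (W e) \<noteq> bl (W e')"
proof
  assume eqW: "bl (W e) = bl (W e')"
  note w = white_rot[OF e] and w' = white_rot[OF e'(1)]
  have wne: "wh e \<noteq> wh e'" using same_white[OF e e'(1)] e' by auto
  have ne: "W e' \<noteq> e" "W e' \<noteq> W e" using e e' w w' by metis+
  have "is_cycle T [e', e, W e, W e']"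
    unfolding is_cycle_def
  proof (intro exI[of _ 2] conjI allI impI)
    show "distinct [e', e, W e, W e']" using e' w(2) w'(2) ne by auto
    fix i :: nat assume "i < 2"
    then have "i = 0 \<or> i = 1" by auto
    then show "bl ([e', e, W e, W e'] ! (2 * i)) = bl ([e', e, W e, W e'] ! (2 * i + 1))"
      using eq eqW by (elim disjE) simp_all
    show "wh ([e', e, W e, W e'] ! (2 * i + 1)) = wh ([e', e, W e, W e'] ! ((2 * i + 2) mod (2 * 2)))"
      using \<open>i = 0 \<or> i = 1\<close> w(5) w'(5) by (elim disjE) simp_all
  next
    have two: "{..<2::nat} = {0, 1}" by auto
    show "inj_on (\<lambda>i. bl ([e', e, W e, W e'] ! (2 * i))) {..<2}"
      using no_loop[OF e] eq unfolding two by (auto simp: numeral_eq_Suc)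
    show "inj_on (\<lambda>i. wh ([e', e, W e, W e'] ! (2 * i + 1))) {..<2}"
      using wne w' unfolding two by (auto simp: numeral_eq_Suc)
  qed (use e e' w w' in auto)
  then show False using no_cycle by blast
qed

text \<open>If both black neighbours of a white vertex were leaves, these three vertices would be a
  whole component, but there are also vertices of degree 4.\<close>

lemma leaf_neighbour:
  assumes e: "e \<in> E" "e \<notin> D"
  shows "W e \<in> D"
proof (rule ccontr)
  assume We: "W e \<notin> D"
  note w = white_rot[OF e(1)]
  let ?X = "{bl e, wh e, bl (W e)}"
  obtain v where v: "v \<in> Q" using card_Q by fastforce
  have "(bl e, v) \<in> ((\<lambda>e. (bl e, wh e)) ` E \<union> (\<lambda>e. (wh e, bl e)) ` E)\<^sup>*"
    using tree ends(1)[OF e(1)] v by (auto simp: bicolored_plane_tree_def map_connected_def Q_def)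
  then have "v \<in> ?X"
  proof induction
    case base
    show ?case by simp
  next
    case (step y z)
    from step.hyps(2) show ?case
    proof
      assume "(y, z) \<in> (\<lambda>e. (bl e, wh e)) ` E"
      then obtain f where f: "f \<in> E" "y = bl f" "z = wh f" by auto
      have "bl f \<noteq> wh e" using ends(1)[OF f(1)] ends(2)[OF e(1)] fin(4) by auto
      then have "bl f = bl e \<or> bl f = bl (W e)" using step.IH f by auto
      then have "f \<in> edges_at_black T (bl e) \<or> f \<in> edges_at_black T (bl (W e))"
        using f(1) by (auto simp: edges_at_black_def)
      then have "f = e \<or> f = W e" using leaf_rot(2)[OF e] leaf_rot(2)[OF w(4) We] by auto
      then show ?case using f w(5) by auto
    next
      assume "(y, z) \<in> (\<lambda>e. (wh e, bl e)) ` E"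
      then obtain f where f: "f \<in> E" "y = wh f" "z = bl f" by auto
      have "wh f \<noteq> bl e" "wh f \<noteq> bl (W e)"
        using ends(2)[OF f(1)] ends(1)[OF e(1)] ends(1)[OF w(4)] fin(4) by auto
      then have "wh f = wh e" using step.IH f by auto
      then have "f = e \<or> f = W e" using same_white[OF e(1) f(1)] by simp
      then show ?case using f by auto
    qed
  qed
  moreover have "v \<noteq> wh e" using v ends(2)[OF e(1)] fin(4) by (auto simp: Q_def)
  ultimately have "bl e \<in> Q \<or> bl (W e) \<in> Q" using v by auto
  then show False using e We w(4) by (auto simp: D_def)
qed

definition I where "I = {e \<in> D. W e \<in> D}"

lemma W_I: "e \<in> I \<Longrightarrow> W e \<in> I"
  using white_rot(1) DE by (auto simp: I_def)

text \<open>Of the 12 edges at vertices of degree 4, eight are the partners under \<open>W\<close>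
  of the 8 edges at leaves.\<close>

lemma card_I: "card I = 4"
proof -
  have "D = I \<union> W ` (E - D)"
  proof (intro set_eqI iffI)
    fix e assume e: "e \<in> D"
    show "e \<in> I \<union> W ` (E - D)"
      using white_rot(1,4)[OF DE[OF e]] e by (cases "W e \<in> D") (auto simp: I_def intro!: image_eqI[of e W "W e"])
  next
    fix e assume "e \<in> I \<union> W ` (E - D)"
    then show "e \<in> D" using leaf_neighbour by (auto simp: I_def)
  qed
  moreover have "I \<inter> W ` (E - D) = {}" using white_rot(1) by (auto simp: I_def)
  moreover have "finite I" "finite (W ` (E - D))" using finite_D fin by (auto simp: I_def)
  ultimately have "card D = card I + card (W ` (E - D))" by (metis card_Un_disjoint)
  also have "card (W ` (E - D)) = card (E - D)" by (intro card_image inj_onI) (auto simp: W_eq_iff)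
  also have "card (E - D) = 8"
    using passport finite_D DE by (subst card_Diff_subset) (auto simp: has_passport_def card_D)
  finally show ?thesis by (simp add: card_D)
qed

text \<open>The inner edges form two paths, \<open>d\<close> with \<open>W d\<close> and
  \<open>d'\<close> with \<open>W d'\<close>. Their four black ends lie among three vertices, so two
  of them coincide, necessarily across the two paths. This common end is the center, and the other
  two ends differ because there is no quadrilateral.\<close>

lemma center:
  obtains a c where "a \<in> I" "c \<in> I" "c \<noteq> a" "bl a = bl c" "I = {a, W a, c, W c}" "bl (W a) \<noteq> bl (W c)"
proof -
  have fI: "finite I" using finite_D by (simp add: I_def)
  have IE: "e \<in> E" if "e \<in> I" for e using that DE by (simp add: I_def)
  have IQ: "bl e \<in> Q" if "e \<in> I" for e using that by (simp add: I_def D_def)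
  obtain d where d: "d \<in> I" using card_I by fastforce
  have "card {d, W d} = 2" using white_rot(2)[OF IE[OF d]] by auto
  then have "card (I - {d, W d}) = 2" using card_I fI d W_I by (subst card_Diff_subset) auto
  then have "I - {d, W d} \<noteq> {}" by (metis card.empty zero_neq_numeral)
  then obtain d' where d': "d' \<in> I" "d' \<noteq> d" "d' \<noteq> W d" by blast
  note w = white_rot[OF IE[OF d]] and w' = white_rot[OF IE[OF d'(1)]]
  have W': "W d' \<noteq> d" "W d' \<noteq> W d" using w w' d' by metis+
  have "distinct [d, W d, d', W d']" using w(2) w'(2) d' W' by auto
  then have "card {d, W d, d', W d'} = 4" by simp
  then have Ieq: "I = {d, W d, d', W d'}"
    using card_I fI d d' W_I by (metis bot_least card_subset_eq insert_subset)
  have nl: "bl (W d) \<noteq> bl d" "bl (W d') \<noteq> bl d'" using no_loop IE d d' by auto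
  have "\<not> distinct [bl d, bl (W d), bl d', bl (W d')]"
  proof
    assume "distinct [bl d, bl (W d), bl d', bl (W d')]"
    then have "card {bl d, bl (W d), bl d', bl (W d')} = 4" by simp
    moreover have "{bl d, bl (W d), bl d', bl (W d')} \<subseteq> Q" using IQ d d' W_I by auto
    then have "card {bl d, bl (W d), bl d', bl (W d')} \<le> card Q" by (rule card_mono[OF finite_Q])
    ultimately show False using card_Q by linarith
  qed
  then have cases: "bl d = bl d' \<or> bl d = bl (W d') \<or> bl (W d) = bl d' \<or> bl (W d) = bl (W d')"
    using nl by auto
  \<comment> \<open>The four ways in which the ends can coincide differ by exchanging an edge with
    its partner under \<open>W\<close>.\<close>
  have key: "\<exists>a c. a \<in> I \<and> c \<in> I \<and> c \<noteq> a \<and> bl a = bl c \<and> I = {a, W a, c, W c} \<and> bl (W a) \<noteq> bl (W c)"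
    if ac: "a \<in> I" "c \<in> I" "c \<noteq> a" "c \<noteq> W a" "bl a = bl c" "I = {a, W a, c, W c}" for a c
    using ac no_double[OF IE[OF ac(1)] IE[OF ac(2)] ac(3,4,5)] by blast
  have eqs: "I = {d, W d, W d', W (W d')}" "I = {W d, W (W d), d', W d'}" "I = {W d, W (W d), W d', W (W d')}"
    using Ieq w(1) w'(1) by auto
  have ne: "d' \<noteq> W (W d)" "W d' \<noteq> W (W d)" using d' W' w(1) by auto
  from cases have "\<exists>a c. a \<in> I \<and> c \<in> I \<and> c \<noteq> a \<and> bl a = bl c \<and> I = {a, W a, c, W c} \<and> bl (W a) \<noteq> bl (W c)"
  proof (elim disjE)
    assume "bl d = bl d'"
    then show ?thesis by (rule key[OF d d' _ Ieq])
  next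
    assume "bl d = bl (W d')"
    then show ?thesis by (rule key[OF d W_I[OF d'(1)] W' _ eqs(1)])
  next
    assume "bl (W d) = bl d'"
    then show ?thesis by (rule key[OF W_I[OF d] d'(1,3) ne(1) _ eqs(2)])
  next
    assume "bl (W d) = bl (W d')"
    then show ?thesis by (rule key[OF W_I[OF d] W_I[OF d'(1)] W'(2) ne(2) _ eqs(3)])
  qed
  then show thesis using that by blast
qed

text \<open>The leaf edges are the partners of the edges in \<open>D - I\<close>, so a numbering of
  the twelve edges in \<open>D\<close> determines that of the other eight.\<close>

lemma extend_numbering:
  assumes L1: "distinct L1" "length L1 = 12" "set L1 \<subseteq> D"
    and L2: "distinct L2" "length L2 = 8" "set L2 \<subseteq> D - I"
  shows "distinct (L1 @ map W L2)" "set (L1 @ map W L2) = E"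
    "e \<in> set L2 \<Longrightarrow> B (W e) = W e" "e \<in> set L2 \<Longrightarrow> W (W e) = e"
proof -
  have leaf: "W e \<notin> D" "W e \<in> E" "W (W e) = e" if "e \<in> set L2" for e
    using that L2(3) white_rot DE by (auto simp: I_def)
  have "inj_on W (set L2)" using L2(3) DE by (auto simp: inj_on_def W_eq_iff subset_eq)
  then have "distinct (map W L2)" using L2(1) by (simp add: distinct_map)
  moreover have "set L1 \<inter> set (map W L2) = {}" using L1(3) leaf(1) by auto
  ultimately show d: "distinct (L1 @ map W L2)" using L1(1) by simp
  have len: "length (L1 @ map W L2) = 20" using L1(2) L2(2) by simp
  have "set (L1 @ map W L2) \<subseteq> E" using L1(3) DE leaf(2) by auto
  moreover have "card E = 20" using passport by (simp add: has_passport_def)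
  ultimately show "set (L1 @ map W L2) = E"
    using distinct_card[OF d] len fin(3) by (metis card_subset_eq)
  show "e \<in> set L2 \<Longrightarrow> B (W e) = W e" "e \<in> set L2 \<Longrightarrow> W (W e) = e"
    using leaf leaf_rot(1) by blast+
qed

lemma numbered_adj_center:
  assumes d: "distinct [a0, a1, a2, a3, x0, x1, x2, x3, z0, z1, z2, z3]"
    and sub: "set [a0, a1, a2, a3, x0, x1, x2, x3, z0, z1, z2, z3] \<subseteq> D"
    and rot: "B a0 = a1" "B a1 = a2" "B a2 = a3" "B a3 = a0" "B x0 = x1" "B x1 = x2" "B x2 = x3" "B x3 = x0"
      "B z0 = z1" "B z1 = z2" "B z2 = z3" "B z3 = z0"
    and W: "W a0 = x0" "W a1 = z0" and I: "I = {a0, x0, a1, z0}"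
  shows "\<exists>L. numbered white_adj T L"
proof -
  let ?L2 = "[a2, a3, x1, x2, x3, z1, z2, z3]"
  have L2: "distinct ?L2" using d by simp
  have subL2: "set ?L2 \<subseteq> D - I" using d sub unfolding I by auto
  note ext = extend_numbering[OF d _ sub L2 _ subL2, simplified list.size]
  have WW: "W x0 = a0" "W z0 = a1" using white_rot(1) sub DE W by auto
  have leaf: "\<forall>e\<in>set ?L2. B (W e) = W e \<and> W (W e) = e" using ext(3,4) by simp
  show ?thesis
    by (rule exI, rule numbered_adjI[OF ext(1,2)[unfolded append.simps list.map]])
      (use rot W WW leaf in simp_all)
qed

lemma numbered_opp_center:
  assumes d: "distinct [a0, a1, a2, a3, x0, x1, x2, x3, z0, z1, z2, z3]"
    and sub: "set [a0, a1, a2, a3, x0, x1, x2, x3, z0, z1, z2, z3] \<subseteq> D"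
    and rot: "B a0 = a1" "B a1 = a2" "B a2 = a3" "B a3 = a0" "B x0 = x1" "B x1 = x2" "B x2 = x3" "B x3 = x0"
      "B z0 = z1" "B z1 = z2" "B z2 = z3" "B z3 = z0"
    and W: "W a0 = x0" "W a2 = z0" and I: "I = {a0, x0, a2, z0}"
  shows "\<exists>L. numbered white_opp T L"
proof -
  let ?L2 = "[a1, a3, x1, x2, x3, z1, z2, z3]"
  have L2: "distinct ?L2" using d by simp
  have subL2: "set ?L2 \<subseteq> D - I" using d sub unfolding I by auto
  note ext = extend_numbering[OF d _ sub L2 _ subL2, simplified list.size]
  have WW: "W x0 = a0" "W z0 = a2" using white_rot(1) sub DE W by auto
  have leaf: "\<forall>e\<in>set ?L2. B (W e) = W e \<and> W (W e) = e" using ext(3,4) by simp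
  show ?thesis
    by (rule exI, rule numbered_oppI[OF ext(1,2)[unfolded append.simps list.map]])
      (use rot W WW leaf in simp_all)
qed

lemma numbered_from_center:
  assumes a: "a \<in> I" and c: "c \<in> I" and I: "I = {a, W a, c, W c}" and bl: "bl a = bl c" "bl (W a) \<noteq> bl (W c)"
  shows "c = B a \<Longrightarrow> \<exists>L. numbered white_adj T L" "c = B (B a) \<Longrightarrow> \<exists>L. numbered white_opp T L"
proof -
  have D: "a \<in> D" "c \<in> D" "W a \<in> D" "W c \<in> D" using a c by (auto simp: I_def)
  note ra = inner_rot[OF D(1)] and rc = inner_rot[OF D(2)] and rx = inner_rot[OF D(3)] and rz = inner_rot[OF D(4)]
  have D': "B a \<in> D" "B (B a) \<in> D" "B (B (B a)) \<in> D" "B (W a) \<in> D" "B (B (W a)) \<in> D" "B (B (B (W a))) \<in> D"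
    "B (W c) \<in> D" "B (B (W c)) \<in> D" "B (B (B (W c))) \<in> D"
    using D inner_rot(4) by blast+
  have bl': "bl (B a) = bl a" "bl (B (B a)) = bl a" "bl (B (B (B a))) = bl a"
    "bl (B (W a)) = bl (W a)" "bl (B (B (W a))) = bl (W a)" "bl (B (B (B (W a)))) = bl (W a)"
    "bl (B (W c)) = bl (W c)" "bl (B (B (W c))) = bl (W c)" "bl (B (B (B (W c)))) = bl (W c)"
    using D D' inner_rot(5) by simp_all
  have nl: "bl (W a) \<noteq> bl a" "bl (W c) \<noteq> bl a" using no_loop[OF DE[OF D(1)]] no_loop[OF DE[OF D(2)]] bl(1) by simp_all
  let ?L1 = "[a, B a, B (B a), B (B (B a)), W a, B (W a), B (B (W a)), B (B (B (W a))),
     W c, B (W c), B (B (W c)), B (B (B (W c)))]"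
  let ?A = "[a, B a, B (B a), B (B (B a))]" and ?X = "[W a, B (W a), B (B (W a)), B (B (B (W a)))]"
    and ?Z = "[W c, B (W c), B (B (W c)), B (B (B (W c)))]"
  have d1: "distinct ?L1"
  proof -
    have A: "e \<in> set ?A \<Longrightarrow> bl e = bl a" and X: "e \<in> set ?X \<Longrightarrow> bl e = bl (W a)"
      and Z: "e \<in> set ?Z \<Longrightarrow> bl e = bl (W c)" for e
      using bl' by auto
    have "set ?A \<inter> set ?X = {}" "set ?A \<inter> set ?Z = {}" "set ?X \<inter> set ?Z = {}"
      using A X Z nl bl(2) by (metis disjoint_iff)+
    then have "distinct (?A @ ?X @ ?Z)"
      unfolding distinct_append set_append Int_Un_distrib using ra(3) rx(3) rz(3) by blast
    then show ?thesis by simp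
  qed
  have s1: "set ?L1 \<subseteq> D" using D D' by simp
  have WW: "W (W a) = a" "W (W c) = c" using white_rot(1) DE D by auto
  show "\<exists>L. numbered white_adj T L" if ca: "c = B a"
    by (rule numbered_adj_center[OF d1 s1]) (use ra(1) rx(1) rz(1) WW I ca in simp_all)
  show "\<exists>L. numbered white_opp T L" if ca: "c = B (B a)"
    by (rule numbered_opp_center[OF d1 s1]) (use ra(1) rx(1) rz(1) WW I ca in simp_all)
qed

lemma numbering_exists: "(\<exists>L. numbered white_adj T L) \<or> (\<exists>L. numbered white_opp T L)"
proof -
  obtain a c where ac: "a \<in> I" "c \<in> I" "c \<noteq> a" "bl a = bl c" "I = {a, W a, c, W c}" "bl (W a) \<noteq> bl (W c)"
    using center by metis
  have aD: "a \<in> D" and cD: "c \<in> D" using ac by (auto simp: I_def)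
  have "c \<in> edges_at_black T (bl a)" using ac(4) DE[OF cD] by (simp add: edges_at_black_def)
  then have "c = B a \<or> c = B (B a) \<or> c = B (B (B a))" using inner_rot(2)[OF aD] ac(3) by auto
  then consider "c = B a" | "c = B (B a)" | "a = B c" using inner_rot(1)[OF aD] by metis
  then show ?thesis
  proof cases
    \<comment> \<open>Here \<open>c\<close> immediately precedes \<open>a\<close>, so exchanging the
      two gives the adjacent case.\<close>
    case 3
    have "I = {c, W c, a, W a}" using ac(5) by auto
    then show ?thesis using numbered_from_center(1)[OF ac(2,1) _ ac(4)[symmetric] ac(6)[symmetric] 3] by blast
  qed (use numbered_from_center[OF ac(1,2,5,4,6)] in blast)+
qed

end

section \<open>Normalizing the critical values\<close>

definition normalized :: "complex poly \<Rightarrow> complex \<Rightarrow> complex \<Rightarrow> complex poly" where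
  "normalized F c1 c2 = smult (1 / (c2 - c1)) (F - [:c1:])"

lemma poly_normalized: "poly (normalized F c1 c2) z = (poly F z - c1) / (c2 - c1)"
  by (simp add: normalized_def)

lemma normalized_segment:
  fixes c1 c2 w :: complex
  assumes "c1 \<noteq> c2"
  shows "(w - c1) / (c2 - c1) \<in> closed_segment 0 1 \<longleftrightarrow> w \<in> closed_segment c1 c2"
    and "(w - c1) / (c2 - c1) \<in> open_segment 0 1 \<longleftrightarrow> w \<in> open_segment c1 c2"
proof -
  have *: "(w - c1) / (c2 - c1) = (1 - u) *\<^sub>R 0 + u *\<^sub>R 1 \<longleftrightarrow> w = (1 - u) *\<^sub>R c1 + u *\<^sub>R c2" for u
    using assms by (simp add: field_simps scaleR_conv_of_real)
  show "(w - c1) / (c2 - c1) \<in> closed_segment 0 1 \<longleftrightarrow> w \<in> closed_segment c1 c2"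
    unfolding in_segment * ..
  show "(w - c1) / (c2 - c1) \<in> open_segment 0 1 \<longleftrightarrow> w \<in> open_segment c1 c2"
    unfolding in_segment * using assms by simp
qed

lemma shabat_tree_normalized:
  assumes "c1 \<noteq> c2"
  shows "shabat_tree (normalized F c1 c2) 0 1 = shabat_tree F c1 c2"
proof -
  let ?f = "normalized F c1 c2"
  have K: "poly ?f -` closed_segment 0 1 = poly F -` closed_segment c1 c2"
    and X: "poly ?f -` open_segment 0 1 = poly F -` open_segment c1 c2"
    using normalized_segment[OF assms] by (auto simp: poly_normalized)
  have 0: "poly ?f v = 0 \<longleftrightarrow> poly F v = c1" and 1: "poly ?f v = 1 \<longleftrightarrow> poly F v = c2" for v
    using assms by (auto simp: poly_normalized)
  have E: "shabat_edges ?f 0 1 = shabat_edges F c1 c2" by (simp add: shabat_edges_def X)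
  have e0: "edge_end ?f 0 e = edge_end F c1 e" and e1: "edge_end ?f 1 e = edge_end F c2 e" for e
    by (simp_all add: edge_end_def 0 1)
  have "edge_rot ?f 0 1 0 = edge_rot F c1 c2 c1" "edge_rot ?f 0 1 1 = edge_rot F c1 c2 c2"
    by (simp_all add: edge_rot_def fun_eq_iff K E e0 e1)
  moreover have "edge_end ?f 0 = edge_end F c1" "edge_end ?f 1 = edge_end F c2"
    by (simp_all add: fun_eq_iff e0 e1)
  moreover have "poly ?f -` {0} = poly F -` {c1}" "poly ?f -` {1} = poly F -` {c2}"
    using 0 1 by auto
  ultimately show ?thesis by (simp add: shabat_tree_def E)
qed

lemma degree_diff_const:
  assumes "degree (F :: complex poly) > 0"
  shows "degree (F - [:c:]) = degree F"
proof -
  have eq: "F - [:c:] = F + [:- c:]" by simp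
  show ?thesis unfolding eq by (rule degree_add_eq_left) (use assms in simp)
qed

lemma shabat_normalized:
  assumes "c1 \<noteq> c2"
  shows "shabat (normalized F c1 c2) 0 1 \<longleftrightarrow> shabat F c1 c2"
proof -
  have "degree (normalized F c1 c2) > 0 \<longleftrightarrow> degree F > 0"
  proof (cases "degree F > 0")
    case True
    then show ?thesis using degree_diff_const assms by (simp add: normalized_def)
  next
    case False
    then obtain a where "F = [:a:]" by (auto elim: degree_eq_zeroE)
    then show ?thesis by (simp add: normalized_def)
  qed
  moreover have "pderiv (normalized F c1 c2) = smult (1 / (c2 - c1)) (pderiv F)"
    by (simp add: normalized_def pderiv_smult pderiv_diff pderiv_pCons)
  ultimately show ?thesis
    using assms by (auto simp: shabat_def poly_normalized)
qed

lemma degree_normalized: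
  assumes "shabat F c1 c2"
  shows "degree (normalized F c1 c2) = degree F"
  using assms degree_diff_const by (auto simp: shabat_def normalized_def)

section \<open>Passports of the two compositions\<close>

lemma order_eqI:
  fixes p :: "complex poly"
  assumes "p = [:- a, 1:] ^ n * h" "poly h a \<noteq> 0"
  shows "Polynomial.order a p = n"
proof -
  have "p \<noteq> 0" using assms by auto
  then have "Polynomial.order a p = Polynomial.order a ([:- a, 1:] ^ n) + Polynomial.order a h"
    unfolding assms(1) by (rule order_mult)
  then show ?thesis using assms(2) by (simp add: order_power_n_n order_0I)
qed

lemma image_mset_order_count:
  assumes "finite S"
  shows "count (image_mset g (mset_set S)) x = card {v \<in> S. g v = x}"
proof -
  have "count (image_mset g (mset_set S)) x = (\<Sum>y\<in>{v \<in> S. g v = x}. count (mset_set S) y)"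
    unfolding count_image_mset using assms by (intro sum.cong) auto
  also have "\<dots> = (\<Sum>y\<in>{v \<in> S. g v = x}. 1)" using assms by (intro sum.cong) auto
  finally show ?thesis by simp
qed

lemma passport_iff_orders:
  assumes f: "shabat f 0 1"
  shows "has_passport (shabat_tree f 0 1) \<alpha> \<beta> n \<longleftrightarrow>
    image_mset (\<lambda>v. Polynomial.order v f) (mset_set {v. poly f v = 0}) = \<alpha> \<and>
    image_mset (\<lambda>v. Polynomial.order v (f - 1)) (mset_set {v. poly f v = 1}) = \<beta> \<and> degree f = n"
proof -
  have fin: "finite {v. poly f v = 0}" "finite {v. poly f v = 1}"
    using shabat_vertices(1)[OF f] by (auto elim: finite_subset[rotated])
  have "image_mset (\<lambda>v. card (edges_at_black (shabat_tree f 0 1) v)) (mset_set {v. poly f v = 0})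
      = image_mset (\<lambda>v. Polynomial.order v f) (mset_set {v. poly f v = 0})"
    using shabat_tree_degrees(1)[OF f] fin by (intro image_mset_cong) auto
  moreover have "image_mset (\<lambda>v. card (edges_at_white (shabat_tree f 0 1) v)) (mset_set {v. poly f v = 1})
      = image_mset (\<lambda>v. Polynomial.order v (f - 1)) (mset_set {v. poly f v = 1})"
    using shabat_tree_degrees(2)[OF f] fin by (intro image_mset_cong) auto
  moreover have "blacks (shabat_tree f 0 1) = {v. poly f v = 0}" "whites (shabat_tree f 0 1) = {v. poly f v = 1}"
    "edges (shabat_tree f 0 1) = shabat_edges f 0 1" by (auto simp: shabat_tree_def)
  ultimately show ?thesis using card_shabat_edges(1)[OF f] by (simp add: has_passport_def)
qed

text \<open>The multiplicities in the partitions follow from the degree: three roots of order 4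
  leave room for 8 simple ones, and there must be 10 double roots of \<open>f - 1\<close>.\<close>

lemma passport_from_orders:
  assumes f: "shabat f 0 1" and deg: "degree f = 20"
    and S: "card S = 3" "\<And>v. v \<in> S \<Longrightarrow> poly f v = 0" "\<And>v. v \<in> S \<Longrightarrow> Polynomial.order v f = 4"
      "\<And>v. v \<notin> S \<Longrightarrow> poly f v = 0 \<Longrightarrow> Polynomial.order v f = 1"
    and W: "\<And>v. poly f v = 1 \<Longrightarrow> Polynomial.order v (f - 1) = 2"
  shows "has_passport (shabat_tree f 0 1) (replicate_mset 3 4 + replicate_mset 8 1) (replicate_mset 10 2) 20"
proof -
  let ?B = "{v. poly f v = 0}" and ?W = "{v. poly f v = 1}"
  have fin: "finite ?B" "finite ?W"
    using shabat_vertices(1)[OF f] by (auto elim: finite_subset[rotated])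
  have finS: "finite S" using S(1) by (simp add: card_ge_0_finite)
  have f0: "f \<noteq> 0" and f1: "f - 1 \<noteq> 0" using deg by auto
  have SB: "S \<subseteq> ?B" using S(2) by auto
  have "20 = (\<Sum>v\<in>?B. Polynomial.order v f)" using sum_order_roots[OF f0] deg by simp
  also have "\<dots> = (\<Sum>v\<in>S. Polynomial.order v f) + (\<Sum>v\<in>?B - S. Polynomial.order v f)"
    using fin SB by (metis sum.subset_diff add.commute)
  also have "(\<Sum>v\<in>S. Polynomial.order v f) = (\<Sum>v\<in>S. 4)" using S(3) by (intro sum.cong) auto
  also have "(\<Sum>v\<in>?B - S. Polynomial.order v f) = (\<Sum>v\<in>?B - S. 1)" using S(4) by (intro sum.cong) auto
  finally have cB: "card (?B - S) = 8" using S(1) by simp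
  have "degree (f - 1) = 20" using degree_diff_const[of f 1] deg by (simp add: one_pCons)
  then have "20 = (\<Sum>v | poly (f - 1) v = 0. Polynomial.order v (f - 1))" using sum_order_roots[OF f1] by simp
  also have "\<dots> = (\<Sum>v\<in>?W. 2)" using W by (intro sum.cong) auto
  finally have cW: "card ?W = 10" by simp
  have "mset_set ?B = mset_set S + mset_set (?B - S)"
    using SB finS fin by (metis Diff_disjoint Un_Diff_cancel finite_Diff mset_set_Union sup.absorb2)
  then have "image_mset (\<lambda>v. Polynomial.order v f) (mset_set ?B) =
      image_mset (\<lambda>v. Polynomial.order v f) (mset_set S) + image_mset (\<lambda>v. Polynomial.order v f) (mset_set (?B - S))"
    by simp
  also have "image_mset (\<lambda>v. Polynomial.order v f) (mset_set S) = image_mset (\<lambda>v. 4) (mset_set S)"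
    using S(3) finS by (intro image_mset_cong) auto
  also have "image_mset (\<lambda>v. Polynomial.order v f) (mset_set (?B - S)) = image_mset (\<lambda>v. 1) (mset_set (?B - S))"
    using S(4) fin by (intro image_mset_cong) auto
  finally have 1: "image_mset (\<lambda>v. Polynomial.order v f) (mset_set ?B) = replicate_mset 3 4 + replicate_mset 8 1"
    using S(1) cB by (simp add: image_mset_const_eq)
  have "image_mset (\<lambda>v. Polynomial.order v (f - 1)) (mset_set ?W) = image_mset (\<lambda>v. 2) (mset_set ?W)"
    using W fin by (intro image_mset_cong) auto
  then have 2: "image_mset (\<lambda>v. Polynomial.order v (f - 1)) (mset_set ?W) = replicate_mset 10 2"
    using cW by (simp add: image_mset_const_eq)
  show ?thesis unfolding passport_iff_orders[OF f] using 1 2 deg by simp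
qed

text \<open>Common to both compositions, with \<open>V\<close> the inner polynomial and
  \<open>w\<close> the nonzero root of the outer one. Since \<open>F' = (2 * V - w) * V'\<close>,
  the three triple zeros of \<open>V'\<close> become roots of order 4 of \<open>F\<close>, and
  \<open>F + w ^ 2 / 4 = (V - w / 2) ^ 2\<close> makes the white vertices double.\<close>

lemma square_composition:
  fixes V :: "complex poly"
  assumes V': "pderiv V = smult K ([:- a, 1:] ^ 3 * [:- b, 1:] ^ 3 * [:- c, 1:] ^ 3)" and K: "K \<noteq> 0"
    and abc: "a \<noteq> b" "a \<noteq> c" "b \<noteq> c"
    and val: "poly V a \<in> {0, w}" "poly V b \<in> {0, w}" "poly V c \<in> {0, w}" and w: "w \<noteq> 0"
  defines "F \<equiv> V * (V - [:w:])"
  shows "shabat F 0 (- (w ^ 2 / 4))"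
    "has_passport (shabat_tree F 0 (- (w ^ 2 / 4))) (replicate_mset 3 4 + replicate_mset 8 1) (replicate_mset 10 2) 20"
proof -
  define d where "d = - (w ^ 2 / 4)"
  define S where "S = {a, b, c}"
  have d0: "d \<noteq> 0" using w by (simp add: d_def)
  have "degree (pderiv V) = 9" unfolding V' using K by (simp add: degree_mult_eq degree_power_eq)
  then have degV: "degree V = 10" by (simp add: degree_pderiv)
  then have "degree F = 20" unfolding F_def using degree_diff_const[of V w]
    by (subst degree_mult_eq) auto
  have pF: "poly F z = poly V z * (poly V z - w)" for z by (simp add: F_def)
  have dV: "pderiv (V - [:w:]) = pderiv V" by (simp add: pderiv_diff pderiv_pCons)
  have F': "pderiv F = (V + V - [:w:]) * pderiv V"
    unfolding F_def pderiv_mult dV by (simp only: distrib_right[symmetric] add_diff_eq)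
  have lin: "poly [:- x, 1:] z = 0 \<longleftrightarrow> z = x" for x z :: complex
    by simp
  have V'0: "poly (pderiv V) z = 0 \<longleftrightarrow> z \<in> S" for z
    unfolding V' using K by (simp del: poly_pCons add: lin S_def)
  have valS: "poly V z = 0 \<or> poly V z = w" if "z \<in> S" for z using val that by (auto simp: S_def)
  show sF: "shabat F 0 (- (w ^ 2 / 4))"
    unfolding shabat_def
  proof (intro conjI allI impI)
    fix z assume "poly (pderiv F) z = 0"
    moreover have "poly (pderiv F) z = (2 * poly V z - w) * poly (pderiv V) z" by (simp add: F')
    ultimately have "2 * poly V z = w \<or> z \<in> S" using V'0 by simp
    then show "poly F z \<in> {0, - (w ^ 2 / 4)}"
    proof
      assume "2 * poly V z = w"
      then have v: "poly V z = w / 2" by (simp add: field_simps)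
      show ?thesis unfolding pF v by (simp add: field_simps power2_eq_square)
    qed (use valS in \<open>auto simp: pF\<close>)
  qed (use w \<open>degree F = 20\<close> in auto)
  define f where "f = normalized F 0 d"
  have sf: "shabat f 0 1" using sF shabat_normalized[of 0 d F] d0 by (simp add: f_def d_def[symmetric])
  have degf: "degree f = 20" using degree_normalized[OF sF] \<open>degree F = 20\<close> by (simp add: f_def d_def)
  have f_eq: "f = smult (1 / d) F" by (simp add: f_def normalized_def)
  have pf: "poly f z = poly F z / d" for z by (simp add: f_eq)
  have f': "pderiv f = smult (1 / d) ((V + V - [:w:]) * pderiv V)" by (simp add: f_eq pderiv_smult F')
  have order3: "Polynomial.order z (pderiv V) = 3" if "z \<in> S" for z
  proof -
    consider "z = a" | "z = b" | "z = c" using \<open>z \<in> S\<close> by (auto simp: S_def)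
    then show ?thesis
    proof cases
      case 1
      show ?thesis
        by (rule order_eqI[of _ _ _ "smult K ([:- b, 1:] ^ 3 * [:- c, 1:] ^ 3)"])
          (use 1 K abc in \<open>auto simp: V' algebra_simps\<close>)
    next
      case 2
      show ?thesis
        by (rule order_eqI[of _ _ _ "smult K ([:- a, 1:] ^ 3 * [:- c, 1:] ^ 3)"])
          (use 2 K abc in \<open>auto simp: V' algebra_simps\<close>)
    next
      case 3
      show ?thesis
        by (rule order_eqI[of _ _ _ "smult K ([:- a, 1:] ^ 3 * [:- b, 1:] ^ 3)"])
          (use 3 K abc in \<open>auto simp: V' algebra_simps\<close>)
    qed
  qed
  have V'ne: "pderiv V \<noteq> 0" using \<open>degree (pderiv V) = 9\<close> by auto
  \<comment> \<open>Over 0 the value of \<open>V\<close> is 0 or \<open>w\<close>, so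
    \<open>2 * V - w\<close> does not vanish there and \<open>f'\<close> has the same order as
    \<open>V'\<close>.\<close>
  have black: "Polynomial.order z f = Suc (Polynomial.order z (pderiv V))" if "poly f z = 0" for z
  proof -
    have "poly V z = 0 \<or> poly V z = w" using that d0 by (auto simp: pf pF)
    then have nz: "poly (V + V - [:w:]) z \<noteq> 0" using w by auto
    then have "V + V - [:w:] \<noteq> 0" by (metis poly_0)
    then have "(V + V - [:w:]) * pderiv V \<noteq> 0" using V'ne by simp
    then have "Polynomial.order z ((V + V - [:w:]) * pderiv V) = Polynomial.order z (V + V - [:w:]) + Polynomial.order z (pderiv V)"
      by (rule order_mult)
    also have "Polynomial.order z (V + V - [:w:]) = 0" using nz by (rule order_0I)
    finally have "Polynomial.order z (pderiv f) = Polynomial.order z (pderiv V)"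
      unfolding f' using d0 by (simp add: order_smult)
    then show ?thesis using order_pderiv_eq[of f z] degf that by simp
  qed
  have "has_passport (shabat_tree f 0 1) (replicate_mset 3 4 + replicate_mset 8 1) (replicate_mset 10 2) 20"
  proof (rule passport_from_orders[OF sf degf])
    show "card S = 3" using abc by (simp add: S_def)
    show z: "poly f v = 0" if "v \<in> S" for v using valS[OF that] by (auto simp: pf pF)
    show "Polynomial.order v f = 4" if "v \<in> S" for v using black[OF z[OF that]] order3[OF that] by simp
    show "Polynomial.order v f = 1" if "v \<notin> S" "poly f v = 0" for v
      using black[OF that(2)] V'0[of v] that(1) by (simp add: order_0I)
    show "Polynomial.order v (f - 1) = 2" if "poly f v = 1" for v
    proof -
      let ?U = "V - [:w / 2:]"
      have sq: "f - 1 = smult (1 / d) (?U ^ 2)"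
        using d0 by (intro poly_eq_poly_eq_iff[THEN iffD1] ext)
          (simp add: pf pF d_def power2_eq_square field_simps)
      have "poly (f - 1) v = 0" using that by simp
      then have Uv: "poly ?U v = 0" unfolding sq using d0 by simp
      then have "v \<notin> S" using valS[of v] w by auto
      have dU: "pderiv ?U = pderiv V" by (simp add: pderiv_diff pderiv_pCons)
      have degU: "degree ?U > 0" using degree_diff_const[of V "w / 2"] degV by simp
      have "Polynomial.order v ?U = 1"
        using order_pderiv_eq[OF degU Uv] V'0[of v] \<open>v \<notin> S\<close> by (simp add: dU order_0I)
      moreover have "?U \<noteq> 0" using degU by auto
      ultimately show ?thesis unfolding sq using d0 by (simp add: order_smult power2_eq_square order_mult)
    qed
  qed
  then show "has_passport (shabat_tree F 0 (- (w ^ 2 / 4))) (replicate_mset 3 4 + replicate_mset 8 1) (replicate_mset 10 2) 20"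
    using shabat_tree_normalized[of 0 d F] d0 by (simp add: f_def d_def)
qed

section \<open>The two explicit inner polynomials\<close>

lemma poly_A: "poly A_poly y = (y - 1) ^ 4 * (y + 1/4)"
  unfolding A_poly_def poly_mult poly_power by (simp add: algebra_simps)

lemma poly_B: "poly B_poly z = 4 * z ^ 2 + 4 * z + 1"
  by (simp add: B_poly_def power2_eq_square algebra_simps)

lemma poly_P: "poly P_poly z = (4 * z ^ 2 + 4 * z) ^ 4 * (4 * z ^ 2 + 4 * z + 5/4)"
  by (simp add: P_poly_def poly_pcompose poly_A poly_B)

text \<open>Here \<open>A' = 5 * y * (y - 1) ^ 3\<close>, \<open>B = (2 * z + 1) ^ 2\<close> and
  \<open>B - 1 = 4 * z * (z + 1)\<close>. The factor \<open>y\<close> contributes a double zero at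
  -1/2, which \<open>B'\<close> completes to a triple one, and \<open>(y - 1) ^ 3\<close> gives the
  triple zeros at 0 and -1.\<close>

lemma pderiv_P:
  "pderiv P_poly = smult 10240 ([:- 0, 1:] ^ 3 * [:- (- 1), 1:] ^ 3 * [:- (- 1/2), 1:] ^ 3)"
proof (rule poly_eq_poly_eq_iff[THEN iffD1], rule ext)
  fix z :: complex
  have A: "poly (pderiv A_poly) y = 5 * y * (y - 1) ^ 3" for y
    unfolding A_poly_def pderiv_mult pderiv_power poly_add poly_mult poly_smult poly_power
    by (simp add: pderiv_pCons) algebra
  have B: "poly (pderiv B_poly) z = 8 * z + 4"
    by (simp add: B_poly_def pderiv_mult pderiv_add pderiv_pCons algebra_simps)
  have "poly (pderiv P_poly) z = 5 * (4 * z ^ 2 + 4 * z + 1) * (4 * z ^ 2 + 4 * z) ^ 3 * (8 * z + 4)"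
    by (simp add: P_poly_def pderiv_pcompose poly_pcompose A B poly_B)
  also have "\<dots> = 10240 * (z ^ 3 * (z + 1) ^ 3 * (z + 1/2) ^ 3)"
    by (simp add: power2_eq_square power3_eq_cube field_simps)
  finally show "poly (pderiv P_poly) z = poly (smult 10240 ([:- 0, 1:] ^ 3 * [:- (- 1), 1:] ^ 3 * [:- (- 1/2), 1:] ^ 3)) z"
    by (simp add: algebra_simps)
qed

text \<open>The two conjugate linear factors multiply to \<open>(z - 5/3) ^ 2 + 2/9\<close>, which
  removes the square root.\<close>

lemma poly_R: "poly R_poly z = (z ^ 2 + 3) ^ 4 * (z ^ 2 - 10/3 * z + 3)"
proof -
  define s where "s = csqrt (- 2)"
  have s: "s * s = - 2" unfolding s_def power2_eq_square[symmetric] by (rule power2_csqrt)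
  have "(- (5/3) - s / 3 + z) * (- (5/3) + s / 3 + z) = (z - 5/3) ^ 2 - s * s / 9"
    by (simp add: power2_eq_square field_simps)
  also have "\<dots> = z ^ 2 - 10/3 * z + 3" unfolding s by (simp add: power2_eq_square field_simps)
  finally have *: "(- (5/3) - s / 3 + z) * (- (5/3) + s / 3 + z) = z ^ 2 - 10/3 * z + 3" .
  have "poly R_poly z = (z ^ 2 + 3) ^ 4 * ((- (5/3) - s / 3 + z) * (- (5/3) + s / 3 + z))"
    unfolding R_poly_def s_def[symmetric] poly_mult poly_power
    by (simp add: power2_eq_square mult.assoc add.commute)
  then show ?thesis unfolding * .
qed

lemma R_poly_eq: "R_poly = [:3, 0, 1:] ^ 4 * [:3, - 10/3, 1:]"
  by (intro poly_eq_poly_eq_iff[THEN iffD1] ext) (simp add: poly_R power2_eq_square algebra_simps)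

lemma pderiv_R:
  "pderiv R_poly = smult 10 ([:- 1, 1:] ^ 3 * [:- (\<i> * sqrt 3), 1:] ^ 3 * [:- (- \<i> * sqrt 3), 1:] ^ 3)"
proof (rule poly_eq_poly_eq_iff[THEN iffD1], rule ext)
  fix z :: complex
  define t where "t = \<i> * complex_of_real (sqrt 3)"
  have t: "t * t = - 3" by (simp add: t_def complex_eq_iff)
  have "poly (pderiv R_poly) z = 10 * ((z - 1) ^ 3 * (z ^ 2 + 3) ^ 3)"
    unfolding R_poly_eq pderiv_mult pderiv_power poly_add poly_mult poly_smult poly_power
    by (simp add: pderiv_pCons power2_eq_square) algebra
  also have "z ^ 2 + 3 = (z - t) * (z + t)"
    using t by (simp add: power2_eq_square algebra_simps)
  also have "10 * ((z - 1) ^ 3 * ((z - t) * (z + t)) ^ 3) = poly (smult 10 ([:- 1, 1:] ^ 3 * [:- t, 1:] ^ 3 * [:- (- t), 1:] ^ 3)) z"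
    unfolding poly_smult poly_mult poly_power power_mult_distrib by (simp add: algebra_simps)
  finally show "poly (pderiv R_poly) z = poly (smult 10 ([:- 1, 1:] ^ 3 * [:- (\<i> * sqrt 3), 1:] ^ 3 * [:- (- \<i> * sqrt 3), 1:] ^ 3)) z"
    by (simp add: t_def)
qed

definition F1_poly :: "complex poly" where "F1_poly = Q1_poly \<circ>\<^sub>p P_poly"
definition F2_poly :: "complex poly" where "F2_poly = Q2_poly \<circ>\<^sub>p R_poly"

lemma F1_eq: "F1_poly = P_poly * (P_poly - [:1/4:])"
  by (simp add: F1_poly_def Q1_poly_def pcompose_mult pcompose_pCons)

lemma F2_eq: "F2_poly = R_poly * (R_poly - [:512/3:])"
  by (simp add: F2_poly_def Q2_poly_def pcompose_mult pcompose_pCons)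

text \<open>\<open>P_poly\<close> is 0 at the critical points 0 and -1, and 1/4 at -1/2, so the
  outer polynomial vanishes over all three.\<close>

lemma F1_shabat: "shabat F1_poly 0 (- (1/64))"
  and F1_passport: "has_passport (shabat_tree F1_poly 0 (- (1/64)))
    (replicate_mset 3 4 + replicate_mset 8 1) (replicate_mset 10 2) 20"
proof -
  have *: "poly P_poly 0 \<in> {0, 1/4}" "poly P_poly (- 1) \<in> {0, 1/4}" "poly P_poly (- 1/2) \<in> {0, 1/4}"
    by (simp_all add: poly_P power2_eq_square power4_eq_xxxx)
  have d: "- ((1/4) ^ 2 / 4) = - (1/64 :: complex)" by (simp add: power2_eq_square)
  note sc = square_composition[OF pderiv_P _ _ _ _ *, folded F1_eq, unfolded d]
  show "shabat F1_poly 0 (- (1/64))" by (rule sc(1)) auto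
  show "has_passport (shabat_tree F1_poly 0 (- (1/64)))
    (replicate_mset 3 4 + replicate_mset 8 1) (replicate_mset 10 2) 20" by (rule sc(2)) auto
qed

text \<open>\<open>R_poly\<close> is 0 at the two roots of \<open>z ^ 2 + 3\<close>, and
  \<open>4 ^ 4 * (2/3) = 512/3\<close> at the third critical point 1.\<close>

lemma F2_shabat: "shabat F2_poly 0 (- (65536/9))"
  and F2_passport: "has_passport (shabat_tree F2_poly 0 (- (65536/9)))
    (replicate_mset 3 4 + replicate_mset 8 1) (replicate_mset 10 2) 20"
proof -
  have s3: "complex_of_real (sqrt 3) * complex_of_real (sqrt 3) = 3"
    by (simp flip: of_real_mult)
  have *: "poly R_poly 1 \<in> {0, 512/3}" "poly R_poly (\<i> * sqrt 3) \<in> {0, 512/3}" "poly R_poly (- \<i> * sqrt 3) \<in> {0, 512/3}"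
    using s3 by (simp_all add: poly_R power2_eq_square power4_eq_xxxx algebra_simps)
  have ne: "1 \<noteq> \<i> * complex_of_real (sqrt 3)" "1 \<noteq> - \<i> * complex_of_real (sqrt 3)"
    "\<i> * complex_of_real (sqrt 3) \<noteq> - \<i> * complex_of_real (sqrt 3)"
    by (auto simp: complex_eq_iff)
  have d: "- ((512/3) ^ 2 / 4) = - (65536/9 :: complex)" by (simp add: power2_eq_square)
  note sc = square_composition[OF pderiv_R _ ne *, folded F2_eq, unfolded d]
  show "shabat F2_poly 0 (- (65536/9))" by (rule sc(1)) auto
  show "has_passport (shabat_tree F2_poly 0 (- (65536/9)))
    (replicate_mset 3 4 + replicate_mset 8 1) (replicate_mset 10 2) 20" by (rule sc(2)) auto
qed

section \<open>Shabat polynomials with the passport\<close>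

lemma linear_power_dvd_cofactor:
  fixes p q :: "complex poly"
  assumes "poly p a \<noteq> 0" "[:- a, 1:] ^ n dvd p * q"
  shows "[:- a, 1:] ^ n dvd q"
proof (cases "q = 0")
  case False
  have "p \<noteq> 0" using assms(1) by auto
  then have ne: "p * q \<noteq> 0" using False by simp
  have "Polynomial.order a (p * q) = Polynomial.order a q"
    unfolding order_mult[OF ne] order_0I[OF assms(1)] by simp
  then show ?thesis using assms(2) ne False unfolding order_divides by metis
qed simp

lemma mult_linear_power_dvd:
  fixes p q :: "complex poly"
  assumes "poly p a \<noteq> 0" "p dvd q" "[:- a, 1:] ^ n dvd q"
  shows "p * [:- a, 1:] ^ n dvd q"
proof -
  obtain r where r: "q = p * r" using assms(2) by (elim dvdE)
  then have "[:- a, 1:] ^ n dvd r" using linear_power_dvd_cofactor[OF assms(1)] assms(3) by blast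
  then show ?thesis unfolding r by (intro mult_dvd_mono dvd_refl)
qed

lemma power_dvd_pderiv:
  fixes p q :: "complex poly"
  shows "p ^ n dvd pderiv (p ^ Suc n * q)"
proof -
  have "p ^ n dvd p ^ Suc n * pderiv q" by (simp add: le_imp_power_dvd dvd_mult2)
  moreover have "p ^ n dvd q * pderiv (p ^ Suc n)"
    unfolding pderiv_power_Suc by (intro dvd_mult dvd_mult2 dvd_smult dvd_refl)
  ultimately show ?thesis unfolding pderiv_mult by (rule dvd_add)
qed

lemma monic_square:
  fixes p :: "complex poly"
  assumes "p \<noteq> 0" and "\<And>z. poly p z = 0 \<Longrightarrow> Polynomial.order z p = 2"
  obtains w where "p = smult (lead_coeff p) (w ^ 2)" "lead_coeff w = 1" "degree p = 2 * degree w"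
proof -
  define w where "w = (\<Prod>z | poly p z = 0. [:- z, 1:])"
  have "p = smult (lead_coeff p) (\<Prod>z | poly p z = 0. [:- z, 1:] ^ Polynomial.order z p)"
    by (rule complex_poly_decompose[symmetric])
  also have "(\<Prod>z | poly p z = 0. [:- z, 1:] ^ Polynomial.order z p) = (\<Prod>z | poly p z = 0. [:- z, 1:] ^ 2)"
    using assms(2) by (intro prod.cong) auto
  also have "\<dots> = w ^ 2" by (simp add: w_def prod_power_distrib)
  finally have 1: "p = smult (lead_coeff p) (w ^ 2)" .
  have 2: "lead_coeff w = 1" by (simp add: w_def lead_coeff_prod)
  have "lead_coeff p \<noteq> 0" using assms(1) by simp
  moreover have "w \<noteq> 0" using 2 by auto
  ultimately have "degree (smult (lead_coeff p) (w ^ 2)) = 2 * degree w"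
    by (simp add: degree_power_eq)
  then show thesis using that[OF 1 2] 1 by simp
qed

text \<open>By its leading coefficient the cubic can only be \<open>10 * (u - c) ^ 3\<close>. It is
  the factor of the derivative of \<open>(u ^ 2 - d) ^ 4 * (u ^ 2 + b * u + g)\<close> that remains
  after \<open>(u ^ 2 - d) ^ 3\<close>.\<close>

lemma cubic_coefficients:
  fixes c d g b :: complex
  assumes "[:- c, 1:] ^ 3 dvd [:- (d * b), 8 * g - 2 * d, 9 * b, 10:]"
  shows "9 * b = - 30 * c" "8 * g - 2 * d = 30 * c ^ 2" "d * b = 10 * c ^ 3"
proof -
  obtain Y where Y: "[:- (d * b), 8 * g - 2 * d, 9 * b, 10:] = [:- c, 1:] ^ 3 * Y" using assms by (elim dvdE)
  have "Y \<noteq> 0" using Y by auto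
  then have "degree ([:- c, 1:] ^ 3 * Y) = 3 + degree Y" by (simp add: degree_mult_eq degree_power_eq)
  moreover have "degree [:- (d * b), 8 * g - 2 * d, 9 * b, 10:] = 3" by simp
  ultimately have "degree Y = 0" using Y by simp
  then obtain y where y: "Y = [:y:]" by (auto elim: degree_eq_zeroE)
  have cube: "[:- c, 1:] ^ 3 = [:- (c ^ 3), 3 * c ^ 2, - 3 * c, 1:]"
    by (simp add: power3_eq_cube power2_eq_square algebra_simps)
  have "y = 10" using Y unfolding cube y by simp
  then show "9 * b = - 30 * c" "8 * g - 2 * d = 30 * c ^ 2" "d * b = 10 * c ^ 3"
    using Y unfolding cube y by simp_all
qed

text \<open>
  In the coordinate centered between the two roots \<open>a\<close> and \<open>b\<close>, \<open>w - \<sigma>\<close> becomes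
  \<open>(u^2 - \<delta>)^4 (u^2 + \<beta> u + \<gamma>)\<close>, and the derivative has a triple zero at \<open>c\<close>.
\<close>

lemma classification_core:
  fixes w f :: "complex poly"
  assumes k: "k * \<sigma> ^ 2 = - 1" and w: "degree w = 10" "lead_coeff w = 1"
    and f: "f = smult k ((w - [:\<sigma>:]) * (w + [:\<sigma>:]))"
    and abc: "a \<noteq> b" "a \<noteq> c" "b \<noteq> c"
    and da: "[:- a, 1:] ^ 4 dvd w - [:\<sigma>:]" and db: "[:- b, 1:] ^ 4 dvd w - [:\<sigma>:]"
    and dc: "[:- c, 1:] ^ 4 dvd w + [:\<sigma>:]"
  shows "shabat_equiv F1_poly 0 (- (1/64)) f 0 1 \<or> shabat_equiv F2_poly 0 (- (65536/9)) f 0 1"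
proof -
  define V where "V = w - [:\<sigma>:]"
  have wV: "w + [:\<sigma>:] = V + [:2 * \<sigma>:]" by (simp add: V_def)
  have degV: "degree V = 10" using degree_diff_const[of w \<sigma>] w by (simp add: V_def)
  then have "lead_coeff V = 1" using w by (simp add: V_def coeff_pCons split: nat.split)
  \<comment> \<open>Translation by the midpoint \<open>m\<close> moves \<open>a\<close> and
    \<open>b\<close> to \<open>e\<close> and \<open>- e\<close>, so the two fourth powers combine to
    \<open>(u ^ 2 - \<delta>) ^ 4\<close>.\<close>
  define m where "m = (a + b) / 2"
  define e where "e = (a - b) / 2"
  define \<delta> where "\<delta> = e ^ 2"
  define c' where "c' = c - m"
  have ab: "a = m + e" "b = m - e" by (simp_all add: m_def e_def field_simps)
  have e0: "e \<noteq> 0" using abc by (simp add: e_def)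
  then have \<delta>0: "\<delta> \<noteq> 0" by (simp add: \<delta>_def)
  have "c = m + c'" by (simp add: c'_def)
  then have ce: "c' \<noteq> e" "c' \<noteq> - e" using abc(2,3) by (auto simp: ab)
  have "[:- a, 1:] ^ 4 * [:- b, 1:] ^ 4 dvd V"
    using da db abc(1) unfolding V_def by (intro mult_linear_power_dvd) auto
  then obtain q where q: "V = [:- a, 1:] ^ 4 * [:- b, 1:] ^ 4 * q" by (elim dvdE)
  then have "q \<noteq> 0" using degV by auto
  then have "degree V = 8 + degree q" unfolding q by (simp add: degree_mult_eq degree_power_eq)
  then have degq: "degree q = 2" using degV by simp
  have "lead_coeff q = 1" using \<open>lead_coeff V = 1\<close> unfolding q by (simp add: lead_coeff_mult lead_coeff_power)
  then have cq: "coeff q 2 = 1" using degq by simp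
  have pq: "poly q x = coeff q 0 + coeff q 1 * x + x ^ 2" for x
    unfolding poly_altdef degq using cq by (simp add: numeral_2_eq_2)
  define \<beta> where "\<beta> = 2 * m + coeff q 1"
  define \<gamma> where "\<gamma> = m ^ 2 + coeff q 1 * m + coeff q 0"
  define V2 where "V2 = [:- \<delta>, 0, 1:] ^ 4 * [:\<gamma>, \<beta>, 1:]"
  have pV2: "poly V2 u = (u ^ 2 - \<delta>) ^ 4 * (u ^ 2 + \<beta> * u + \<gamma>)" for u
    unfolding V2_def poly_mult poly_power by (simp add: power2_eq_square algebra_simps)
  have VV2: "poly V (u + m) = poly V2 u" for u
  proof -
    have "poly V (u + m) = (u - e) ^ 4 * (u + e) ^ 4 * poly q (u + m)"
      unfolding q poly_mult poly_power by (simp add: ab add.commute)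
    also have "(u - e) ^ 4 * (u + e) ^ 4 = (u ^ 2 - \<delta>) ^ 4"
      unfolding power_mult_distrib[symmetric] by (simp add: \<delta>_def power2_eq_square algebra_simps)
    also have "poly q (u + m) = u ^ 2 + \<beta> * u + \<gamma>"
      unfolding pq \<beta>_def \<gamma>_def by (simp add: power2_eq_square algebra_simps)
    finally show ?thesis unfolding pV2 .
  qed
  obtain h where h: "V + [:2 * \<sigma>:] = [:- c, 1:] ^ 4 * h" using dc unfolding wV by (elim dvdE)
  define H where "H = h \<circ>\<^sub>p [:m, 1:]"
  have H: "V2 + [:2 * \<sigma>:] = [:- c', 1:] ^ 4 * H"
  proof (rule poly_eq_poly_eq_iff[THEN iffD1], rule ext)
    fix u
    have "poly (V2 + [:2 * \<sigma>:]) u = poly (V + [:2 * \<sigma>:]) (u + m)" using VV2[of u] by simp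
    also have "\<dots> = (u + m - c) ^ 4 * poly h (u + m)" unfolding h poly_mult poly_power by simp
    also have "\<dots> = poly ([:- c', 1:] ^ 4 * H) u"
      unfolding poly_mult poly_power by (simp add: H_def poly_pcompose c'_def algebra_simps)
    finally show "poly (V2 + [:2 * \<sigma>:]) u = poly ([:- c', 1:] ^ 4 * H) u" .
  qed
  define T where "T = [:- (\<delta> * \<beta>), 8 * \<gamma> - 2 * \<delta>, 9 * \<beta>, 10:]"
  have "pderiv V2 = [:- \<delta>, 0, 1:] ^ 3 * T"
  proof (rule poly_eq_poly_eq_iff[THEN iffD1], rule ext)
    fix u
    show "poly (pderiv V2) u = poly ([:- \<delta>, 0, 1:] ^ 3 * T) u"
      unfolding V2_def T_def pderiv_mult pderiv_power poly_add poly_mult poly_smult poly_power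
      by (simp add: pderiv_pCons) algebra
  qed
  moreover have "pderiv V2 = pderiv (V2 + [:2 * \<sigma>:])" by (simp add: pderiv_add pderiv_pCons)
  then have "[:- c', 1:] ^ 3 dvd pderiv V2"
    unfolding H using power_dvd_pderiv[of "[:- c', 1:]" 3 H] by (simp only: Suc_numeral add_num_simps)
  ultimately have "[:- c', 1:] ^ 3 dvd [:- \<delta>, 0, 1:] ^ 3 * T" by simp
  moreover have "poly ([:- \<delta>, 0, 1:] ^ 3) c' = ((c' - e) * (c' + e)) ^ 3"
    unfolding poly_power by (simp add: \<delta>_def power2_eq_square algebra_simps)
  then have "poly ([:- \<delta>, 0, 1:] ^ 3) c' \<noteq> 0" using ce by (auto simp: add_eq_0_iff2)
  ultimately have "[:- c', 1:] ^ 3 dvd T" by (metis linear_power_dvd_cofactor)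
  note eqs = cubic_coefficients[OF this[unfolded T_def]]
  \<comment> \<open>Evaluation at \<open>c'\<close> eliminates the unknown \<open>\<sigma>\<close>
    in favour of a value of \<open>V2\<close>.\<close>
  have "poly (V2 + [:2 * \<sigma>:]) c' = 0" unfolding H by simp
  then have root: "2 * \<sigma> = - poly V2 c'" by (simp add: add_eq_0_iff)
  have pf: "poly f x = k * (poly V2 (x - m) * (poly V2 (x - m) - poly V2 c'))" for x
    using VV2[of "x - m"] root unfolding f wV V_def[symmetric] by simp
  have k': "k * (poly V2 c') ^ 2 = - 4"
  proof -
    have "poly V2 c' = - (2 * \<sigma>)" using root by simp
    then show ?thesis using k by (simp add: power_mult_distrib)
  qed
  show ?thesis
  proof (cases "c' = 0")
    case True
    have \<beta>: "\<beta> = 0" and \<gamma>: "\<gamma> = \<delta> / 4" using eqs(1,2) True by (auto simp: field_simps)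
    have V20: "poly V2 c' = \<delta> ^ 5 / 4" unfolding pV2 \<beta> \<gamma> True by (simp add: numeral_eq_Suc)
    \<comment> \<open>The value -64 follows from \<open>k'\<close> and \<open>V20\<close>; it is the
      reciprocal of the critical value -1/64, as the equivalence demands.\<close>
    define A where "A = k * \<delta> ^ 10"
    have A: "A = - 64" using k' unfolding V20 A_def by (simp add: power_divide power_mult[symmetric] field_simps)
    \<comment> \<open>This affine map sends \<open>a\<close>, \<open>b\<close>, \<open>c\<close> to
      0, -1, -1/2, the critical points of \<open>P_poly\<close>.\<close>
    define y where "y x = - (m / (2 * e)) - 1/2 + 1 / (2 * e) * x" for x
    have PV: "poly P_poly (y x) = poly V2 (x - m) / \<delta> ^ 5" for x
    proof -
      define u where "u = x - m"
      have "2 * y x + 1 = u / e" by (simp add: y_def u_def field_simps e0)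
      moreover have "4 * (y x) ^ 2 + 4 * y x = (2 * y x + 1) ^ 2 - 1"
        by (simp add: power2_eq_square algebra_simps)
      ultimately have "4 * (y x) ^ 2 + 4 * y x = u ^ 2 / \<delta> - 1"
        by (simp only: \<delta>_def power_divide)
      then have "poly P_poly (y x) = (u ^ 2 / \<delta> - 1) ^ 4 * (u ^ 2 / \<delta> - 1 + 5/4)"
        unfolding poly_P by (simp only:)
      also have "u ^ 2 / \<delta> - 1 = (u ^ 2 - \<delta>) / \<delta>" using \<delta>0 by (simp add: field_simps)
      also have "((u ^ 2 - \<delta>) / \<delta>) ^ 4 * ((u ^ 2 - \<delta>) / \<delta> + 5/4) = (u ^ 2 - \<delta>) ^ 4 * (u ^ 2 + \<delta> / 4) / \<delta> ^ 5"
        using \<delta>0 by (simp add: power_divide field_simps numeral_eq_Suc)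
      also have "\<dots> = poly V2 u / \<delta> ^ 5" unfolding pV2 \<beta> \<gamma> by simp
      finally show ?thesis by (simp add: u_def)
    qed
    have "f = smult A (F1_poly \<circ>\<^sub>p [:- (m / (2 * e)) - 1/2, 1 / (2 * e):]) + [:0:]"
    proof (rule poly_eq_poly_eq_iff[THEN iffD1], rule ext)
      fix x
      have "poly (smult A (F1_poly \<circ>\<^sub>p [:- (m / (2 * e)) - 1/2, 1 / (2 * e):]) + [:0:]) x
          = A * (poly P_poly (y x) * (poly P_poly (y x) - 1/4))"
        by (simp add: poly_pcompose F1_eq y_def mult.commute)
      also have "\<dots> = poly f x"
        unfolding PV pf V20 A_def using \<delta>0 by (simp add: field_simps power_add[of \<delta> 5 5, simplified])
      finally show "poly f x = poly (smult A (F1_poly \<circ>\<^sub>p [:- (m / (2 * e)) - 1/2, 1 / (2 * e):]) + [:0:]) x" ..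
    qed
    then have "shabat_equiv F1_poly 0 (- (1/64)) f 0 1"
      unfolding shabat_equiv_def using e0 A
      by (intro exI[of _ A] exI[of _ 0] exI[of _ "1 / (2 * e)"] exI[of _ "- (m / (2 * e)) - 1/2"]) simp
    then show ?thesis ..
  next
    case False
    have \<beta>: "\<beta> = - (10/3) * c'" using eqs(1) by (simp add: field_simps)
    \<comment> \<open>Eliminating \<open>\<beta>\<close> leaves this one equation; its other
      solution \<open>c' = 0\<close> was the first composition.\<close>
    have "c' * (\<delta> + 3 * c' ^ 2) = 0" using eqs(3) unfolding \<beta> by algebra
    then have \<delta>: "\<delta> = - 3 * c' ^ 2" using False by (simp add: add_eq_0_iff2)
    have \<gamma>: "\<gamma> = 3 * c' ^ 2" using eqs(2) unfolding \<delta> by (simp add: field_simps)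
    have RV: "poly V2 u = c' ^ 10 * poly R_poly (u / c')" for u
    proof -
      have "poly V2 u = (u ^ 2 + 3 * c' ^ 2) ^ 4 * (u ^ 2 - 10/3 * c' * u + 3 * c' ^ 2)"
        unfolding pV2 \<beta> \<gamma> \<delta> by simp
      also have "u ^ 2 + 3 * c' ^ 2 = c' ^ 2 * ((u / c') ^ 2 + 3)"
        using False by (simp add: field_simps power2_eq_square)
      also have "u ^ 2 - 10/3 * c' * u + 3 * c' ^ 2 = c' ^ 2 * ((u / c') ^ 2 - 10/3 * (u / c') + 3)"
        using False by (simp add: field_simps power2_eq_square)
      also have "(c' ^ 2 * ((u / c') ^ 2 + 3)) ^ 4 * (c' ^ 2 * ((u / c') ^ 2 - 10/3 * (u / c') + 3))
          = c' ^ 10 * poly R_poly (u / c')"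
        unfolding poly_R power_mult_distrib power_mult[symmetric] by (simp add: power_add[of c' 8 2, simplified])
      finally show ?thesis .
    qed
    have V2c: "poly V2 c' = c' ^ 10 * (512/3)"
      unfolding RV using False by (simp add: poly_R)
    define A where "A = k * c' ^ 20"
    have A: "A = - (9 / 65536)"
      using k' unfolding V2c A_def by (simp add: power_mult_distrib power_mult[symmetric] field_simps)
    \<comment> \<open>This map sends \<open>c\<close> to 1 and, because
      \<open>\<delta> = - 3 * c' ^ 2\<close>, sends \<open>a\<close> and \<open>b\<close> to the
      roots of \<open>z ^ 2 + 3\<close>.\<close>
    define y where "y x = - (m / c') + 1 / c' * x" for x
    have y: "(x - m) / c' = y x" for x by (simp add: y_def field_simps diff_divide_distrib)
    have "f = smult A (F2_poly \<circ>\<^sub>p [:- (m / c'), 1 / c':]) + [:0:]"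
    proof (rule poly_eq_poly_eq_iff[THEN iffD1], rule ext)
      fix x
      have "poly (smult A (F2_poly \<circ>\<^sub>p [:- (m / c'), 1 / c':]) + [:0:]) x
          = A * (poly R_poly (y x) * (poly R_poly (y x) - 512/3))"
        by (simp add: poly_pcompose F2_eq y_def mult.commute)
      also have "\<dots> = poly f x"
        unfolding pf V2c unfolding RV y A_def by (simp add: algebra_simps power_add[of c' 10 10, simplified])
      finally show "poly f x = poly (smult A (F2_poly \<circ>\<^sub>p [:- (m / c'), 1 / c':]) + [:0:]) x" ..
    qed
    then have "shabat_equiv F2_poly 0 (- (65536/9)) f 0 1"
      unfolding shabat_equiv_def using False A
      by (intro exI[of _ A] exI[of _ 0] exI[of _ "1 / c'"] exI[of _ "- (m / c')"]) simp
    then show ?thesis ..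
  qed
qed

lemma classification:
  assumes f: "shabat f 0 1"
    and pass: "has_passport (shabat_tree f 0 1) (replicate_mset 3 4 + replicate_mset 8 1) (replicate_mset 10 2) 20"
  shows "shabat_equiv F1_poly 0 (- (1/64)) f 0 1 \<or> shabat_equiv F2_poly 0 (- (65536/9)) f 0 1"
proof -
  have fin: "finite {v. poly f v = 0}" "finite {v. poly f v = 1}"
    using shabat_vertices(1)[OF f] by (auto elim: finite_subset[rotated])
  have mb: "image_mset (\<lambda>v. Polynomial.order v f) (mset_set {v. poly f v = 0}) = replicate_mset 3 4 + replicate_mset 8 1"
    and mw: "image_mset (\<lambda>v. Polynomial.order v (f - 1)) (mset_set {v. poly f v = 1}) = replicate_mset 10 2"
    and deg: "degree f = 20"
    using pass unfolding passport_iff_orders[OF f] by auto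
  have "card {v \<in> {v. poly f v = 0}. Polynomial.order v f = 4} = 3"
    using image_mset_order_count[OF fin(1), of "\<lambda>v. Polynomial.order v f" 4] unfolding mb by simp
  then obtain a b c where abc: "{v \<in> {v. poly f v = 0}. Polynomial.order v f = 4} = {a, b, c}"
      "a \<noteq> b" "a \<noteq> c" "b \<noteq> c" unfolding card_3_iff by blast
  have o4: "Polynomial.order v f = 4" if "v \<in> {a, b, c}" for v using abc(1) that by blast
  have white: "Polynomial.order v (f - 1) = 2" if "poly (f - 1) v = 0" for v
  proof -
    have "Polynomial.order v (f - 1) \<in># image_mset (\<lambda>v. Polynomial.order v (f - 1)) (mset_set {v. poly f v = 1})"
      using that fin by auto
    then show ?thesis unfolding mw by (auto split: if_splits)
  qed
  have deg1: "degree (f - 1) = 20" using degree_diff_const[of f 1] deg by (simp add: one_pCons)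
  then have f1: "f - 1 \<noteq> 0" by auto
  define k where "k = lead_coeff (f - 1)"
  have k0: "k \<noteq> 0" using f1 leading_coeff_0_iff unfolding k_def by blast
  obtain w where w: "f - 1 = smult k (w ^ 2)" "lead_coeff w = 1" "degree (f - 1) = 2 * degree w"
    using monic_square[OF f1 white] unfolding k_def by metis
  have degw: "degree w = 10" using w(3) deg1 by simp
  \<comment> \<open>With this constant \<open>f = k * (w ^ 2 - s ^ 2)\<close> splits into two
    factors \<open>w - s\<close> and \<open>w + s\<close> without a common zero, so each root of
    order 4 belongs to one of them entirely.\<close>
  define s where "s = csqrt (- 1 / k)"
  have s: "s ^ 2 = - 1 / k" unfolding s_def by (rule power2_csqrt)
  have ks: "k * \<sigma> ^ 2 = - 1" and f_eq: "f = smult k ((w - [:\<sigma>:]) * (w + [:\<sigma>:]))" if "\<sigma> = s \<or> \<sigma> = - s" for \<sigma>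
  proof -
    have "\<sigma> ^ 2 = s ^ 2" using that by auto
    then show *: "k * \<sigma> ^ 2 = - 1" using s k0 by simp
    have "(w - [:\<sigma>:]) * (w + [:\<sigma>:]) = w ^ 2 - [:\<sigma> ^ 2:]" by (simp add: power2_eq_square algebra_simps)
    then have "smult k ((w - [:\<sigma>:]) * (w + [:\<sigma>:])) = smult k (w ^ 2) - [:k * \<sigma> ^ 2:]"
      by (simp add: smult_diff_right)
    also have "\<dots> = f" unfolding w(1)[symmetric] * by (simp add: one_pCons)
    finally show "f = smult k ((w - [:\<sigma>:]) * (w + [:\<sigma>:]))" ..
  qed
  have s0: "s \<noteq> 0" using ks[of s] by auto
  define D where "D v \<sigma> \<longleftrightarrow> [:- v, 1:] ^ 4 dvd w - [:\<sigma>:]" for v \<sigma>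
  have D: "D v s \<or> D v (- s)" if v: "v \<in> {a, b, c}" for v
  proof -
    let ?p = "w - [:s:]" and ?q = "w - [:- s:]"
    have "w + [:s:] = ?q" by simp
    then have fe: "f = smult k (?p * ?q)" using f_eq[of s] by metis
    have ne: "?p * ?q \<noteq> 0"
    proof
      assume "?p * ?q = 0"
      then have "f = 0" using fe by (metis smult_0_right)
      then show False using deg by simp
    qed
    have "Polynomial.order v (?p * ?q) = 4" using o4[OF v] k0 fe order_smult by metis
    then have sum: "Polynomial.order v ?p + Polynomial.order v ?q = 4" unfolding order_mult[OF ne] .
    have "poly ?q v = poly ?p v + 2 * s" by simp
    then have "poly ?p v \<noteq> 0 \<or> poly ?q v \<noteq> 0" using s0 by (metis add_0 mult_eq_0_iff zero_neq_numeral)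
    then have "Polynomial.order v ?p = 0 \<or> Polynomial.order v ?q = 0"
      by (rule disj_forward) (rule order_0I, assumption)+
    then have "Polynomial.order v ?p = 4 \<or> Polynomial.order v ?q = 4" using sum by linarith
    then show ?thesis unfolding D_def using Polynomial.order_1[of v ?p] Polynomial.order_1[of v ?q] by metis
  qed
  \<comment> \<open>Three fourth powers have degree 12, but each factor has degree 10.\<close>
  have no3: "\<not> (D a \<sigma> \<and> D b \<sigma> \<and> D c \<sigma>)" for \<sigma>
  proof
    assume "D a \<sigma> \<and> D b \<sigma> \<and> D c \<sigma>"
    then have "[:- a, 1:] ^ 4 * [:- b, 1:] ^ 4 * [:- c, 1:] ^ 4 dvd w - [:\<sigma>:]"
    proof (intro mult_linear_power_dvd)
      show "poly ([:- a, 1:] ^ 4) b \<noteq> 0" using abc(2) by simp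
      show "poly ([:- a, 1:] ^ 4 * [:- b, 1:] ^ 4) c \<noteq> 0" using abc(3,4) unfolding poly_mult by simp
    qed (simp_all only: D_def)
    moreover have d10: "degree (w - [:\<sigma>:]) = 10" using degree_diff_const[of w \<sigma>] degw by simp
    ultimately have "degree ([:- a, 1:] ^ 4 * [:- b, 1:] ^ 4 * [:- c, 1:] ^ 4) \<le> 10"
      by (metis dvd_imp_degree_le degree_0 zero_neq_numeral)
    then show False by (simp add: degree_mult_eq degree_power_eq)
  qed
  have core: ?thesis if "\<sigma> = s \<or> \<sigma> = - s" "D x \<sigma>" "D y \<sigma>" "D z (- \<sigma>)" "x \<noteq> y" "x \<noteq> z" "y \<noteq> z" for \<sigma> x y z
  proof (rule classification_core[OF ks[OF that(1)] degw w(2) f_eq[OF that(1)] that(5-7)])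
    have "w + [:\<sigma>:] = w - [:- \<sigma>:]" by simp
    then show "[:- z, 1:] ^ 4 dvd w + [:\<sigma>:]" using that(4) unfolding D_def by metis
  qed (use that(2,3) in \<open>simp_all only: D_def\<close>)
  have sym: "- (- s) = s" by simp
  \<comment> \<open>The three points are split as two and one between the factors; taking
    \<open>\<sigma>\<close> to be \<open>s\<close> or \<open>- s\<close> puts the pair into
    \<open>w - \<sigma>\<close>.\<close>
  show ?thesis
    using D[of a] D[of b] D[of c] no3[of s] no3[of "- s"] abc(2-4) core[of s] core[of "- s", unfolded sym]
    by (metis insertCI)
qed

section \<open>Symmetries of the plane acting on Shabat trees\<close>

text \<open>Branches of the inverse of \<open>g\<close> are carried to branches of the inverse of
  \<open>f\<close>. Agreement is asked for over the closed interval only, so that complex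
  conjugation qualifies: for a polynomial with real coefficients it preserves values just where they
  are real.\<close>

lemma edge_image:
  assumes f: "shabat f 0 1" and g: "shabat g 0 1" and \<phi>: "continuous_on UNIV \<phi>"
    and fg: "\<And>z. poly g z \<in> closed_segment 0 1 \<Longrightarrow> poly f (\<phi> z) = poly g z"
    and e: "e \<in> shabat_edges g 0 1"
  shows "\<phi> ` e \<in> shabat_edges f 0 1" "edge_end f 0 (\<phi> ` e) = \<phi> (edge_end g 0 e)"
proof -
  obtain \<gamma> where \<gamma>: "continuous_on I01 \<gamma>" "\<gamma> ` I01 = e" "\<And>t. t \<in> I01 \<Longrightarrow> poly g (\<gamma> t) = t"
    using shabat_edge_branch[OF g e] by metis
  have "(\<lambda>t. \<phi> (\<gamma> t)) ` I01 \<in> shabat_edges f 0 1"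
  proof (rule branch_is_component[OF f])
    show "continuous_on I01 (\<lambda>t. \<phi> (\<gamma> t))" by (rule continuous_on_compose2[OF \<phi> \<gamma>(1)]) simp
    show "poly f (\<phi> (\<gamma> t)) = t" if "t \<in> I01" for t
      using fg[of "\<gamma> t"] \<gamma>(3)[OF that] that segment_open_subset_closed by auto
  qed
  moreover have "(\<lambda>t. \<phi> (\<gamma> t)) ` I01 = \<phi> ` e" using \<gamma>(2) by auto
  ultimately show *: "\<phi> ` e \<in> shabat_edges f 0 1" by simp
  have "\<phi> ` closure e \<subseteq> closure (\<phi> ` e)"
    by (rule image_closure_subset) (use \<phi> in \<open>auto intro: continuous_on_subset closure_subset[THEN subsetD]\<close>)
  then have "\<phi> (edge_end g 0 e) \<in> closure (\<phi> ` e)" using edge_endD(3)[OF g e] by blast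
  moreover have "poly f (\<phi> (edge_end g 0 e)) = 0" using fg[of "edge_end g 0 e"] edge_endD(1)[OF g e] by simp
  ultimately show "edge_end f 0 (\<phi> ` e) = \<phi> (edge_end g 0 e)" using edge_end_black[OF f *] by blast
qed

text \<open>The map scales radii by \<open>cmod a\<close> and adds \<open>Arg a\<close> to all
  angles, hence preserves the counterclockwise order.\<close>

lemma next_ccw_affine:
  assumes a: "a \<noteq> 0" and K: "\<And>z. a * z + b \<in> K' \<longleftrightarrow> z \<in> K" and nx: "next_ccw K v e e'"
  shows "next_ccw K' (a * v + b) ((\<lambda>z. a * z + b) ` e) ((\<lambda>z. a * z + b) ` e')"
proof -
  obtain r where r: "r > 0" "\<And>\<epsilon>. 0 < \<epsilon> \<Longrightarrow> \<epsilon> < r \<Longrightarrow> \<exists>\<theta> \<phi>. \<phi> > 0 \<and> v + rcis \<epsilon> \<theta> \<in> e \<and> v + rcis \<epsilon> (\<theta> + \<phi>) \<in> e' \<and>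
        (\<forall>\<psi>. 0 < \<psi> \<and> \<psi> < \<phi> \<longrightarrow> v + rcis \<epsilon> (\<theta> + \<psi>) \<notin> K)"
    using nx unfolding next_ccw_def eventually_at_right_field by metis
  have rot: "a * v + b + rcis \<epsilon> (\<theta> + Arg a) = a * (v + rcis (\<epsilon> / cmod a) \<theta>) + b" for \<epsilon> \<theta>
  proof -
    have "a * rcis (\<epsilon> / cmod a) \<theta> = rcis (cmod a) (Arg a) * rcis (\<epsilon> / cmod a) \<theta>" by (simp add: rcis_cmod_Arg)
    also have "\<dots> = rcis \<epsilon> (\<theta> + Arg a)" unfolding rcis_mult using a by (simp add: add.commute)
    finally show ?thesis by (simp add: algebra_simps)
  qed
  have "\<exists>\<theta> \<phi>. \<phi> > 0 \<and> a * v + b + rcis \<epsilon> \<theta> \<in> (\<lambda>z. a * z + b) ` e \<and>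
      a * v + b + rcis \<epsilon> (\<theta> + \<phi>) \<in> (\<lambda>z. a * z + b) ` e' \<and>
      (\<forall>\<psi>. 0 < \<psi> \<and> \<psi> < \<phi> \<longrightarrow> a * v + b + rcis \<epsilon> (\<theta> + \<psi>) \<notin> K')"
    if \<epsilon>: "0 < \<epsilon>" "\<epsilon> < r * cmod a" for \<epsilon>
  proof -
    have "0 < \<epsilon> / cmod a" "\<epsilon> / cmod a < r" using \<epsilon> a by (simp_all add: field_simps)
    from r(2)[OF this] obtain \<theta> \<phi> where t: "\<phi> > 0" "v + rcis (\<epsilon> / cmod a) \<theta> \<in> e" "v + rcis (\<epsilon> / cmod a) (\<theta> + \<phi>) \<in> e'"
      "\<And>\<psi>. 0 < \<psi> \<Longrightarrow> \<psi> < \<phi> \<Longrightarrow> v + rcis (\<epsilon> / cmod a) (\<theta> + \<psi>) \<notin> K" by blast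
    have sh: "\<theta> + Arg a + x = (\<theta> + x) + Arg a" for x by simp
    show ?thesis
      by (rule exI[of _ "\<theta> + Arg a"], rule exI[of _ \<phi>]) (use t in \<open>auto simp: sh rot K\<close>)
  qed
  moreover have "r * cmod a > 0" using r(1) a by simp
  ultimately show ?thesis unfolding next_ccw_def eventually_at_right_field by blast
qed

text \<open>Conjugation negates angles, so the roles of \<open>e\<close> and \<open>e'\<close> are
  exchanged.\<close>

lemma next_ccw_cnj:
  assumes K: "\<And>z. cnj z \<in> K \<longleftrightarrow> z \<in> K" and nx: "next_ccw K v e e'"
  shows "next_ccw K (cnj v) (cnj ` e') (cnj ` e)"
proof -
  have rot: "cnj v + rcis \<epsilon> (- \<theta>) = cnj (v + rcis \<epsilon> \<theta>)" for \<epsilon> \<theta>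
    by (simp add: rcis_def cis_cnj)
  have "\<exists>\<theta> \<phi>. \<phi> > 0 \<and> cnj v + rcis \<epsilon> \<theta> \<in> cnj ` e' \<and> cnj v + rcis \<epsilon> (\<theta> + \<phi>) \<in> cnj ` e \<and>
      (\<forall>\<psi>. 0 < \<psi> \<and> \<psi> < \<phi> \<longrightarrow> cnj v + rcis \<epsilon> (\<theta> + \<psi>) \<notin> K)"
    if "\<exists>\<theta> \<phi>. \<phi> > 0 \<and> v + rcis \<epsilon> \<theta> \<in> e \<and> v + rcis \<epsilon> (\<theta> + \<phi>) \<in> e' \<and>
      (\<forall>\<psi>. 0 < \<psi> \<and> \<psi> < \<phi> \<longrightarrow> v + rcis \<epsilon> (\<theta> + \<psi>) \<notin> K)" for \<epsilon>
  proof -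
    obtain \<theta> \<phi> where t: "\<phi> > 0" "v + rcis \<epsilon> \<theta> \<in> e" "v + rcis \<epsilon> (\<theta> + \<phi>) \<in> e'"
      "\<And>\<psi>. 0 < \<psi> \<Longrightarrow> \<psi> < \<phi> \<Longrightarrow> v + rcis \<epsilon> (\<theta> + \<psi>) \<notin> K" using \<open>\<exists>\<theta> \<phi>. _ \<theta> \<phi>\<close> by blast
    show ?thesis
    proof (intro exI conjI allI impI)
      show "\<phi> > 0" by fact
      show "cnj v + rcis \<epsilon> (- (\<theta> + \<phi>)) \<in> cnj ` e'" unfolding rot using t(3) by (rule imageI)
      have "cnj v + rcis \<epsilon> (- (\<theta> + \<phi>) + \<phi>) = cnj (v + rcis \<epsilon> \<theta>)" using rot[of \<epsilon> \<theta>] by simp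
      then show "cnj v + rcis \<epsilon> (- (\<theta> + \<phi>) + \<phi>) \<in> cnj ` e" using t(2) by (metis imageI)
      fix \<psi> assume "0 < \<psi> \<and> \<psi> < \<phi>"
      then have "v + rcis \<epsilon> (\<theta> + (\<phi> - \<psi>)) \<notin> K" by (intro t(4)) auto
      moreover have "- (\<theta> + \<phi>) + \<psi> = - (\<theta> + (\<phi> - \<psi>))" by simp
      ultimately show "cnj v + rcis \<epsilon> (- (\<theta> + \<phi>) + \<psi>) \<notin> K" by (simp only: rot K not_False_eq_True)
    qed
  qed
  then show ?thesis using nx unfolding next_ccw_def by (rule eventually_mono[rotated])
qed

lemma shabat_affine:
  assumes f: "shabat f 0 1" and a: "a \<noteq> 0"
  shows "shabat (f \<circ>\<^sub>p [:b, a:]) 0 1"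
  using assms by (auto simp: shabat_def degree_pcompose pderiv_pcompose poly_pcompose pderiv_pCons)

lemma affine_rot:
  assumes f: "shabat f 0 1" and a: "a \<noteq> 0" and e: "e \<in> shabat_edges (f \<circ>\<^sub>p [:b, a:]) 0 1"
  defines "\<phi> \<equiv> \<lambda>z. a * z + b"
  shows "\<phi> ` e \<in> shabat_edges f 0 1"
    "edge_rot f 0 1 0 (\<phi> ` e) = \<phi> ` edge_rot (f \<circ>\<^sub>p [:b, a:]) 0 1 0 e"
    "edge_rot f 0 1 1 (\<phi> ` e) = \<phi> ` edge_rot (f \<circ>\<^sub>p [:b, a:]) 0 1 1 e"
proof -
  have cont: "continuous_on UNIV \<phi>" unfolding \<phi>_def by (intro continuous_intros)
  \<comment> \<open>Stated for an arbitrary \<open>f\<close>, so that \<open>1 - f\<close> yields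
    the white rotation.\<close>
  have black: "\<phi> ` e \<in> shabat_edges f 0 1"
    "edge_rot f 0 1 0 (\<phi> ` e) = \<phi> ` edge_rot (f \<circ>\<^sub>p [:b, a:]) 0 1 0 e"
    if f: "shabat f 0 1" and e: "e \<in> shabat_edges (f \<circ>\<^sub>p [:b, a:]) 0 1" for f
  proof -
    let ?g = "f \<circ>\<^sub>p [:b, a:]"
    have g: "shabat ?g 0 1" by (rule shabat_affine[OF f a])
    have fg: "poly f (\<phi> z) = poly ?g z" for z by (simp add: poly_pcompose \<phi>_def mult.commute add.commute)
    note im = edge_image[OF f g cont fg]
    show "\<phi> ` e \<in> shabat_edges f 0 1" by (rule im(1)[OF e])
    note ch = edge_rot_black_char[OF g e]
    have "\<phi> ` edge_rot ?g 0 1 0 e = edge_rot f 0 1 0 (\<phi> ` e)"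
    proof (rule edge_rot_black_char(3)[OF f im(1)[OF e] im(1)[OF ch(1)]])
      show "next_ccw (poly f -` closed_segment 0 1) (edge_end f 0 (\<phi> ` e)) (\<phi> ` e) (\<phi> ` edge_rot ?g 0 1 0 e)"
        unfolding im(2)[OF e] unfolding \<phi>_def
        by (rule next_ccw_affine[OF a _ ch(2)]) (use fg in \<open>simp add: \<phi>_def\<close>)
    qed
    then show "edge_rot f 0 1 0 (\<phi> ` e) = \<phi> ` edge_rot ?g 0 1 0 e" ..
  qed
  show "\<phi> ` e \<in> shabat_edges f 0 1"
    "edge_rot f 0 1 0 (\<phi> ` e) = \<phi> ` edge_rot (f \<circ>\<^sub>p [:b, a:]) 0 1 0 e" using black[OF f e] .
  have comp: "(1 - f) \<circ>\<^sub>p [:b, a:] = 1 - f \<circ>\<^sub>p [:b, a:]" by (simp add: pcompose_diff pcompose_1)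
  show "edge_rot f 0 1 1 (\<phi> ` e) = \<phi> ` edge_rot (f \<circ>\<^sub>p [:b, a:]) 0 1 1 e"
    using black(2)[OF shabat_complement[OF f]] e
    unfolding comp shabat_edges_complement edge_rot_complement by blast
qed

text \<open>Taking images is injective on edges, and both trees have \<open>degree f\<close> edges,
  so it is a bijection between them.\<close>

lemma affine_tree_iso:
  assumes f: "shabat f 0 1" and a: "a \<noteq> 0"
  shows "tree_iso (shabat_tree (f \<circ>\<^sub>p [:b, a:]) 0 1) (shabat_tree f 0 1)"
proof -
  let ?g = "f \<circ>\<^sub>p [:b, a:]"
  define \<phi> where "\<phi> z = a * z + b" for z
  have \<phi>: "\<phi> = (\<lambda>z. a * z + b)" by (simp add: \<phi>_def fun_eq_iff)
  have g: "shabat ?g 0 1" by (rule shabat_affine[OF f a])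
  note rot = affine_rot[OF f a, of _ b, folded \<phi>]
  have "inj \<phi>" using a by (auto simp: inj_def \<phi>_def)
  then have "inj_on ((`) \<phi>) (shabat_edges ?g 0 1)" by (auto simp: inj_on_def inj_image_eq_iff)
  moreover have "((`) \<phi>) ` shabat_edges ?g 0 1 \<subseteq> shabat_edges f 0 1" using rot(1) by auto
  moreover have "card (shabat_edges ?g 0 1) = card (shabat_edges f 0 1)"
    using card_shabat_edges(1)[OF f] card_shabat_edges(1)[OF g] a by (simp add: degree_pcompose)
  ultimately have "bij_betw ((`) \<phi>) (shabat_edges ?g 0 1) (shabat_edges f 0 1)"
    using card_shabat_edges(2)[OF f] by (metis bij_betw_def card_image card_subset_eq)
  then show ?thesis
    by (intro tree_isoI[OF shabat_tree_is_tree[OF g] shabat_tree_is_tree[OF f], of "(`) \<phi>"])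
       (simp_all add: shabat_tree_def rot)
qed

lemma shabat_tree_general:
  assumes "shabat F c1 c2"
  shows "shabat (normalized F c1 c2) 0 1" "shabat_tree F c1 c2 = shabat_tree (normalized F c1 c2) 0 1"
    "bicolored_plane_tree (shabat_tree F c1 c2)"
proof -
  have ne: "c1 \<noteq> c2" using assms by (simp add: shabat_def)
  show 1: "shabat (normalized F c1 c2) 0 1" using assms shabat_normalized[OF ne] by simp
  show 2: "shabat_tree F c1 c2 = shabat_tree (normalized F c1 c2) 0 1" using shabat_tree_normalized[OF ne] by simp
  show "bicolored_plane_tree (shabat_tree F c1 c2)" unfolding 2 by (rule shabat_tree_is_tree[OF 1])
qed

text \<open>Normalizing cancels the affine map on the values, which leaves the change of
  variable.\<close>

lemma shabat_equiv_imp_tree_iso: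
  assumes F: "shabat F c11 c12" and eq: "shabat_equiv F c11 c12 G c21 c22"
  shows "tree_iso (shabat_tree G c21 c22) (shabat_tree F c11 c12)"
proof -
  obtain A B a b where e: "A \<noteq> 0" "a \<noteq> 0" "G = smult A (F \<circ>\<^sub>p [:b, a:]) + [:B:]" "c21 = A * c11 + B" "c22 = A * c12 + B"
    using eq unfolding shabat_equiv_def by blast
  have ne: "c11 \<noteq> c12" using F by (simp add: shabat_def)
  have ne': "c21 \<noteq> c22" using ne e by simp
  have "normalized G c21 c22 = normalized F c11 c12 \<circ>\<^sub>p [:b, a:]"
  proof (rule poly_eq_poly_eq_iff[THEN iffD1], rule ext)
    fix x
    have "c22 - c21 = A * (c12 - c11)" using e by (simp add: algebra_simps)
    moreover have "poly G x - c21 = A * (poly F (b + x * a) - c11)" using e by (simp add: poly_pcompose algebra_simps)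
    ultimately show "poly (normalized G c21 c22) x = poly (normalized F c11 c12 \<circ>\<^sub>p [:b, a:]) x"
      using e(1) by (simp add: poly_normalized poly_pcompose)
  qed
  then show ?thesis
    using affine_tree_iso[OF shabat_tree_general(1)[OF F] e(2), of b]
      shabat_tree_general(2)[OF F] shabat_tree_normalized[OF ne', of G] by simp
qed

lemma shabat_equiv_from_normalized:
  assumes "c1 \<noteq> c2" and "shabat_equiv F 0 c (normalized G c1 c2) 0 1"
  shows "shabat_equiv F 0 c G c1 c2"
proof -
  obtain A B a b where e: "A \<noteq> 0" "a \<noteq> 0" "normalized G c1 c2 = smult A (F \<circ>\<^sub>p [:b, a:]) + [:B:]" "0 = A * 0 + B" "1 = A * c + B"
    using assms(2) unfolding shabat_equiv_def by blast
  have B: "B = 0" and Ac: "A * c = 1" using e by simp_all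
  have "G = smult (c2 - c1) (normalized G c1 c2) + [:c1:]" using assms(1) by (simp add: normalized_def)
  also have "\<dots> = smult ((c2 - c1) * A) (F \<circ>\<^sub>p [:b, a:]) + [:c1:]" unfolding e(3) B by simp
  finally have G: "G = smult ((c2 - c1) * A) (F \<circ>\<^sub>p [:b, a:]) + [:c1:]" .
  have "c2 = (c2 - c1) * A * c + c1" using Ac by (simp add: mult.assoc)
  then show ?thesis unfolding shabat_equiv_def
    using G e(1,2) assms(1)
    by (intro exI[of _ "(c2 - c1) * A"] exI[of _ c1] exI[of _ a] exI[of _ b]) auto
qed

section \<open>Telling the two trees apart\<close>

lemma shabat_tree_passport_tree:
  assumes "shabat F c1 c2"
    and "has_passport (shabat_tree F c1 c2) (replicate_mset 3 4 + replicate_mset 8 1) (replicate_mset 10 2) 20"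
  shows "(\<exists>L. numbered white_adj (shabat_tree F c1 c2) L) \<or> (\<exists>L. numbered white_opp (shabat_tree F c1 c2) L)"
  using passport_tree.numbering_exists[OF passport_tree.intro] shabat_tree_general(3)[OF assms(1)] assms(2) by blast

text \<open>The symmetry \<open>z \<mapsto> -1 - z\<close> of \<open>F1_poly\<close> fixes no edge, while the adjacent tree is rigid.\<close>

lemma F1_opp: "\<exists>L. numbered white_opp (shabat_tree F1_poly 0 (- (1/64))) L"
proof (rule ccontr)
  assume "\<not> ?thesis"
  then obtain L where L: "numbered white_adj (shabat_tree F1_poly 0 (- (1/64))) L"
    using shabat_tree_passport_tree[OF F1_shabat F1_passport] by blast
  define f where "f = normalized F1_poly 0 (- (1/64))"
  note gen = shabat_tree_general[OF F1_shabat, folded f_def]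
  note L = L[unfolded gen(2)]
  define \<phi> :: "complex \<Rightarrow> complex" where "\<phi> z = - 1 * z + - 1" for z
  have \<phi>: "\<phi> = (\<lambda>z. - 1 * z + - 1)" by (simp add: \<phi>_def fun_eq_iff)
  \<comment> \<open>\<open>P_poly\<close> is a polynomial in \<open>z ^ 2 + z\<close>, which the
    symmetry preserves.\<close>
  have P: "poly P_poly (- 1 - z) = poly P_poly z" for z
    unfolding poly_P by (simp add: power2_eq_square algebra_simps)
  have ff: "f \<circ>\<^sub>p [:- 1, - 1:] = f"
    by (intro poly_eq_poly_eq_iff[THEN iffD1] ext) (simp add: poly_pcompose f_def poly_normalized F1_eq P)
  have m1: "(- 1 :: complex) \<noteq> 0" by simp
  note rot = affine_rot[OF gen(1) m1, of _ "- 1", unfolded ff, folded \<phi>]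
  have "inj \<phi>" by (auto simp: inj_def \<phi>_def)
  have "\<phi> ` (L ! 0) = L ! 0"
  proof (rule adj_rigid[OF L])
    show "(`) \<phi> ` edges (shabat_tree f 0 1) \<subseteq> edges (shabat_tree f 0 1)"
      using rot(1) by (auto simp: shabat_tree_def)
    show "inj_on ((`) \<phi>) (edges (shabat_tree f 0 1))" using \<open>inj \<phi>\<close> by (auto simp: inj_on_def inj_image_eq_iff)
  qed (use rot tree_rot_in_edges(1,3)[OF gen(3)[unfolded gen(2)]] in \<open>auto simp: shabat_tree_def\<close>)
  moreover have e: "L ! 0 \<in> shabat_edges f 0 1" using numbered_nth(2)[OF L, of 0] by (simp add: shabat_tree_def)
  moreover obtain x where x: "x \<in> L ! 0" using shabat_edge_facts(4)[OF gen(1) e] by auto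
  \<comment> \<open>\<open>x\<close> and \<open>\<phi> x\<close> lie on one edge and have the same
    value, so they coincide; but the only fixed point of \<open>\<phi>\<close> is -1/2, a black
    vertex.\<close>
  ultimately have "\<phi> x \<in> L ! 0" by blast
  moreover have "poly [:- 1, - 1:] x = \<phi> x" by (simp add: \<phi>_def)
  then have "poly f (\<phi> x) = poly f x" by (metis ff poly_pcompose)
  ultimately have "\<phi> x = x" using shabat_edge_facts(1)[OF gen(1) e] x by (auto simp: inj_on_def)
  then have "2 * x = - 1" unfolding \<phi>_def by (metis add_diff_cancel_left' diff_eq_eq diff_minus_eq_add mult_2 mult_minus1)
  then have "x = - 1/2" by (simp add: field_simps)
  then have "poly f x = 0" by (simp add: f_def poly_normalized F1_eq poly_P power2_eq_square)
  moreover have "poly f x \<in> I01" using shabat_edge_facts(2)[OF gen(1) e] x by blast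
  ultimately show False by (simp add: I01_iff)
qed

text \<open>\<open>R_poly - 512/3\<close> has a root of order 4 at 1, and its cofactor is positive
  on the real line; hence \<open>R_poly\<close> is at least 512/3 there.\<close>

lemma F2_nonneg_on_reals:
  obtains y where "y \<ge> 0" "poly F2_poly (of_real x) = of_real y"
proof -
  define t where "t = x - 1"
  define r where "r = (x ^ 2 + 3) ^ 4 * (x ^ 2 - 10/3 * x + 3)"
  \<comment> \<open>The expansion at 1 with completed squares; the constants left over,
    \<open>90 - 1440/17\<close> and \<open>160 - 4608/35\<close>, are positive.\<close>
  have "r - 512/3 = t ^ 4 * (t ^ 4 * (t + 10/3) ^ 2 + t ^ 2 * (170/9 * (t + 36/17) ^ 2 + 90 - 1440/17) + (70 * (t + 48/35) ^ 2 + 160 - 4608/35))"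
    unfolding r_def t_def by algebra
  also have "\<dots> \<ge> 0" by (intro mult_nonneg_nonneg add_nonneg_nonneg) (auto intro!: add_nonneg_nonneg simp: add_diff_eq[symmetric])
  finally have r: "r \<ge> 512/3" by simp
  have R: "poly R_poly (of_real x) = of_real r" by (simp add: poly_R r_def)
  show thesis
  proof
    show "0 \<le> r * (r - 512/3)" using r by simp
    show "poly F2_poly (of_real x) = of_real (r * (r - 512/3))" by (simp add: F2_eq R)
  qed
qed

text \<open>
  Conjugation reverses the rotations of the tree of \<open>F2_poly\<close> and fixes no edge, because
  \<open>F2_poly\<close> is nonnegative on the reals while its nonzero critical value is negative.
\<close>

lemma F2_adj: "\<exists>L. numbered white_adj (shabat_tree F2_poly 0 (- (65536/9))) L"
proof (rule ccontr)
  assume "\<not> ?thesis"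
  then obtain L where L: "numbered white_opp (shabat_tree F2_poly 0 (- (65536/9))) L"
    using shabat_tree_passport_tree[OF F2_shabat F2_passport] by blast
  define f where "f = normalized F2_poly 0 (- (65536/9))"
  note gen = shabat_tree_general[OF F2_shabat, folded f_def]
  note L = L[unfolded gen(2)]
  let ?T = "shabat_tree f 0 1"
  have T: "bicolored_plane_tree ?T" using gen by simp
  have cn: "poly f (cnj z) = cnj (poly f z)" for z
    by (simp add: f_def poly_normalized F2_eq poly_R)
  have cont: "continuous_on UNIV cnj" by (intro continuous_intros)
  \<comment> \<open>For an arbitrary \<open>f\<close> again, because the white rotation is treated
    through \<open>1 - f\<close>.\<close>
  have rev: "cnj ` e \<in> shabat_edges f 0 1 \<and> edge_rot f 0 1 0 (cnj ` edge_rot f 0 1 0 e) = cnj ` e"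
    if f: "shabat f 0 1" and cn: "\<And>z. poly f (cnj z) = cnj (poly f z)" and e: "e \<in> shabat_edges f 0 1" for f e
  proof -
    have fg: "poly f (cnj z) = poly f z" if "poly f z \<in> closed_segment 0 1" for z
      using that cn[of z] by (auto simp: closed01_iff complex_eq_iff)
    have im: "cnj ` e' \<in> shabat_edges f 0 1" "edge_end f 0 (cnj ` e') = cnj (edge_end f 0 e')"
      if "e' \<in> shabat_edges f 0 1" for e'
      by (rule edge_image[OF f f cont _ that], rule fg, assumption)+
    note ch = edge_rot_black_char[OF f e]
    have K: "cnj z \<in> poly f -` closed_segment 0 1 \<longleftrightarrow> z \<in> poly f -` closed_segment 0 1" for z
      by (simp add: cn closed01_iff)
    have "cnj ` e = edge_rot f 0 1 0 (cnj ` edge_rot f 0 1 0 e)"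
    proof (rule edge_rot_black_char(3)[OF f im(1)[OF ch(1)] im(1)[OF e]])
      show "next_ccw (poly f -` closed_segment 0 1) (edge_end f 0 (cnj ` edge_rot f 0 1 0 e)) (cnj ` edge_rot f 0 1 0 e) (cnj ` e)"
        unfolding im(2)[OF ch(1)] ch(4) by (rule next_ccw_cnj[OF K ch(2)])
    qed
    then show ?thesis using im(1)[OF e] by simp
  qed
  note black = rev[OF gen(1) cn]
  have cn': "poly (1 - f) (cnj z) = cnj (poly (1 - f) z)" for z by (simp add: cn)
  note white = rev[OF shabat_complement[OF gen(1)] cn', unfolded shabat_edges_complement edge_rot_complement]
  interpret passport_tree ?T
    using T F2_passport unfolding gen(2) by (rule passport_tree.intro)
  have E: "edges ?T = shabat_edges f 0 1" "black_rot ?T = edge_rot f 0 1 0" "white_rot ?T = edge_rot f 0 1 1"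
    by (simp_all add: shabat_tree_def)
  have "\<exists>e\<in>edges ?T. cnj ` e = e"
  proof (rule opp_reversal_fixed_edge[OF L])
    show "(`) cnj ` edges ?T \<subseteq> edges ?T" using black by (auto simp: E)
    show "inj_on ((`) cnj) (edges ?T)" by (auto simp: inj_on_def inj_image_eq_iff)
    show "black_rot ?T (cnj ` black_rot ?T e) = cnj ` e" if "e \<in> edges ?T" for e using black that by (auto simp: E)
    \<comment> \<open>White vertices have degree 2, so the white rotation is an involution, and
      reversing it is the same as preserving it.\<close>
    show "white_rot ?T (cnj ` e) = cnj ` white_rot ?T e" if e: "e \<in> edges ?T" for e
    proof -
      have "white_rot ?T (cnj ` white_rot ?T e) = cnj ` e" using white e by (auto simp: E)
      moreover have "cnj ` white_rot ?T e \<in> edges ?T" using black white_rot(4)[OF e] by (auto simp: E)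
      ultimately show ?thesis using white_rot(1) by metis
    qed
    show "black_rot ?T e \<in> edges ?T" "white_rot ?T e \<in> edges ?T" if "e \<in> edges ?T" for e
      using rot[OF that] by simp_all
    show "inj_on (black_rot ?T) (edges ?T)"
    proof (rule eq_card_imp_inj_on[OF fin(3)])
      have "black_rot ?T ` edges ?T = edges ?T"
      proof (intro set_eqI iffI)
        fix e assume "e \<in> black_rot ?T ` edges ?T"
        then show "e \<in> edges ?T" using rot(1) by auto
      next
        fix e assume e: "e \<in> edges ?T"
        have "cnj ` cnj ` e = e" by (simp add: image_image)
        moreover have "cnj ` e \<in> edges ?T" using black e by (auto simp: E)
        moreover from this have "cnj ` black_rot ?T (cnj ` e) \<in> edges ?T" using black rot(1) by (auto simp: E)
        ultimately show "e \<in> black_rot ?T ` edges ?T" using black[of "cnj ` e"] by (metis E(1,2) imageI)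
      qed
      then show "card (black_rot ?T ` edges ?T) = card (edges ?T)" by simp
    qed
  qed
  then obtain e where e: "e \<in> shabat_edges f 0 1" "cnj ` e = e" by (auto simp: E)
  obtain z where z: "z \<in> e" using shabat_edge_facts(4)[OF gen(1) e(1)] by auto
  have zI: "poly f z \<in> I01" using shabat_edge_facts(2)[OF gen(1) e(1)] z by blast
  then have "poly f (cnj z) = poly f z" by (simp add: cn I01_iff complex_eq_iff)
  moreover have "cnj z \<in> e" using e(2) z by blast
  ultimately have "cnj z = z" using shabat_edge_facts(1)[OF gen(1) e(1)] z by (auto simp: inj_on_def)
  then have "z = of_real (Re z)" by (simp add: complex_eq_iff)
  then obtain y where "y \<ge> 0" "poly F2_poly z = of_real y" using F2_nonneg_on_reals by metis
  \<comment> \<open>Normalizing divides the nonnegative value by the negative number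
    -65536/9.\<close>
  then have "Re (poly f z) \<le> 0" by (simp add: f_def poly_normalized)
  then show False using zI by (simp add: I01_iff)
qed

theorem lemma9p3:
  defines "F1 \<equiv> Q1_poly \<circ>\<^sub>p P_poly"
    and "F2 \<equiv> Q2_poly \<circ>\<^sub>p R_poly"
    and "\<alpha> \<equiv> replicate_mset 3 4 + replicate_mset 8 (1::nat)"
    and "\<beta> \<equiv> replicate_mset 10 (2::nat)"
  shows "\<exists>c d. shabat F1 0 c \<and> shabat F2 0 d \<and>
    bicolored_plane_tree (shabat_tree F1 0 c) \<and> has_passport (shabat_tree F1 0 c) \<alpha> \<beta> 20 \<and>
    bicolored_plane_tree (shabat_tree F2 0 d) \<and> has_passport (shabat_tree F2 0 d) \<alpha> \<beta> 20 \<and>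
    \<not> tree_iso (shabat_tree F1 0 c) (shabat_tree F2 0 d) \<and>
    (\<forall>T :: ('v, 'e) bicolored_map. bicolored_plane_tree T \<and> has_passport T \<alpha> \<beta> 20 \<longrightarrow>
       tree_iso (shabat_tree F1 0 c) T \<or> tree_iso (shabat_tree F2 0 d) T) \<and>
    (\<forall>G c1 c2. shabat G c1 c2 \<longrightarrow>
       (tree_iso (shabat_tree G c1 c2) (shabat_tree F1 0 c) \<longleftrightarrow> shabat_equiv F1 0 c G c1 c2) \<and>
       (tree_iso (shabat_tree G c1 c2) (shabat_tree F2 0 d) \<longleftrightarrow> shabat_equiv F2 0 d G c1 c2))"
proof -
  have F: "F1 = F1_poly" "F2 = F2_poly" by (simp_all add: F1_def F2_def F1_poly_def F2_poly_def)
  let ?T1 = "shabat_tree F1_poly 0 (- (1/64))" and ?T2 = "shabat_tree F2_poly 0 (- (65536/9))"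
  note t1 = shabat_tree_general(3)[OF F1_shabat] and t2 = shabat_tree_general(3)[OF F2_shabat]
  obtain L1 where L1: "numbered white_opp ?T1 L1" using F1_opp by blast
  obtain L2 where L2: "numbered white_adj ?T2 L2" using F2_adj by blast
  have ni: "\<not> tree_iso ?T2 ?T1" by (rule adj_not_iso_opp[OF L2 L1 t2])
  then have ni': "\<not> tree_iso ?T1 ?T2" using tree_iso_sym[OF t1 t2] by blast
  have all: "tree_iso ?T1 T \<or> tree_iso ?T2 T" if T: "bicolored_plane_tree T" "has_passport T \<alpha> \<beta> 20" for T :: "('v, 'e) bicolored_map"
  proof -
    have "(\<exists>L. numbered white_adj T L) \<or> (\<exists>L. numbered white_opp T L)"
      by (rule passport_tree.numbering_exists[OF passport_tree.intro]) (use T in \<open>simp_all add: \<alpha>_def \<beta>_def\<close>)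
    then show ?thesis
      using numbered_iso[OF t1 T(1) L1 _ table_less(3)] numbered_iso[OF t2 T(1) L2 _ table_less(2)] by blast
  qed
  have G: "(tree_iso (shabat_tree G c1 c2) ?T1 \<longleftrightarrow> shabat_equiv F1_poly 0 (- (1/64)) G c1 c2) \<and>
       (tree_iso (shabat_tree G c1 c2) ?T2 \<longleftrightarrow> shabat_equiv F2_poly 0 (- (65536/9)) G c1 c2)"
    if G: "shabat G c1 c2" for G c1 c2
  proof -
    note tG = shabat_tree_general[OF G]
    have ne: "c1 \<noteq> c2" using G by (simp add: shabat_def)
    \<comment> \<open>The isomorphism transports the passport to \<open>G\<close>, and only the two
      compositions are possible for this passport.\<close>
    have one: "shabat_equiv F1_poly 0 (- (1/64)) G c1 c2 \<or> shabat_equiv F2_poly 0 (- (65536/9)) G c1 c2"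
      if "tree_iso (shabat_tree G c1 c2) ?T1 \<or> tree_iso (shabat_tree G c1 c2) ?T2"
    proof -
      have "has_passport (shabat_tree G c1 c2) (replicate_mset 3 4 + replicate_mset 8 1) (replicate_mset 10 2) 20"
        using that tree_iso_passport[OF tG(3) _ F1_passport] tree_iso_passport[OF tG(3) _ F2_passport] by blast
      then show ?thesis
        using classification[OF tG(1)] shabat_equiv_from_normalized[OF ne] unfolding tG(2) by blast
    qed
    have i1: "tree_iso (shabat_tree G c1 c2) ?T1" if "shabat_equiv F1_poly 0 (- (1/64)) G c1 c2"
      by (rule shabat_equiv_imp_tree_iso[OF F1_shabat that])
    have i2: "tree_iso (shabat_tree G c1 c2) ?T2" if "shabat_equiv F2_poly 0 (- (65536/9)) G c1 c2"
      by (rule shabat_equiv_imp_tree_iso[OF F2_shabat that])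
    \<comment> \<open>This turns the disjunction in \<open>one\<close> into two separate claims:
      equivalence to the other composition would give an isomorphism to the other tree as
      well.\<close>
    have "\<not> (tree_iso (shabat_tree G c1 c2) ?T1 \<and> tree_iso (shabat_tree G c1 c2) ?T2)"
      using ni tree_iso_trans tree_iso_sym[OF tG(3) t2] by blast
    then show ?thesis using one i1 i2 by blast
  qed
  show ?thesis
    unfolding F
    by (intro exI[of _ "- (1/64)"] exI[of _ "- (65536/9)"] conjI allI impI F1_shabat F2_shabat t1 t2 ni')
      (use F1_passport F2_passport all G in \<open>auto simp: \<alpha>_def \<beta>_def\<close>)
qed

end
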